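(* Let $G$ be a connected unicyclic graph with a cycle of size $c$, and let $\lambda_{\mathrm{lead}}$ be the leading partition in the star-expansion of $\mathbf{X}_G$. If $G$ has exactly one non-trivial rooted tree, then the number of leaves in $G$ is equal to $|\lambda_{\mathrm{lead}}|-\ell(\lambda_{\mathrm{lead}})-1$. If $G$ has at least two non-trivial rooted trees, then the number of leaves in $G$ is equal to $|\lambda_{\mathrm{lead}}|-\ell(\lambda_{\mathrm{lead}})$.
   Context: All graphs are finite and simple. The chromatic symmetric function of a graph $G$ with vertices $v_1,\dots,v_n$ is $\mathbf{X}_G=\sum_\kappa x_{\kappa(v_1)}\cdots x_{\kappa(v_n)}$, summed over all proper colorings $\kappa:V(G)\to\mathbb{N}$. The star graph $\mathsf{St}_k$ on $k$ vertices is the tree with one central vertex adjacent to $k-1$ leaves ($\mathsf{St}_1$ is a single vertex); $\mathfrak{st}_k:=\mathbf{X}_{\mathsf{St}_k}$, and for a partition $\lambda=(\lambda_1,\dots,\lambda_\ell)$, $\mathfrak{st}_\lambda:=\mathfrak{st}_{\lambda_1}\cdots\mathfrak{st}_{\lambda_\ell}$. The set $\{\mathfrak{st}_\lambda:\lambda\vdash n\}$ is a $\mathbb{Q}$-basis (the star-basis) of the space of homogeneous symmetric functions of degree $n$, so $\mathbf{X}_G=\sum_{\lambda\vdash n}c_\lambda\mathfrak{st}_\lambda$ with uniquely determined coefficients $c_\lambda$ (the star-expansion). Partitions of $n$ are ordered lexicographically: $\mu\le\lambda$ if $\mu=\lambda$ or, for some $j$, $\mu_i=\lambda_i$ for $i<j$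 and $\mu_j<\lambda_j$. The leading partition $\lambda_{\mathrm{lead}}$ is the smallest partition $\lambda$ in lexicographic order with $c_\lambda\ne0$. For a partition $\lambda$, $|\lambda|$ is the sum of its parts and $\ell(\lambda)$ its number of parts. A unicyclic graph is a graph containing exactly one cycle. If $G$ is connected unicyclic with cycle vertices $v_1,\dots,v_c$, then deleting the edges of the cycle leaves $c$ trees $T_1,\dots,T_c$ with $T_i$ containing (and rooted at) $v_i$; $T_i$ is non-trivial if it has more than one vertex. A leaf is a vertex of degree one. *)

theory Defs
  imports Complex_Main "HOL-Library.Multiset" "HOL-Library.FuncSet" "HOL-Library.List_Lexorder"
begin

section \<open>Finite simple graphs\<close>

type_synonym 'a graph = "'a set \<times> 'a set set"

abbreviation verts :: "'a graph \<Rightarrow> 'a set" where "verts \<equiv> fst"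
abbreviation edges :: "'a graph \<Rightarrow> 'a set set" where "edges \<equiv> snd"

definition simple_graph :: "'a graph \<Rightarrow> bool" where
  "simple_graph G \<longleftrightarrow> finite (verts G) \<and> (\<forall>e \<in> edges G. e \<subseteq> verts G \<and> card e = 2)"

definition adj_rel :: "'a graph \<Rightarrow> ('a \<times> 'a) set" where
  "adj_rel G = {(u, v). {u, v} \<in> edges G}"

definition connected_graph :: "'a graph \<Rightarrow> bool" where
  "connected_graph G \<longleftrightarrow>
     verts G \<noteq> {} \<and> (\<forall>u \<in> verts G. \<forall>v \<in> verts G. (u, v) \<in> (adj_rel G)\<^sup>*)"

definition component_of :: "'a graph \<Rightarrow> 'a \<Rightarrow> 'a graph" where
  "component_of G v =
     (let W = {u \<in> verts G. (v, u) \<in> (adj_rel G)\<^sup>*} in (W, {e \<in> edges G. e \<subseteq> W}))"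

definition degree :: "'a graph \<Rightarrow> 'a \<Rightarrow> nat" where
  "degree G v = card {e \<in> edges G. v \<in> e}"

definition leaves :: "'a graph \<Rightarrow> 'a set" where
  "leaves G = {v \<in> verts G. degree G v = 1}"

definition cycle_graph :: "'a list \<Rightarrow> 'a graph" where
  "cycle_graph vs = (set vs, {{vs ! i, vs ! (Suc i mod length vs)} | i. i < length vs})"

text \<open>A cycle is a subgraph, so the choice of starting vertex and of direction is immaterial when
  cycles are counted.\<close>

definition is_cycle_in :: "'a graph \<Rightarrow> 'a graph \<Rightarrow> bool" where
  "is_cycle_in C G \<longleftrightarrow>
     (\<exists>vs. distinct vs \<and> 3 \<le> length vs \<and> C = cycle_graph vs) \<and>
     verts C \<subseteq> verts G \<and> edges C \<subseteq> edges G"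

definition unicyclic :: "'a graph \<Rightarrow> bool" where
  "unicyclic G \<longleftrightarrow> (\<exists>!C. is_cycle_in C G)"

definition rooted_tree :: "'a graph \<Rightarrow> 'a graph \<Rightarrow> 'a \<Rightarrow> 'a graph" where
  "rooted_tree G C v = component_of (verts G, edges G - edges C) v"

text \<open>The rooted trees have pairwise distinct roots and are therefore counted by their roots.\<close>

definition nontrivial_roots :: "'a graph \<Rightarrow> 'a graph \<Rightarrow> 'a set" where
  "nontrivial_roots G C = {v \<in> verts C. card (verts (rooted_tree G C v)) > 1}"

section \<open>Chromatic symmetric functions\<close>

text \<open>A formal power series over the rationals in variables x_0, x_1, x_2, ... is the function
  giving its coefficients; a monomial is the multiset of the indices of its variables.\<close>

type_synonym series = "nat multiset \<Rightarrow> rat"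

definition series_one :: series where
  "series_one m = (if m = {#} then 1 else 0)"

definition series_mult :: "series \<Rightarrow> series \<Rightarrow> series" where
  "series_mult f g m = (\<Sum>a \<in> {a. a \<subseteq># m}. f a * g (m - a))"

definition proper_colorings :: "'a graph \<Rightarrow> ('a \<Rightarrow> nat) set" where
  "proper_colorings G =
     {\<kappa> \<in> verts G \<rightarrow>\<^sub>E UNIV. \<forall>u v. {u, v} \<in> edges G \<longrightarrow> \<kappa> u \<noteq> \<kappa> v}"

text \<open>The coloring \<open>\<kappa>\<close> contributes the monomial whose variable indices are its values,
  taken with multiplicity.\<close>

definition chromatic_sf :: "'a graph \<Rightarrow> series" where
  "chromatic_sf G m =
     of_nat (card {\<kappa> \<in> proper_colorings G. image_mset \<kappa> (mset_set (verts G)) = m})"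

definition star_graph :: "nat \<Rightarrow> nat graph" where
  "star_graph k = ({0..<k}, {{0, i} | i. 1 \<le> i \<and> i < k})"

definition star_sf :: "nat list \<Rightarrow> series" where
  "star_sf lam = foldr (\<lambda>k. series_mult (chromatic_sf (star_graph k))) lam series_one"

section \<open>Star-expansion and leading partition\<close>

definition partitions :: "nat \<Rightarrow> nat list set" where
  "partitions n = {lam. sorted (rev lam) \<and> 0 \<notin> set lam \<and> sum_list lam = n}"

definition is_star_expansion :: "'a graph \<Rightarrow> (nat list \<Rightarrow> rat) \<Rightarrow> bool" where
  "is_star_expansion G c \<longleftrightarrow>
     (\<forall>lam. lam \<notin> partitions (card (verts G)) \<longrightarrow> c lam = 0) \<and>
     (\<forall>m. chromatic_sf G m = (\<Sum>lam \<in> partitions (card (verts G)). c lam * star_sf lam m))"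

definition star_coeff :: "'a graph \<Rightarrow> nat list \<Rightarrow> rat" where
  "star_coeff G = (THE c. is_star_expansion G c)"

text \<open>The minimum is with respect to the lexicographic order on lists from
  \<^theory>\<open>HOL-Library.List_Lexorder\<close>. That order also compares a list with its proper
  prefixes, but no partition of a number is a proper prefix of another partition of it.\<close>

definition leading_partition :: "'a graph \<Rightarrow> nat list" where
  "leading_partition G = Min {lam \<in> partitions (card (verts G)). star_coeff G lam \<noteq> 0}"

end

theory Submission
  imports Defs "HOL-Library.Multiset_Order" "HOL-Library.Disjoint_Sets"
begin

text \<open>
  Let \<open>V'\<close> be the set of vertices that are not leaves, \<open>E'\<close> the set of edges between them, and \<open>n v\<close> the
  number of leaves attached to \<open>v\<close>. Inclusion--exclusion over \<open>S \<subseteq> E'\<close> writes the chromatic symmetric function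
  as a signed sum of products over the components of \<open>(V', S)\<close>, the factor of a component being the
  series of a monochromatic block of \<open>k\<close> vertices with \<open>l\<close> attached leaves. Such a block satisfies
  \<open>block (k + 1) l = block k l * star 1 - block k (l + 1)\<close>, so it is a combination of the products
  \<open>star (l + i + 1) * star 1 ^ (k - 1 - i)\<close> with \<open>i < k\<close>.

  The smallest partition that can occur consists of the numbers \<open>n v + 1\<close>; its coefficient \<open>coeff0\<close> is the
  signed number of the sets \<open>S\<close> that do not connect two vertices carrying leaves. The next one arises by
  replacing two parts \<open>1\<close> by a part \<open>2\<close>, with coefficient \<open>coeff1\<close>. Both coefficients satisfy a
  recursion for deleting a pendant vertex, in which all terms have the same sign; this reduces them to
  the cycle. With at least two non-trivial rooted trees \<open>coeff0\<close> is nonzero; with exactly one, \<open>coeff0\<close>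
  vanishes but \<open>coeff1\<close> does not.
\<close>

section \<open>The ring of series\<close>

text \<open>The difference of size and length counts leaves because the smallest candidate has one
  part \<open>n v + 1\<close> per non-leaf \<open>v\<close>: its length is the number of non-leaves,
  its size the number of all vertices. Trading two parts 1 for a 2 keeps the size and shortens the
  partition by one, which is the extra -1 in the case of one non-trivial tree. The obstacle is
  cancellation: many edge sets yield the same partition, so a signed count has to be shown nonzero.
  Call the vertices in \<open>L\<close>, initially those carrying leaves, marked. The sign of the
  count is \<open>(-1) ^ card (V - L)\<close>: removing a pendant vertex either drops its mark or
  moves it to the neighbour, and this parity turns the difference in the recursion into a sum. If
  marks are always moved and never dropped, they end on the cycle exactly at the roots of the
  non-trivial trees. A single mark leaves nothing to separate, so every edge set counts and the
  alternating sum is 0; this forces the passage to the second coefficient. Partitions are compared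
  as multisets, since addition is monotone in that order and components can be compared one at a
  time.\<close>

typedef ser = "UNIV :: series set" morphisms coeff Ser ..

setup_lifting type_definition_ser

lemma finite_submultisets: "finite {a. a \<subseteq># (m :: 'a multiset)}"
proof -
  have "{a. a \<subseteq># m} \<subseteq> {a. set_mset a \<subseteq> set_mset m \<and> size a \<le> size m}"
    by (auto dest: mset_subset_eqD size_mset_mono)
  moreover have "finite {a. set_mset a \<subseteq> set_mset m \<and> size a \<le> size m}"
  proof -
    have "{a. set_mset a \<subseteq> set_mset m \<and> size a \<le> size m} \<subseteq>
        mset ` {xs. set xs \<subseteq> set_mset m \<and> length xs \<le> size m}"
    proof
      fix a assume a: "a \<in> {a. set_mset a \<subseteq> set_mset m \<and> size a \<le> size m}"
      obtain xs where "mset xs = a" using ex_mset by blast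
      then show "a \<in> mset ` {xs. set xs \<subseteq> set_mset m \<and> length xs \<le> size m}"
        using a by (intro image_eqI[of _ _ xs]) auto
    qed
    then show ?thesis
      by (rule finite_subset) (intro finite_imageI finite_lists_length_le, simp)
  qed
  ultimately show ?thesis by (rule finite_subset)
qed

lemma series_mult_commute: "series_mult f g = series_mult g f"
proof
  fix m
  show "series_mult f g m = series_mult g f m"
    unfolding series_mult_def
    by (rule sum.reindex_bij_witness[of _ "\<lambda>a. m - a" "\<lambda>a. m - a"])
      (auto simp: subset_mset.add_diff_inverse mult.commute subset_mset.diff_diff_right)
qed

lemma series_mult_assoc: "series_mult (series_mult f g) h = series_mult f (series_mult g h)"
proof
  fix m
  have "series_mult (series_mult f g) h m =
      (\<Sum>(a, b) \<in> (SIGMA a:{a. a \<subseteq># m}. {b. b \<subseteq># a}). f b * g (a - b) * h (m - a))"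
    unfolding series_mult_def sum_distrib_right
    by (subst sum.Sigma) (auto simp: finite_submultisets)
  also have "\<dots> = (\<Sum>(b, c) \<in> (SIGMA b:{b. b \<subseteq># m}. {c. c \<subseteq># m - b}). f b * (g c * h (m - b - c)))"
    by (rule sum.reindex_bij_witness[of _ "\<lambda>(b, c). (b + c, b)" "\<lambda>(a, b). (b, a - b)"])
      (auto simp: subset_eq_diff_conv add.commute subset_mset.le_diff_conv2 subset_mset.add_diff_inverse
        mult.assoc diff_diff_add_mset dest: subset_mset.order_trans)
  also have "\<dots> = series_mult f (series_mult g h) m"
    unfolding series_mult_def sum_distrib_left
    by (subst sum.Sigma) (auto simp: finite_submultisets)
  finally show "series_mult (series_mult f g) h m = series_mult f (series_mult g h) m" .
qed

lemma series_mult_one: "series_mult series_one f = f"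
proof
  fix m
  have "series_mult series_one f m = (\<Sum>a \<in> {a. a \<subseteq># m}. if a = {#} then f m else 0)"
    unfolding series_mult_def by (rule sum.cong) (auto simp: series_one_def)
  then show "series_mult series_one f m = f m"
    by (simp add: finite_submultisets)
qed

instantiation ser :: comm_ring_1
begin

lift_definition zero_ser :: ser is "\<lambda>_. 0" .
lift_definition one_ser :: ser is series_one .
lift_definition plus_ser :: "ser \<Rightarrow> ser \<Rightarrow> ser" is "\<lambda>f g m. f m + g m" .
lift_definition minus_ser :: "ser \<Rightarrow> ser \<Rightarrow> ser" is "\<lambda>f g m. f m - g m" .
lift_definition uminus_ser :: "ser \<Rightarrow> ser" is "\<lambda>f m. - f m" .
lift_definition times_ser :: "ser \<Rightarrow> ser \<Rightarrow> ser" is series_mult .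

instance
proof
  fix a b c :: ser
  show "a * b * c = a * (b * c)" by transfer (rule series_mult_assoc)
  show "a * b = b * a" by transfer (rule series_mult_commute)
  show "1 * a = a" by transfer (rule series_mult_one)
  show "(a + b) * c = a * c + b * c"
    by transfer (simp add: series_mult_def fun_eq_iff algebra_simps sum.distrib)
  show "(0::ser) \<noteq> 1" by transfer (metis series_one_def zero_neq_one)
qed (transfer; simp add: algebra_simps)+

end

lift_definition sscale :: "rat \<Rightarrow> ser \<Rightarrow> ser" (infixr "*\<^sub>s" 75) is "\<lambda>c f m. c * f m" .

text \<open>Makes span, independence and the exchange bound available for the dimension count in
  \<open>stars_independent\<close>.\<close>

interpretation ser: vector_space sscale
  by standard (transfer; simp add: algebra_simps)+

lemma sscale_mult_left: "(c *\<^sub>s a) * b = c *\<^sub>s (a * b)"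
  by transfer (simp add: series_mult_def fun_eq_iff sum_distrib_left mult.assoc)

lemma sscale_mult_right: "a * (c *\<^sub>s b) = c *\<^sub>s (a * b)"
  by (metis sscale_mult_left mult.commute)

lemma coeff_sum: "coeff (sum f A) m = (\<Sum>x\<in>A. coeff (f x) m)"
  by (induction A rule: infinite_finite_induct) (simp_all add: zero_ser.rep_eq plus_ser.rep_eq)

lemma sscale_of_int: "of_int c *\<^sub>s a = of_int c * a"
proof -
  have n: "of_nat k *\<^sub>s a = of_nat k * a" for k
    by (induction k) (simp_all add: ser.scale_left_distrib algebra_simps)
  show ?thesis
    by (cases c rule: int_cases2) (simp_all add: n)
qed

lemma prod_sscale: "(\<Prod>x\<in>A. c x *\<^sub>s f x) = (\<Prod>x\<in>A. c x) *\<^sub>s (\<Prod>x\<in>A. f x)"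
  by (induction A rule: infinite_finite_induct)
    (simp_all add: sscale_mult_left sscale_mult_right)

definition star :: "nat \<Rightarrow> ser" where
  "star k = Ser (chromatic_sf (star_graph k))"

text \<open>Indexed by a multiset because the product forgets the order of the parts;
  \<open>desc\<close> leads back to lists.\<close>

definition stars :: "nat multiset \<Rightarrow> ser" where
  "stars M = prod_mset (image_mset star M)"

lemma coeff_stars: "coeff (stars (mset lam)) = star_sf lam"
proof (induction lam)
  case Nil
  then show ?case by (simp add: stars_def star_sf_def one_ser.rep_eq)
next
  case (Cons k lam)
  then show ?case
    by (simp add: stars_def star_sf_def times_ser.rep_eq star_def Ser_inverse)
qed

lemma stars_add: "stars (M + N) = stars M * stars N"
  by (simp add: stars_def)

lemma stars_sum: "finite A \<Longrightarrow> stars (\<Sum>x\<in>A. N x) = (\<Prod>x\<in>A. stars (N x))"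
  by (induction A rule: finite_induct) (simp_all add: stars_add, simp add: stars_def)

section \<open>Series of families of colorings\<close>

abbreviation fibre :: "('a \<Rightarrow> nat) set \<Rightarrow> 'a set \<Rightarrow> nat multiset \<Rightarrow> ('a \<Rightarrow> nat) set" where
  "fibre K V m \<equiv> {\<kappa> \<in> K. image_mset \<kappa> (mset_set V) = m}"

definition gser :: "'a set \<Rightarrow> ('a \<Rightarrow> nat) set \<Rightarrow> ser" where
  "gser V K = Ser (\<lambda>m. of_nat (card (fibre K V m)))"

lemma coeff_gser: "coeff (gser V K) m = of_nat (card (fibre K V m))"
  by (simp add: gser_def Ser_inverse)

lemma gser_chromatic: "gser (verts G) (proper_colorings G) = Ser (chromatic_sf G)"
  by (simp add: gser_def chromatic_sf_def[abs_def])

text \<open>The monomial confines the colors to a finite set. Otherwise \<open>card\<close> would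
  silently return 0 for an infinite fibre and additivity would fail.\<close>

lemma finite_colorings_of_monomial:
  assumes "finite V" "K \<subseteq> V \<rightarrow>\<^sub>E UNIV"
  shows "finite (fibre K V m)"
proof (rule finite_subset)
  show "fibre K V m \<subseteq> V \<rightarrow>\<^sub>E set_mset m"
    using assms by (fastforce simp: PiE_iff)
qed (use assms in \<open>auto intro: finite_PiE\<close>)

lemma gser_Un:
  assumes "finite V" "K1 \<subseteq> V \<rightarrow>\<^sub>E UNIV" "K2 \<subseteq> V \<rightarrow>\<^sub>E UNIV" "K1 \<inter> K2 = {}"
  shows "gser V (K1 \<union> K2) = gser V K1 + gser V K2"
proof -
  have "card (fibre (K1 \<union> K2) V m) = card (fibre K1 V m) + card (fibre K2 V m)" for m
  proof -
    have "fibre (K1 \<union> K2) V m = fibre K1 V m \<union> fibre K2 V m"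
      by auto
    moreover have "fibre K1 V m \<inter> fibre K2 V m = {}"
      using assms(4) by auto
    ultimately show ?thesis
      using finite_colorings_of_monomial[OF assms(1,2)] finite_colorings_of_monomial[OF assms(1,3)]
      by (metis (no_types, lifting) card_Un_disjoint)
  qed
  then show ?thesis
    by (intro coeff_inject[THEN iffD1] ext) (simp add: coeff_gser plus_ser.rep_eq)
qed

text \<open>A coloring of a disjoint union is a pair of colorings, and its monomial is the product
  of the two monomials. Sorting by the factor \<open>a\<close> that comes from \<open>V1\<close>
  gives the convolution that defines the product.\<close>

lemma gser_times:
  assumes "finite V1" "finite V2" "V1 \<inter> V2 = {}" "K1 \<subseteq> V1 \<rightarrow>\<^sub>E UNIV" "K2 \<subseteq> V2 \<rightarrow>\<^sub>E UNIV"
  shows "gser V1 K1 * gser V2 K2 =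
    gser (V1 \<union> V2) {\<kappa> \<in> V1 \<union> V2 \<rightarrow>\<^sub>E UNIV. restrict \<kappa> V1 \<in> K1 \<and> restrict \<kappa> V2 \<in> K2}"
    (is "_ = gser _ ?K")
proof (intro coeff_inject[THEN iffD1] ext)
  fix m
  let ?F1 = "fibre K1 V1"
  let ?F2 = "fibre K2 V2"
  let ?F = "\<lambda>a. {\<kappa> \<in> ?K. image_mset \<kappa> (mset_set V1) = a \<and> image_mset \<kappa> (mset_set V2) = m - a}"
  let ?mg = "\<lambda>\<kappa>1 \<kappa>2 x. if x \<in> V1 then \<kappa>1 x else \<kappa>2 x"
  have fin: "finite (?F1 a)" "finite (?F2 a)" for a
    using finite_colorings_of_monomial assms by blast+
  have restr: "image_mset (restrict \<kappa> W) (mset_set W) = image_mset \<kappa> (mset_set W)" for \<kappa> :: "'a \<Rightarrow> nat" and W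
    by (rule image_mset_cong) (metis elem_mset_set infinite_set_mset_mset_set restrict_apply' empty_iff)
  have bij: "bij_betw (\<lambda>\<kappa>. (restrict \<kappa> V1, restrict \<kappa> V2)) (?F a) (?F1 a \<times> ?F2 (m - a))" for a
  proof (rule bij_betw_byWitness[where f' = "\<lambda>(\<kappa>1, \<kappa>2). ?mg \<kappa>1 \<kappa>2"])
    show "\<forall>\<kappa>\<in>?F a. (case (restrict \<kappa> V1, restrict \<kappa> V2) of
        (\<kappa>1, \<kappa>2) \<Rightarrow> (?mg \<kappa>1 \<kappa>2)) = \<kappa>"
      by (auto simp: fun_eq_iff PiE_iff extensional_def)
    have *: "restrict (?mg \<kappa>1 \<kappa>2) V1 = \<kappa>1"
      "restrict (?mg \<kappa>1 \<kappa>2) V2 = \<kappa>2"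
      "(?mg \<kappa>1 \<kappa>2) \<in> V1 \<union> V2 \<rightarrow>\<^sub>E UNIV"
      if "\<kappa>1 \<in> K1" "\<kappa>2 \<in> K2" for \<kappa>1 \<kappa>2
    proof -
      have e: "\<kappa>1 \<in> extensional V1" "\<kappa>2 \<in> extensional V2"
        using that assms(4,5) by (auto simp: PiE_iff)
      then show "restrict (?mg \<kappa>1 \<kappa>2) V1 = \<kappa>1"
        "(?mg \<kappa>1 \<kappa>2) \<in> V1 \<union> V2 \<rightarrow>\<^sub>E UNIV"
        by (auto simp: fun_eq_iff PiE_iff extensional_def)
      have "x \<notin> V1" if "x \<in> V2" for x using that assms(3) by blast
      then show "restrict (?mg \<kappa>1 \<kappa>2) V2 = \<kappa>2"
        using e by (simp add: fun_eq_iff extensional_def)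
    qed
    show "\<forall>a'\<in>?F1 a \<times> ?F2 (m - a). (restrict (case a' of
        (\<kappa>1, \<kappa>2) \<Rightarrow> (?mg \<kappa>1 \<kappa>2)) V1,
        restrict (case a' of (\<kappa>1, \<kappa>2) \<Rightarrow> (?mg \<kappa>1 \<kappa>2)) V2) = a'"
      using * by auto
    show "(\<lambda>\<kappa>. (restrict \<kappa> V1, restrict \<kappa> V2)) ` ?F a \<subseteq> ?F1 a \<times> ?F2 (m - a)"
      by (auto simp: restr)
    show "(\<lambda>(\<kappa>1, \<kappa>2). ?mg \<kappa>1 \<kappa>2) ` (?F1 a \<times> ?F2 (m - a)) \<subseteq> ?F a"
    proof (rule image_subsetI)
      fix p assume "p \<in> ?F1 a \<times> ?F2 (m - a)"
      then obtain \<kappa>1 \<kappa>2 where p: "p = (\<kappa>1, \<kappa>2)" and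
        k: "\<kappa>1 \<in> K1" "\<kappa>2 \<in> K2" "image_mset \<kappa>1 (mset_set V1) = a" "image_mset \<kappa>2 (mset_set V2) = m - a"
        by blast
      show "(case p of (\<kappa>1, \<kappa>2) \<Rightarrow> ?mg \<kappa>1 \<kappa>2) \<in> ?F a"
        unfolding p prod.case
        using *[OF k(1,2)] k restr[of "?mg \<kappa>1 \<kappa>2" V1]
          restr[of "?mg \<kappa>1 \<kappa>2" V2] by simp
    qed
  qed
  have split: "image_mset \<kappa> (mset_set (V1 \<union> V2)) =
      image_mset \<kappa> (mset_set V1) + image_mset \<kappa> (mset_set V2)" for \<kappa> :: "'a \<Rightarrow> nat"
    using assms(1-3) by (simp add: mset_set_Union)
  have eq: "fibre ?K (V1 \<union> V2) m = (\<Union>a\<in>{a. a \<subseteq># m}. ?F a)"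
    unfolding split by (auto simp: subset_mset.add_diff_inverse)
  have "card (fibre ?K (V1 \<union> V2) m) = (\<Sum>a\<in>{a. a \<subseteq># m}. card (?F a))"
    unfolding eq
  proof (rule card_UN_disjoint)
    show "\<forall>a\<in>{a. a \<subseteq># m}. finite (?F a)"
      using bij_betw_finite[OF bij] fin by blast
  qed (auto simp: finite_submultisets)
  also have "\<dots> = (\<Sum>a\<in>{a. a \<subseteq># m}. card (?F1 a) * card (?F2 (m - a)))"
    using bij_betw_same_card[OF bij] by (simp add: card_cartesian_product)
  finally show "coeff (gser V1 K1 * gser V2 K2) m = coeff (gser (V1 \<union> V2) ?K) m"
    by (simp add: coeff_gser times_ser.rep_eq series_mult_def)
qed

text \<open>The constantly \<open>undefined\<close> function is the only extensional coloring of no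
  vertices; this starts the induction in \<open>gser_prod\<close>.\<close>

lemma gser_empty: "gser ({} :: 'a set) {\<lambda>x. undefined} = 1"
proof (intro coeff_inject[THEN iffD1] ext)
  fix m :: "nat multiset"
  have "{\<kappa> \<in> {\<lambda>x. undefined :: nat}. image_mset \<kappa> (mset_set ({} :: 'a set)) = m} = (if m = {#} then {\<lambda>x. undefined} else {})"
    by auto
  then show "coeff (gser ({} :: 'a set) {\<lambda>x. undefined}) m = coeff 1 m"
    by (simp add: coeff_gser one_ser.rep_eq series_one_def)
qed

lemma gser_prod:
  assumes "finite J" "\<And>j. j \<in> J \<Longrightarrow> finite (B j)" "disjoint_family_on B J"
    "\<And>j. j \<in> J \<Longrightarrow> K j \<subseteq> B j \<rightarrow>\<^sub>E UNIV"
  shows "gser (\<Union>j\<in>J. B j) {\<kappa> \<in> (\<Union>j\<in>J. B j) \<rightarrow>\<^sub>E UNIV. \<forall>j\<in>J. restrict \<kappa> (B j) \<in> K j} =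
    (\<Prod>j\<in>J. gser (B j) (K j))"
  using assms
proof (induction J rule: finite_induct)
  case empty
  then show ?case by (simp add: gser_empty)
next
  case (insert j J)
  let ?V = "\<Union>j\<in>J. B j" and ?K = "{\<kappa> \<in> (\<Union>j\<in>J. B j) \<rightarrow>\<^sub>E UNIV. \<forall>j\<in>J. restrict \<kappa> (B j) \<in> K j}"
  have disj: "B j \<inter> ?V = {}"
    using insert.prems(2) insert.hyps(2) by (auto simp: disjoint_family_on_def)
  have IH: "gser ?V ?K = (\<Prod>j\<in>J. gser (B j) (K j))"
    using insert.prems by (intro insert.IH) (auto simp: disjoint_family_on_def)
  have sub: "restrict (restrict \<kappa> ?V) (B i) = restrict \<kappa> (B i)" if "i \<in> J" for \<kappa> :: "'b \<Rightarrow> nat" and i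
    using that by (simp add: restrict_restrict) (metis Int_absorb1 SUP_upper)
  have "gser (B j) (K j) * gser ?V ?K = gser (B j \<union> ?V) {\<kappa> \<in> B j \<union> ?V \<rightarrow>\<^sub>E UNIV. restrict \<kappa> (B j) \<in> K j \<and> restrict \<kappa> ?V \<in> ?K}"
    using insert.prems insert.hyps disj by (intro gser_times) auto
  also have "{\<kappa> \<in> B j \<union> ?V \<rightarrow>\<^sub>E UNIV. restrict \<kappa> (B j) \<in> K j \<and> restrict \<kappa> ?V \<in> ?K} =
      {\<kappa> \<in> B j \<union> ?V \<rightarrow>\<^sub>E UNIV. \<forall>i\<in>insert j J. restrict \<kappa> (B i) \<in> K i}"
    using sub by (auto simp del: restrict_restrict)
  finally show ?case
    by (simp only: IH UN_insert prod.insert[OF insert.hyps])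
qed

text \<open>Series do not depend on the names of vertices: needed because \<open>star_graph\<close>
  lives on natural numbers and blocks live on arbitrary vertices.\<close>

lemma gser_reindex:
  assumes "bij_betw h A B" "finite B" "KA \<subseteq> A \<rightarrow>\<^sub>E UNIV" "KB \<subseteq> B \<rightarrow>\<^sub>E UNIV"
    and iff: "\<And>\<kappa>. \<kappa> \<in> B \<rightarrow>\<^sub>E UNIV \<Longrightarrow> \<kappa> \<in> KB \<longleftrightarrow> restrict (\<kappa> \<circ> h) A \<in> KA"
  shows "gser A KA = gser B KB"
proof (intro coeff_inject[THEN iffD1] ext)
  fix m
  have finA: "finite A" and hA: "h ` A = B" and inj: "inj_on h A"
    using assms(1,2) bij_betw_finite by (auto simp: bij_betw_def)
  have img: "image_mset (restrict (\<kappa> \<circ> h) A) (mset_set A) = image_mset \<kappa> (mset_set B)" for \<kappa> :: "'b \<Rightarrow> nat"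
  proof -
    have "image_mset (restrict (\<kappa> \<circ> h) A) (mset_set A) = image_mset \<kappa> (image_mset h (mset_set A))"
      unfolding multiset.map_comp by (rule image_mset_cong) (use finA in simp)
    then show ?thesis using inj hA by (simp add: image_mset_mset_set)
  qed
  have "bij_betw (\<lambda>\<kappa>. restrict (\<kappa> \<circ> h) A) (fibre KB B m) (fibre KA A m)"
  proof (rule bij_betw_byWitness[where f' = "\<lambda>\<kappa>. restrict (\<kappa> \<circ> inv_into A h) B"])
    have 1: "restrict (restrict (\<kappa> \<circ> inv_into A h) B \<circ> h) A = \<kappa>" if "\<kappa> \<in> A \<rightarrow>\<^sub>E UNIV" for \<kappa> :: "'a \<Rightarrow> nat"
    proof
      fix x
      show "restrict (restrict (\<kappa> \<circ> inv_into A h) B \<circ> h) A x = \<kappa> x"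
        using that inj hA by (cases "x \<in> A") (auto simp: PiE_iff extensional_def)
    qed
    have 2: "restrict (restrict (\<kappa> \<circ> h) A \<circ> inv_into A h) B = \<kappa>" if "\<kappa> \<in> B \<rightarrow>\<^sub>E UNIV" for \<kappa> :: "'b \<Rightarrow> nat"
    proof
      fix x
      show "restrict (restrict (\<kappa> \<circ> h) A \<circ> inv_into A h) B x = \<kappa> x"
      proof (cases "x \<in> B")
        case True
        then have "inv_into A h x \<in> A" "h (inv_into A h x) = x"
          using hA by (auto simp: inv_into_into f_inv_into_f)
        then show ?thesis using True by simp
      qed (use that in \<open>auto simp: PiE_iff extensional_def\<close>)
    qed
    show "\<forall>\<kappa>\<in>fibre KB B m.
        restrict (restrict (\<kappa> \<circ> h) A \<circ> inv_into A h) B = \<kappa>"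
      using 2 assms(4) by blast
    show "\<forall>\<kappa>\<in>fibre KA A m.
        restrict (restrict (\<kappa> \<circ> inv_into A h) B \<circ> h) A = \<kappa>"
      using 1 assms(3) by blast
    show "(\<lambda>\<kappa>. restrict (\<kappa> \<circ> h) A) ` fibre KB B m \<subseteq> fibre KA A m"
    proof (rule image_subsetI)
      fix \<kappa> assume k: "\<kappa> \<in> fibre KB B m"
      then have "restrict (\<kappa> \<circ> h) A \<in> KA"
        using iff[of \<kappa>] assms(4) by blast
      then show "restrict (\<kappa> \<circ> h) A \<in> fibre KA A m"
        using img[of \<kappa>] k by simp
    qed
    show "(\<lambda>\<kappa>. restrict (\<kappa> \<circ> inv_into A h) B) ` fibre KA A m \<subseteq> fibre KB B m"
    proof (rule image_subsetI)
      fix \<kappa> assume k: "\<kappa> \<in> fibre KA A m"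
      let ?k = "restrict (\<kappa> \<circ> inv_into A h) B"
      have "restrict (?k \<circ> h) A = \<kappa>" using 1 k assms(3) by blast
      then show "?k \<in> fibre KB B m"
        using iff[of ?k] img[of ?k] k by auto
    qed
  qed
  then show "coeff (gser A KA) m = coeff (gser B KB) m"
    by (simp add: coeff_gser bij_betw_same_card)
qed

section \<open>Monochromatic blocks with attached leaves\<close>

text \<open>As \<open>C\<close> has a single color, it does not matter which vertex of
  \<open>C\<close> a leaf is attached to; so \<open>U\<close> avoids the color of \<open>C\<close>
  as a whole.\<close>

definition block_colorings :: "'a set \<Rightarrow> 'a set \<Rightarrow> ('a \<Rightarrow> nat) set" where
  "block_colorings C U = {\<kappa> \<in> C \<union> U \<rightarrow>\<^sub>E UNIV.
     (\<forall>x\<in>C. \<forall>y\<in>C. \<kappa> x = \<kappa> y) \<and> (\<forall>x\<in>C. \<forall>u\<in>U. \<kappa> x \<noteq> \<kappa> u)}"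

definition block :: "'a set \<Rightarrow> 'a set \<Rightarrow> ser" where
  "block C U = gser (C \<union> U) (block_colorings C U)"

lemma block_colorings_subset: "block_colorings C U \<subseteq> C \<union> U \<rightarrow>\<^sub>E UNIV"
  unfolding block_colorings_def by blast

lemma star_edge_iff:
  "{u, v} \<in> edges (star_graph k) \<longleftrightarrow> u = 0 \<and> 1 \<le> v \<and> v < k \<or> v = 0 \<and> 1 \<le> u \<and> u < k"
  by (auto simp: star_graph_def doubleton_eq_iff)

lemma block_singleton:
  assumes "finite U" "c \<notin> U"
  shows "block {c} U = star (Suc (card U))"
proof -
  obtain g where g: "bij_betw g {0..<card U} U"
    using ex_bij_betw_nat_finite[OF assms(1)] by blast
  define h where "h = (\<lambda>i. if i = 0 then c else g (i - 1))"
  have "bij_betw (\<lambda>i. g (i - 1)) {1..card U} U"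
  proof (rule bij_betw_trans[of "\<lambda>i. i - 1" _ "{0..<card U}" g, unfolded comp_def])
    show "bij_betw (\<lambda>i. i - 1) {1..card U} {0..<card U}"
      by (rule bij_betw_byWitness[where f' = Suc]) auto
  qed (rule g)
  then have h1: "bij_betw h {1..card U} U"
    by (rule bij_betw_cong[THEN iffD1, rotated]) (auto simp: h_def)
  have "bij_betw h {0} {c}" by (simp add: h_def)
  then have "bij_betw h ({0} \<union> {1..card U}) ({c} \<union> U)"
    using h1 assms by (intro bij_betw_combine) auto
  moreover have "{0} \<union> {1..card U} = {0..<Suc (card U)}" by auto
  ultimately have h: "bij_betw h {0..<Suc (card U)} ({c} \<union> U)" by simp
  have hU: "h ` {1..card U} = U" "h 0 = c"
    using h1 by (auto simp: bij_betw_def h_def)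
  have "gser {0..<Suc (card U)} (proper_colorings (star_graph (Suc (card U)))) = block {c} U"
    unfolding block_def
  proof (rule gser_reindex[OF h])
    fix \<kappa> :: "'a \<Rightarrow> nat"
    assume "\<kappa> \<in> {c} \<union> U \<rightarrow>\<^sub>E UNIV"
    then have "\<kappa> \<in> block_colorings {c} U \<longleftrightarrow> (\<forall>u\<in>U. \<kappa> c \<noteq> \<kappa> u)"
      by (auto simp: block_colorings_def)
    also have "\<dots> \<longleftrightarrow> (\<forall>u\<in>h ` {1..card U}. \<kappa> c \<noteq> \<kappa> u)"
      by (simp only: hU(1))
    also have "\<dots> \<longleftrightarrow> (\<forall>i\<in>{1..card U}. \<kappa> (h 0) \<noteq> \<kappa> (h i))"
      by (simp add: hU(2))
    also have "\<dots> \<longleftrightarrow> restrict (\<kappa> \<circ> h) {0..<Suc (card U)} \<in> proper_colorings (star_graph (Suc (card U)))"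
    proof -
      have "restrict (\<kappa> \<circ> h) {0..<Suc (card U)} \<in> proper_colorings (star_graph (Suc (card U))) \<longleftrightarrow>
          (\<forall>i. 1 \<le> i \<and> i < Suc (card U) \<longrightarrow> \<kappa> (h 0) \<noteq> \<kappa> (h i))"
        (is "?k \<in> _ \<longleftrightarrow> ?R")
      proof
        assume k: "?k \<in> proper_colorings (star_graph (Suc (card U)))"
        show ?R
        proof (intro allI impI)
          fix i assume "1 \<le> i \<and> i < Suc (card U)"
          moreover from this k have "?k 0 \<noteq> ?k i"
            unfolding proper_colorings_def star_edge_iff by blast
          ultimately show "\<kappa> (h 0) \<noteq> \<kappa> (h i)" by simp
        qed
      next
        assume R: ?R
        have "?k u \<noteq> ?k v" if "{u, v} \<in> edges (star_graph (Suc (card U)))" for u v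
          using that unfolding star_edge_iff
        proof
          assume "u = 0 \<and> 1 \<le> v \<and> v < Suc (card U)"
          then show ?thesis using R by simp
        next
          assume "v = 0 \<and> 1 \<le> u \<and> u < Suc (card U)"
          then show ?thesis using R[rule_format, of u] by simp
        qed
        moreover have "?k \<in> verts (star_graph (Suc (card U))) \<rightarrow>\<^sub>E UNIV"
          by (simp add: star_graph_def)
        ultimately show "?k \<in> proper_colorings (star_graph (Suc (card U)))"
          unfolding proper_colorings_def by blast
      qed
      then show ?thesis by (simp add: less_Suc_eq_le Ball_def)
    qed
    finally show "\<kappa> \<in> block_colorings {c} U \<longleftrightarrow>
        restrict (\<kappa> \<circ> h) {0..<Suc (card U)} \<in> proper_colorings (star_graph (Suc (card U)))" .
  next
    show "finite ({c} \<union> U)" using assms(1) by simp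
    show "proper_colorings (star_graph (Suc (card U))) \<subseteq> {0..<Suc (card U)} \<rightarrow>\<^sub>E UNIV"
      unfolding proper_colorings_def star_graph_def fst_conv by blast
    show "block_colorings {c} U \<subseteq> {c} \<union> U \<rightarrow>\<^sub>E UNIV"
      by (rule block_colorings_subset)
  qed
  then show ?thesis
    using gser_chromatic[of "star_graph (Suc (card U))"] by (simp add: star_def star_graph_def)
qed

text \<open>Add an isolated vertex \<open>w\<close>, which contributes the factor
  \<open>star 1\<close>. Either \<open>w\<close> receives the color of \<open>C\<close> and joins
  it, or another color and then it behaves like one more leaf; \<open>C \<noteq> {}\<close> makes
  the two cases exclusive.\<close>

lemma block_insert:
  assumes "finite C" "finite U" "C \<noteq> {}" "C \<inter> U = {}" "w \<notin> C \<union> U"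
  shows "block (insert w C) U = block C U * star 1 - block C (insert w U)"
proof -
  have "block C U * star 1 = block C U * gser {w} (block_colorings {w} {})"
    using block_singleton[of "{}" w] by (simp add: block_def)
  also have "\<dots> = gser (C \<union> U \<union> {w}) {\<kappa> \<in> C \<union> U \<union> {w} \<rightarrow>\<^sub>E UNIV.
      restrict \<kappa> (C \<union> U) \<in> block_colorings C U \<and> restrict \<kappa> {w} \<in> block_colorings {w} {}}"
    unfolding block_def using assms block_colorings_subset[of C U] block_colorings_subset[of "{w}" "{}"]
    by (intro gser_times) auto
  also have "{\<kappa> \<in> C \<union> U \<union> {w} \<rightarrow>\<^sub>E UNIV.
      restrict \<kappa> (C \<union> U) \<in> block_colorings C U \<and> restrict \<kappa> {w} \<in> block_colorings {w} {}} =
      block_colorings (insert w C) U \<union> block_colorings C (insert w U)" (is "?A = ?B")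
  proof
    show "?A \<subseteq> ?B"
    proof
      fix \<kappa> assume k: "\<kappa> \<in> ?A"
      obtain c where c: "c \<in> C" using assms(3) by blast
      have r: "restrict \<kappa> (C \<union> U) \<in> block_colorings C U" using k by blast
      have E: "\<kappa> \<in> C \<union> U \<union> {w} \<rightarrow>\<^sub>E UNIV" using k by blast
      have C: "\<kappa> x = \<kappa> y" if "x \<in> C" "y \<in> C" for x y
      proof -
        have "restrict \<kappa> (C \<union> U) x = restrict \<kappa> (C \<union> U) y"
          using r that unfolding block_colorings_def by blast
        then show ?thesis using that by simp
      qed
      have U: "\<kappa> x \<noteq> \<kappa> u" if "x \<in> C" "u \<in> U" for x u
      proof -
        have "restrict \<kappa> (C \<union> U) x \<noteq> restrict \<kappa> (C \<union> U) u"
          using r that unfolding block_colorings_def by blast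
        then show ?thesis using that by simp
      qed
      show "\<kappa> \<in> ?B"
      proof (cases "\<kappa> w = \<kappa> c")
        case True
        then have "\<kappa> \<in> block_colorings (insert w C) U"
          unfolding block_colorings_def
        proof (intro CollectI conjI ballI)
          fix x y assume "x \<in> insert w C" "y \<in> insert w C"
          then show "\<kappa> x = \<kappa> y" using True C[OF _ c] C[OF c] by (metis insertE)
        next
          fix x u assume "x \<in> insert w C" "u \<in> U"
          then show "\<kappa> x \<noteq> \<kappa> u" using True U c by (metis insertE)
        qed (use E in simp)
        then show ?thesis by simp
      next
        case False
        then have "\<kappa> \<in> block_colorings C (insert w U)"
          unfolding block_colorings_def
        proof (intro CollectI conjI ballI)
          fix x u assume "x \<in> C" "u \<in> insert w U"
          then show "\<kappa> x \<noteq> \<kappa> u" using False U C[OF _ c] by (metis insertE)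
        next
          fix x y assume "x \<in> C" "y \<in> C"
          then show "\<kappa> x = \<kappa> y" by (rule C)
        qed (use E in simp)
        then show ?thesis by simp
      qed
    qed
    show "?B \<subseteq> ?A"
    proof
      fix \<kappa> assume "\<kappa> \<in> ?B"
      then have k: "\<kappa> \<in> C \<union> U \<union> {w} \<rightarrow>\<^sub>E UNIV" "\<forall>x\<in>C. \<forall>y\<in>C. \<kappa> x = \<kappa> y" "\<forall>x\<in>C. \<forall>u\<in>U. \<kappa> x \<noteq> \<kappa> u"
        using block_colorings_subset[of "insert w C" U] block_colorings_subset[of C "insert w U"]
        unfolding block_colorings_def by blast+
      have "restrict \<kappa> (C \<union> U) \<in> block_colorings C U"
        unfolding block_colorings_def
      proof (intro CollectI conjI ballI)
        fix x y assume "x \<in> C" "y \<in> C"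
        moreover from this have "\<kappa> x = \<kappa> y" using k(2) by blast
        ultimately show "restrict \<kappa> (C \<union> U) x = restrict \<kappa> (C \<union> U) y" by simp
      next
        fix x u assume "x \<in> C" "u \<in> U"
        moreover from this have "\<kappa> x \<noteq> \<kappa> u" using k(3) by blast
        ultimately show "restrict \<kappa> (C \<union> U) x \<noteq> restrict \<kappa> (C \<union> U) u" by simp
      qed simp
      moreover have "restrict \<kappa> {w} \<in> block_colorings {w} {}"
        unfolding block_colorings_def by simp
      ultimately show "\<kappa> \<in> ?A" using k(1) by blast
    qed
  qed
  also have "gser (C \<union> U \<union> {w}) ?B =
      gser (C \<union> U \<union> {w}) (block_colorings (insert w C) U) + gser (C \<union> U \<union> {w}) (block_colorings C (insert w U))"
  proof (rule gser_Un)
    show "block_colorings (insert w C) U \<inter> block_colorings C (insert w U) = {}"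
    proof -
      obtain c where "c \<in> C" using assms(3) by blast
      then show ?thesis unfolding block_colorings_def by blast
    qed
    show "finite (C \<union> U \<union> {w})" using assms(1,2) by simp
    show "block_colorings (insert w C) U \<subseteq> C \<union> U \<union> {w} \<rightarrow>\<^sub>E UNIV"
      "block_colorings C (insert w U) \<subseteq> C \<union> U \<union> {w} \<rightarrow>\<^sub>E UNIV"
      using block_colorings_subset[of "insert w C" U] block_colorings_subset[of C "insert w U"] by auto
  qed
  finally show ?thesis
    by (simp add: block_def)
qed

text \<open>Unfolding \<open>block_insert\<close> down to one vertex turns \<open>i\<close> of the
  other \<open>k - 1\<close> vertices into leaves of the star, each with a factor -1, and splits off
  the rest as parts 1. \<open>block_coeff\<close> counts the ways to select those \<open>i\<close>
  vertices.\<close>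

definition block_parts :: "nat \<Rightarrow> nat \<Rightarrow> nat \<Rightarrow> nat multiset" where
  "block_parts k l i = {#l + i + 1#} + replicate_mset (k - 1 - i) 1"

definition block_coeff :: "nat \<Rightarrow> nat \<Rightarrow> int" where
  "block_coeff k i = (-1) ^ i * int ((k - 1) choose i)"

lemma stars_block_parts: "stars (block_parts k l i) = star (l + i + 1) * star 1 ^ (k - 1 - i)"
  by (simp add: stars_def block_parts_def)

lemma block_expansion:
  assumes "finite C" "finite U" "C \<noteq> {}" "C \<inter> U = {}"
  shows "block C U =
    (\<Sum>i<card C. of_int (block_coeff (card C) i) *\<^sub>s stars (block_parts (card C) (card U) i))"
proof -
  \<comment> \<open>Here \<open>n\<close> stands for \<open>card C - 1\<close>, so that a single
    vertex is the case \<open>n = 0\<close> and \<open>step\<close> is Pascal's rule.\<close>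
  define F where "F = (\<lambda>n l. \<Sum>i\<le>n. (- 1) ^ i * of_nat (n choose i) * (star (l + i + 1) * star 1 ^ (n - i)))"
  have step: "F (Suc n) l = F n l * star 1 - F n (Suc l)" for n l
  proof -
    let ?a = "\<lambda>i. (- 1) ^ i * of_nat (n choose i) * (star (l + i + 1) * star 1 ^ (Suc n - i))"
    have "F (Suc n) l = star (l + 1) * star 1 ^ Suc n + (\<Sum>i\<le>n. (- 1) ^ Suc i * of_nat (Suc n choose Suc i) *
        (star (l + Suc i + 1) * star 1 ^ (n - i)))"
      unfolding F_def by (subst sum.atMost_Suc_shift) simp
    also have "(\<Sum>i\<le>n. (- 1) ^ Suc i * of_nat (Suc n choose Suc i) * (star (l + Suc i + 1) * star 1 ^ (n - i))) =
        (\<Sum>i\<le>n. ?a (Suc i) - (- 1) ^ i * of_nat (n choose i) * (star (Suc l + i + 1) * star 1 ^ (n - i)))"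
      by (intro sum.cong) (simp_all add: algebra_simps)
    also have "\<dots> = (\<Sum>i\<le>n. ?a (Suc i)) - F n (Suc l)"
      unfolding F_def by (rule sum_subtractf)
    also have "star (l + 1) * star 1 ^ Suc n + ((\<Sum>i\<le>n. ?a (Suc i)) - F n (Suc l)) =
        ?a 0 + (\<Sum>i\<le>n. ?a (Suc i)) - F n (Suc l)"
      by simp
    also have "?a 0 + (\<Sum>i\<le>n. ?a (Suc i)) = (\<Sum>i\<le>Suc n. ?a i)"
      by (rule sum.atMost_Suc_shift[symmetric])
    also have "\<dots> = (\<Sum>i\<le>n. ?a i)"
      by (simp add: binomial_eq_0)
    also have "\<dots> = F n l * star 1"
      unfolding F_def sum_distrib_right by (intro sum.cong) (auto simp: Suc_diff_le algebra_simps)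
    finally show ?thesis .
  qed
  have "block C U = F (card C - 1) (card U)"
    using assms(1,3,2,4)
  proof (induction C arbitrary: U rule: finite_ne_induct)
    case (singleton x)
    then show ?case by (simp add: block_singleton F_def)
  next
    case (insert w C)
    then have "block (insert w C) U = F (card C - 1) (card U) * star 1 - F (card C - 1) (Suc (card U))"
      using insert.IH[of U] insert.IH[of "insert w U"] by (subst block_insert) auto
    moreover have "card (insert w C) - 1 = Suc (card C - 1)"
      using insert.hyps by (simp add: card_gt_0_iff)
    ultimately show ?case by (simp add: step)
  qed
  also have "\<dots> = (\<Sum>i<card C. of_int (block_coeff (card C) i) *\<^sub>s stars (block_parts (card C) (card U) i))"
  proof -
    have "{..card C - 1} = {..<card C}"
      using assms(1,3) by (metis Suc_diff_1 card_gt_0_iff lessThan_Suc_atMost)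
    then show ?thesis
      by (simp only: F_def stars_block_parts sscale_of_int block_coeff_def)
        (simp add: algebra_simps)
  qed
  finally show ?thesis .
qed

section \<open>Connected components and the expansion into stars\<close>

text \<open>Reflexive on the whole type, hence an equivalence on \<open>UNIV\<close> independent of
  any vertex set; \<open>comps\<close> keeps the classes of the vertices in
  \<open>V\<close>.\<close>

definition conn :: "'a set set \<Rightarrow> ('a \<times> 'a) set" where
  "conn S = {(u, v). {u, v} \<in> S}\<^sup>*"

definition comps :: "'a set \<Rightarrow> 'a set set \<Rightarrow> 'a set set" where
  "comps V S = V // conn S"

lemma conn_refl [simp]: "(x, x) \<in> conn S"
  by (simp add: conn_def)

lemma conn_trans: "(x, y) \<in> conn S \<Longrightarrow> (y, z) \<in> conn S \<Longrightarrow> (x, z) \<in> conn S"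
  unfolding conn_def by (rule rtrancl_trans)

lemma conn_sym: "(x, y) \<in> conn S \<Longrightarrow> (y, x) \<in> conn S"
proof -
  have "sym {(u, v). {u, v} \<in> S}"
    by (auto simp: sym_def insert_commute)
  then show "(x, y) \<in> conn S \<Longrightarrow> (y, x) \<in> conn S"
    unfolding conn_def by (meson sym_rtrancl symD)
qed

lemma conn_edge: "{x, y} \<in> S \<Longrightarrow> (x, y) \<in> conn S"
  by (auto simp: conn_def)

lemma conn_mono: "S \<subseteq> S' \<Longrightarrow> conn S \<subseteq> conn S'"
  unfolding conn_def by (rule rtrancl_mono) auto

lemma equiv_conn: "equiv UNIV (conn S)"
  by (intro equivI refl_onI symI transI) (auto intro: conn_sym conn_trans)

text \<open>The way to prove that vertices are not connected: exhibit a suitable \<open>f\<close>.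
  Later choices are membership in a vertex set and the class of a vertex in a smaller edge
  set.\<close>

lemma conn_invariant:
  assumes "(x, y) \<in> conn S" "\<And>u v. {u, v} \<in> S \<Longrightarrow> f u = f v"
  shows "f x = f y"
  using assms(1) unfolding conn_def
  by (induction rule: rtrancl_induct) (auto simp: assms(2))

lemma conn_in: "(x, y) \<in> conn S \<Longrightarrow> \<Union>S \<subseteq> V \<Longrightarrow> x \<in> V \<longleftrightarrow> y \<in> V"
  by (rule conn_invariant[of x y S "\<lambda>x. x \<in> V"]) blast+

lemma comps_iff: "C \<in> comps V S \<longleftrightarrow> (\<exists>v\<in>V. C = conn S `` {v})"
  by (auto simp: comps_def quotient_def)

lemma comps_subset: "C \<in> comps V S \<Longrightarrow> \<Union>S \<subseteq> V \<Longrightarrow> C \<subseteq> V"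
proof
  fix x assume "C \<in> comps V S" and S: "\<Union>S \<subseteq> V" and "x \<in> C"
  then obtain v where "v \<in> V" "(v, x) \<in> conn S" unfolding comps_iff by blast
  then show "x \<in> V" using conn_in[OF _ S] by blast
qed

lemma comps_nonempty: "C \<in> comps V S \<Longrightarrow> C \<noteq> {}"
  unfolding comps_iff using conn_refl by fastforce

lemma comps_conn: "C \<in> comps V S \<Longrightarrow> x \<in> C \<Longrightarrow> y \<in> C \<longleftrightarrow> (x, y) \<in> conn S"
proof -
  assume "C \<in> comps V S" "x \<in> C"
  then obtain v where C: "C = conn S `` {v}" and "(v, x) \<in> conn S" unfolding comps_iff by blast
  then show ?thesis
    using conn_trans[of v x S y] conn_trans[of x v S y] conn_sym[of v x S] by blast
qed

lemma Union_comps: "\<Union>S \<subseteq> V \<Longrightarrow> \<Union>(comps V S) = V"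
proof
  assume S: "\<Union>S \<subseteq> V"
  show "\<Union>(comps V S) \<subseteq> V" using comps_subset[OF _ S] by (rule Union_least)
  show "V \<subseteq> \<Union>(comps V S)"
  proof
    fix v assume "v \<in> V"
    then have "conn S `` {v} \<in> comps V S" unfolding comps_iff by blast
    then show "v \<in> \<Union>(comps V S)" by (rule UnionI) simp
  qed
qed

lemma finite_comps: "finite V \<Longrightarrow> finite (comps V S)"
  by (simp add: comps_def quotient_def)

lemma disjoint_comps: "C \<in> comps V S \<Longrightarrow> D \<in> comps V S \<Longrightarrow> C \<noteq> D \<Longrightarrow> C \<inter> D = {}"
  using quotient_disj[OF equiv_conn, of C S D] unfolding comps_def quotient_def by blast

lemma finite_comp: "finite V \<Longrightarrow> \<Union>S \<subseteq> V \<Longrightarrow> C \<in> comps V S \<Longrightarrow> finite C"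
  using comps_subset finite_subset by metis

lemma sum_Pow_insert:
  fixes f :: "'a set \<Rightarrow> 'b :: comm_monoid_add"
  assumes "finite E" "e \<notin> E"
  shows "(\<Sum>S\<in>Pow (insert e E). f S) = (\<Sum>S\<in>Pow E. f S) + (\<Sum>S\<in>Pow E. f (insert e S))"
proof -
  have inj: "inj_on (insert e) (Pow E)"
    using assms(2) by (auto simp: inj_on_def)
  have "(\<Sum>S\<in>Pow (insert e E). f S) = (\<Sum>S\<in>Pow E. f S) + (\<Sum>S\<in>insert e ` Pow E. f S)"
    unfolding Pow_insert using assms by (intro sum.union_disjoint) auto
  then show ?thesis by (simp add: sum.reindex[OF inj])
qed

lemma sum_Pow_sign:
  assumes "finite E"
  shows "(\<Sum>S\<in>Pow E. (- 1) ^ card S) = (if E = {} then 1 else 0 :: 'b :: comm_ring_1)"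
  using assms
proof (induction E rule: finite_induct)
  case (insert e E)
  have "(- 1 :: 'b) ^ card (insert e S) = - ((- 1) ^ card S)" if "S \<in> Pow E" for S
    using that insert.hyps finite_subset[of S E] by (subst card_insert_disjoint) auto
  then show ?case
    by (simp add: sum_Pow_insert[OF insert.hyps] sum_negf)
qed simp

locale leafy_graph =
  fixes V U :: "'a set" and E :: "'a set set" and b :: "'a \<Rightarrow> 'a"
  assumes finV: "finite V" and finU: "finite U" and disj: "V \<inter> U = {}"
    and b: "\<And>u. u \<in> U \<Longrightarrow> b u \<in> V"
    and E: "\<And>e. e \<in> E \<Longrightarrow> e \<subseteq> V \<and> card e = 2"
begin

definition full :: "'a graph" where
  "full = (V \<union> U, E \<union> (\<lambda>u. {b u, u}) ` U)"

definition nleaves :: "'a \<Rightarrow> nat" where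
  "nleaves v = card {u \<in> U. b u = v}"

abbreviation leaves_at :: "'a set \<Rightarrow> 'a set" where
  "leaves_at C \<equiv> {u \<in> U. b u \<in> C}"

lemma finE: "finite E"
  by (rule finite_subset[of _ "Pow V"]) (use E finV in auto)

lemma edge_pair: "e \<in> E \<Longrightarrow> \<exists>x y. e = {x, y}"
  using E[of e] by (auto simp: card_2_iff)

lemma Union_edges: "S \<subseteq> E \<Longrightarrow> \<Union>S \<subseteq> V"
  using E by blast

lemma card_leaves_at: "finite C \<Longrightarrow> card (leaves_at C) = (\<Sum>v\<in>C. nleaves v)"
proof -
  assume "finite C"
  then have "card (\<Union>v\<in>C. {u \<in> U. b u = v}) = (\<Sum>v\<in>C. nleaves v)"
    unfolding nleaves_def using finU by (intro card_UN_disjoint) auto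
  moreover have "(\<Union>v\<in>C. {u \<in> U. b u = v}) = leaves_at C" by auto
  ultimately show ?thesis by simp
qed

text \<open>Leaf edges are respected from the outset and only edges of \<open>E\<close> may be
  violated. Thus inclusion-exclusion runs over \<open>Pow E\<close> alone, and a component with one
  vertex already is a star.\<close>

definition leaf_colorings :: "('a \<Rightarrow> nat) set" where
  "leaf_colorings = {\<kappa> \<in> V \<union> U \<rightarrow>\<^sub>E UNIV. \<forall>u\<in>U. \<kappa> (b u) \<noteq> \<kappa> u}"

definition mono_edges :: "('a \<Rightarrow> nat) \<Rightarrow> 'a set set" where
  "mono_edges \<kappa> = {e \<in> E. \<forall>x\<in>e. \<forall>y\<in>e. \<kappa> x = \<kappa> y}"

lemma proper_colorings_full: "proper_colorings full = {\<kappa> \<in> leaf_colorings. mono_edges \<kappa> = {}}"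
proof -
  have "(\<forall>u v. {u, v} \<in> edges full \<longrightarrow> \<kappa> u \<noteq> \<kappa> v) \<longleftrightarrow> (\<forall>u\<in>U. \<kappa> (b u) \<noteq> \<kappa> u) \<and> mono_edges \<kappa> = {}"
    for \<kappa> :: "'a \<Rightarrow> nat"
  proof
    assume L: "\<forall>u v. {u, v} \<in> edges full \<longrightarrow> \<kappa> u \<noteq> \<kappa> v"
    have "e \<notin> mono_edges \<kappa>" for e
    proof
      assume e: "e \<in> mono_edges \<kappa>"
      then obtain x y where "e = {x, y}"
        using edge_pair unfolding mono_edges_def by blast
      then show False using e L by (auto simp: mono_edges_def full_def)
    qed
    then show "(\<forall>u\<in>U. \<kappa> (b u) \<noteq> \<kappa> u) \<and> mono_edges \<kappa> = {}"
      using L by (auto simp: full_def)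
  next
    assume R: "(\<forall>u\<in>U. \<kappa> (b u) \<noteq> \<kappa> u) \<and> mono_edges \<kappa> = {}"
    show "\<forall>u v. {u, v} \<in> edges full \<longrightarrow> \<kappa> u \<noteq> \<kappa> v"
    proof (intro allI impI notI)
      fix u v assume uv: "{u, v} \<in> edges full" and eq: "\<kappa> u = \<kappa> v"
      show False
      proof (cases "{u, v} \<in> E")
        case True
        then have "{u, v} \<in> mono_edges \<kappa>" using eq by (auto simp: mono_edges_def)
        then show False using R by blast
      next
        case False
        then obtain w where "w \<in> U" "{u, v} = {b w, w}"
          using uv by (auto simp: full_def)
        then show False using R eq by (metis doubleton_eq_iff)
      qed
    qed
  qed
  then show ?thesis
    by (auto simp: proper_colorings_def leaf_colorings_def full_def)
qed

lemma restrict_block_colorings: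
  "restrict \<kappa> (C \<union> W) \<in> block_colorings C W \<longleftrightarrow>
    (\<forall>x\<in>C. \<forall>y\<in>C. \<kappa> x = \<kappa> y) \<and> (\<forall>x\<in>C. \<forall>u\<in>W. \<kappa> x \<noteq> \<kappa> u)"
proof -
  let ?r = "restrict \<kappa> (C \<union> W)"
  have "(\<forall>x\<in>C. \<forall>y\<in>C. ?r x = ?r y) \<longleftrightarrow> (\<forall>x\<in>C. \<forall>y\<in>C. \<kappa> x = \<kappa> y)"
    by (intro ball_cong refl) simp
  moreover have "(\<forall>x\<in>C. \<forall>u\<in>W. ?r x \<noteq> ?r u) \<longleftrightarrow> (\<forall>x\<in>C. \<forall>u\<in>W. \<kappa> x \<noteq> \<kappa> u)"
    by (intro ball_cong refl) simp
  moreover have "?r \<in> C \<union> W \<rightarrow>\<^sub>E UNIV" by simp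
  ultimately show ?thesis
    unfolding block_colorings_def by blast
qed

text \<open>Constancy along the edges of \<open>S\<close> is constancy on its components, and the
  edge of a leaf \<open>u\<close> concerns only the component of \<open>b u\<close>; so the
  conditions decouple and the series factorizes.\<close>

lemma leaf_colorings_mono:
  assumes "S \<subseteq> E"
  shows "{\<kappa> \<in> leaf_colorings. S \<subseteq> mono_edges \<kappa>} =
    {\<kappa> \<in> V \<union> U \<rightarrow>\<^sub>E UNIV. \<forall>C\<in>comps V S. restrict \<kappa> (C \<union> leaves_at C) \<in> block_colorings C (leaves_at C)}"
proof -
  have "(\<forall>u\<in>U. \<kappa> (b u) \<noteq> \<kappa> u) \<and> S \<subseteq> mono_edges \<kappa> \<longleftrightarrow>
      (\<forall>C\<in>comps V S. (\<forall>x\<in>C. \<forall>y\<in>C. \<kappa> x = \<kappa> y) \<and> (\<forall>x\<in>C. \<forall>u\<in>leaves_at C. \<kappa> x \<noteq> \<kappa> u))"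
    for \<kappa> :: "'a \<Rightarrow> nat"
  proof
    assume L: "(\<forall>u\<in>U. \<kappa> (b u) \<noteq> \<kappa> u) \<and> S \<subseteq> mono_edges \<kappa>"
    have "\<kappa> x = \<kappa> y" if "(x, y) \<in> conn S" for x y
      using that by (rule conn_invariant) (use L in \<open>auto simp: mono_edges_def\<close>)
    then have c: "\<kappa> x = \<kappa> y" if "C \<in> comps V S" "x \<in> C" "y \<in> C" for C x y
      using that comps_conn by metis
    then show "\<forall>C\<in>comps V S. (\<forall>x\<in>C. \<forall>y\<in>C. \<kappa> x = \<kappa> y) \<and> (\<forall>x\<in>C. \<forall>u\<in>leaves_at C. \<kappa> x \<noteq> \<kappa> u)"
    proof (intro ballI conjI)
      fix C x u assume "C \<in> comps V S" "x \<in> C" "u \<in> leaves_at C"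
      then have "\<kappa> x = \<kappa> (b u)" "u \<in> U" using c[of C x "b u"] by simp_all
      then show "\<kappa> x \<noteq> \<kappa> u" using L by metis
    qed (rule c)
  next
    assume R: "\<forall>C\<in>comps V S. (\<forall>x\<in>C. \<forall>y\<in>C. \<kappa> x = \<kappa> y) \<and> (\<forall>x\<in>C. \<forall>u\<in>leaves_at C. \<kappa> x \<noteq> \<kappa> u)"
    show "(\<forall>u\<in>U. \<kappa> (b u) \<noteq> \<kappa> u) \<and> S \<subseteq> mono_edges \<kappa>"
    proof (intro conjI ballI subsetI)
      fix u assume u: "u \<in> U"
      then have "conn S `` {b u} \<in> comps V S" using b by (auto simp: comps_iff)
      from conjunct2[OF bspec[OF R this]] show "\<kappa> (b u) \<noteq> \<kappa> u" using u by simp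
    next
      fix e assume e: "e \<in> S"
      then have "e \<in> E" using assms by blast
      then obtain x y where xy: "e = {x, y}" using edge_pair by blast
      have "x \<in> V" using \<open>e \<in> E\<close> E[of e] xy by blast
      then have "conn S `` {x} \<in> comps V S" unfolding comps_iff by blast
      moreover have "x \<in> conn S `` {x}" "y \<in> conn S `` {x}" using e xy by (auto intro: conn_edge)
      ultimately have "\<kappa> x = \<kappa> y" using R by metis
      then have "\<forall>p\<in>e. \<forall>q\<in>e. \<kappa> p = \<kappa> q" unfolding xy by simp
      then show "e \<in> mono_edges \<kappa>" using \<open>e \<in> E\<close> unfolding mono_edges_def by blast
    qed
  qed
  then show ?thesis
    by (intro set_eqI) (simp only: leaf_colorings_def restrict_block_colorings mem_Collect_eq conj_assoc)
qed

lemma gser_leaf_colorings_mono: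
  assumes "S \<subseteq> E"
  shows "gser (V \<union> U) {\<kappa> \<in> leaf_colorings. S \<subseteq> mono_edges \<kappa>} = (\<Prod>C\<in>comps V S. block C (leaves_at C))"
proof -
  have un: "(\<Union>C\<in>comps V S. C \<union> leaves_at C) = V \<union> U"
    using Union_comps[OF Union_edges[OF assms]] b by auto
  have dj: "disjoint_family_on (\<lambda>C. C \<union> leaves_at C) (comps V S)"
    using disjoint_comps[of _ V S] comps_subset[OF _ Union_edges[OF assms]] disj
    unfolding disjoint_family_on_def by blast
  have "gser (\<Union>C\<in>comps V S. C \<union> leaves_at C)
      {\<kappa> \<in> (\<Union>C\<in>comps V S. C \<union> leaves_at C) \<rightarrow>\<^sub>E UNIV.
        \<forall>C\<in>comps V S. restrict \<kappa> (C \<union> leaves_at C) \<in> block_colorings C (leaves_at C)} =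
      (\<Prod>C\<in>comps V S. gser (C \<union> leaves_at C) (block_colorings C (leaves_at C)))"
  proof (intro gser_prod finite_comps finV dj block_colorings_subset)
    fix C assume "C \<in> comps V S"
    then show "finite (C \<union> leaves_at C)"
      using finU finite_comp[OF finV Union_edges[OF assms]] by simp
  qed
  then show ?thesis
    unfolding un leaf_colorings_mono[OF assms] block_def .
qed

text \<open>The indicator of \<open>mono_edges \<kappa> = {}\<close> is the alternating sum over all
  subsets of \<open>mono_edges \<kappa>\<close>. Exchanging the sums collects, for each
  \<open>S\<close>, the colorings that are constant along \<open>S\<close>.\<close>

lemma chromatic_blocks:
  "Ser (chromatic_sf full) =
    (\<Sum>S\<in>Pow E. of_int ((- 1) ^ card S) *\<^sub>s (\<Prod>C\<in>comps V S. block C (leaves_at C)))"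
proof (intro coeff_inject[THEN iffD1] ext)
  fix m
  let ?X = "fibre leaf_colorings (V \<union> U) m"
  have fin: "finite ?X"
    by (rule finite_colorings_of_monomial) (use finV finU in \<open>auto simp: leaf_colorings_def\<close>)
  have finM: "finite (mono_edges \<kappa>)" for \<kappa>
    using finE by (simp add: mono_edges_def)
  have "fibre (proper_colorings full) (verts full) m =
      {\<kappa> \<in> ?X. mono_edges \<kappa> = {}}"
    unfolding proper_colorings_full by (auto simp: full_def)
  then have "coeff (Ser (chromatic_sf full)) m = rat_of_nat (card {\<kappa> \<in> ?X. mono_edges \<kappa> = {}})"
    by (simp only: coeff_gser flip: gser_chromatic)
  also have "\<dots> = (\<Sum>\<kappa>\<in>?X. if mono_edges \<kappa> = {} then 1 else 0)"
    using fin by (simp add: sum.If_cases Int_def)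
  also have "\<dots> = (\<Sum>\<kappa>\<in>?X. \<Sum>S\<in>Pow (mono_edges \<kappa>). (- 1) ^ card S)"
    using finM by (simp add: sum_Pow_sign)
  also have "\<dots> = (\<Sum>\<kappa>\<in>?X. \<Sum>S\<in>Pow E. if S \<subseteq> mono_edges \<kappa> then (- 1) ^ card S else 0)"
  proof (rule sum.cong[OF refl])
    fix \<kappa>
    have "{S \<in> Pow E. S \<subseteq> mono_edges \<kappa>} = Pow (mono_edges \<kappa>)"
      by (auto simp: mono_edges_def)
    then show "(\<Sum>S\<in>Pow (mono_edges \<kappa>). (- 1) ^ card S) =
        (\<Sum>S\<in>Pow E. if S \<subseteq> mono_edges \<kappa> then (- 1) ^ card S else (0 :: rat))"
      using finE by (simp add: sum.inter_filter[symmetric])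
  qed
  also have "\<dots> = (\<Sum>S\<in>Pow E. \<Sum>\<kappa>\<in>?X. if S \<subseteq> mono_edges \<kappa> then (- 1) ^ card S else 0)"
    by (rule sum.swap)
  also have "\<dots> = (\<Sum>S\<in>Pow E. (- 1) ^ card S * of_nat (card {\<kappa> \<in> ?X. S \<subseteq> mono_edges \<kappa>}))"
    using fin by (simp add: sum.If_cases Int_def mult.commute)
  also have "\<dots> = (\<Sum>S\<in>Pow E. (- 1) ^ card S * coeff (gser (V \<union> U) {\<kappa> \<in> leaf_colorings. S \<subseteq> mono_edges \<kappa>}) m)"
    by (intro sum.cong refl arg_cong2[of _ _ _ _ "(*)"])
      (auto simp: coeff_gser intro!: arg_cong[of _ _ card])
  also have "\<dots> = coeff (\<Sum>S\<in>Pow E. of_int ((- 1) ^ card S) *\<^sub>s (\<Prod>C\<in>comps V S. block C (leaves_at C))) m"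
    by (simp add: coeff_sum sscale.rep_eq gser_leaf_colorings_mono)
  finally show "coeff (Ser (chromatic_sf full)) m = \<dots>" .
qed

abbreviation choices :: "'a set set \<Rightarrow> ('a set \<Rightarrow> nat) set" where
  "choices S \<equiv> \<Pi>\<^sub>E C\<in>comps V S. {..<card C}"

text \<open>The terms after multiplying out: an edge set \<open>S\<close> and, for each component
  \<open>C\<close>, the index \<open>g C\<close> of one term of its block expansion.\<close>

definition indices :: "('a set set \<times> ('a set \<Rightarrow> nat)) set" where
  "indices = (SIGMA S:Pow E. choices S)"

definition parts :: "'a set set \<times> ('a set \<Rightarrow> nat) \<Rightarrow> nat multiset" where
  "parts = (\<lambda>(S, g). \<Sum>C\<in>comps V S. block_parts (card C) (\<Sum>v\<in>C. nleaves v) (g C))"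

definition weight :: "'a set set \<times> ('a set \<Rightarrow> nat) \<Rightarrow> int" where
  "weight = (\<lambda>(S, g). (- 1) ^ card S * (\<Prod>C\<in>comps V S. block_coeff (card C) (g C)))"

lemma finite_indices: "finite indices"
  unfolding indices_def using finE finite_comps[OF finV]
  by (intro finite_SigmaI finite_PiE) auto

lemma chromatic_stars:
  "Ser (chromatic_sf full) = (\<Sum>j\<in>indices. of_int (weight j) *\<^sub>s stars (parts j))"
proof -
  have "(\<Prod>C\<in>comps V S. block C (leaves_at C)) =
      (\<Sum>g\<in>choices S.
        of_int (\<Prod>C\<in>comps V S. block_coeff (card C) (g C)) *\<^sub>s stars (parts (S, g)))"
    if S: "S \<in> Pow E" for S
  proof -
    have "block C (leaves_at C) = (\<Sum>i<card C. of_int (block_coeff (card C) i) *\<^sub>s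
        stars (block_parts (card C) (\<Sum>v\<in>C. nleaves v) i))" if C: "C \<in> comps V S" for C
    proof -
      have U: "\<Union>S \<subseteq> V" using S Union_edges by blast
      have *: "C \<subseteq> V" "finite C" "C \<noteq> {}"
        using comps_subset[OF C U] finite_comp[OF finV U C] comps_nonempty[OF C] by auto
      moreover have "C \<inter> leaves_at C = {}" using * disj by auto
      moreover have "finite (leaves_at C)" using finU by simp
      ultimately show ?thesis
        unfolding card_leaves_at[OF *(2), symmetric] by (intro block_expansion)
    qed
    then have "(\<Prod>C\<in>comps V S. block C (leaves_at C)) = (\<Prod>C\<in>comps V S. \<Sum>i<card C.
        of_int (block_coeff (card C) i) *\<^sub>s stars (block_parts (card C) (\<Sum>v\<in>C. nleaves v) i))"
      by (rule prod.cong[OF refl])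
    also have "\<dots> = (\<Sum>g\<in>choices S. \<Prod>C\<in>comps V S.
        of_int (block_coeff (card C) (g C)) *\<^sub>s stars (block_parts (card C) (\<Sum>v\<in>C. nleaves v) (g C)))"
      by (rule prod_sum_PiE) (auto simp: finite_comps finV)
    finally show ?thesis
      by (simp add: prod_sscale parts_def stars_sum finite_comps finV)
  qed
  then have "Ser (chromatic_sf full) = (\<Sum>S\<in>Pow E. \<Sum>g\<in>choices S.
      of_int (weight (S, g)) *\<^sub>s stars (parts (S, g)))"
    unfolding chromatic_blocks by (intro sum.cong refl) (simp add: ser.scale_sum_right weight_def)
  also have "\<dots> = (\<Sum>j\<in>indices. of_int (weight j) *\<^sub>s stars (parts j))"
    unfolding indices_def using finE finite_comps[OF finV]
    by (subst sum.Sigma) (auto intro!: finite_PiE)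
  finally show ?thesis .
qed

end

section \<open>Uniqueness of the star-expansion\<close>

text \<open>For \<open>k > 0\<close> this is the power sum symmetric function, seen as a block
  without leaves so that \<open>block_expansion\<close> applies.\<close>

definition psum :: "nat \<Rightarrow> ser" where
  "psum k = block {0..<k} {}"

definition psums :: "nat list \<Rightarrow> ser" where
  "psums lam = prod_list (map psum lam)"

text \<open>The variable \<open>ks ! i\<close> receives the exponent \<open>lam ! i\<close>;
  exponents of repeated entries of \<open>ks\<close> add up.\<close>

definition monomial :: "nat list \<Rightarrow> nat list \<Rightarrow> nat multiset" where
  "monomial lam ks = sum_list (map2 replicate_mset lam ks)"

lemma image_mset_block_coloring:
  assumes "\<kappa> \<in> block_colorings {0..<k} {}"
  shows "image_mset \<kappa> (mset_set {0..<k}) = replicate_mset k (\<kappa> 0)"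
proof -
  have const: "\<kappa> x = \<kappa> 0" if "x \<in> {0..<k}" for x
  proof -
    have "0 \<in> {0..<k}" using that by auto
    then show ?thesis using assms that unfolding block_colorings_def by blast
  qed
  have "image_mset \<kappa> (mset_set {0..<k}) = image_mset (\<lambda>_. \<kappa> 0) (mset_set {0..<k})"
    by (rule image_mset_cong, rule const) simp
  then show ?thesis by (simp add: image_mset_const_eq)
qed

lemma coeff_psum_nonneg: "0 \<le> coeff (psum k) m"
  by (simp add: psum_def block_def coeff_gser)

lemma coeff_psum_nonzero: "coeff (psum k) m \<noteq> 0 \<Longrightarrow> \<exists>i. m = replicate_mset k i"
proof -
  assume "coeff (psum k) m \<noteq> 0"
  then have "{\<kappa> \<in> block_colorings {0..<k} {}. image_mset \<kappa> (mset_set {0..<k}) = m} \<noteq> {}"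
    unfolding psum_def block_def coeff_gser by force
  then show ?thesis using image_mset_block_coloring by blast
qed

lemma coeff_psum_pos: "0 < coeff (psum k) (replicate_mset k i)"
proof -
  let ?k = "restrict (\<lambda>_. i) {0..<k}"
  let ?K = "{\<kappa> \<in> block_colorings {0..<k} {}. image_mset \<kappa> (mset_set {0..<k}) = replicate_mset k i}"
  have b: "?k \<in> block_colorings {0..<k} {}"
    by (simp add: block_colorings_def)
  have "replicate_mset k (?k 0) = replicate_mset k i" by (cases k) auto
  then have "?k \<in> ?K" using b image_mset_block_coloring[OF b] by simp
  moreover have "finite ?K"
    by (rule finite_colorings_of_monomial) (use block_colorings_subset[of "{0..<k}" "{}"] in auto)
  ultimately have "0 < card ?K" by (auto simp: card_gt_0_iff)
  then show ?thesis by (simp add: psum_def block_def coeff_gser)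
qed

lemma coeff_times: "coeff (f * g) m = (\<Sum>a\<in>{a. a \<subseteq># m}. coeff f a * coeff g (m - a))"
  by (simp add: times_ser.rep_eq series_mult_def)

lemma coeff_psums_nonneg: "0 \<le> coeff (psums lam) m"
proof (induction lam arbitrary: m)
  case Nil
  then show ?case by (simp add: psums_def one_ser.rep_eq series_one_def)
next
  case (Cons k lam)
  have "psums (k # lam) = psum k * psums lam" by (simp add: psums_def)
  then show ?case
    using Cons.IH coeff_psum_nonneg by (simp add: coeff_times sum_nonneg)
qed

lemma coeff_psums_nonzero:
  "coeff (psums lam) m \<noteq> 0 \<Longrightarrow> \<exists>ks. length ks = length lam \<and> m = monomial lam ks"
proof (induction lam arbitrary: m)
  case Nil
  then show ?case
    by (simp add: psums_def one_ser.rep_eq series_one_def monomial_def split: if_splits)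
next
  case (Cons k lam)
  have "psums (k # lam) = psum k * psums lam" by (simp add: psums_def)
  then have "(\<Sum>a\<in>{a. a \<subseteq># m}. coeff (psum k) a * coeff (psums lam) (m - a)) \<noteq> 0"
    using Cons.prems by (simp add: coeff_times)
  then obtain a where a: "a \<subseteq># m" "coeff (psum k) a \<noteq> 0" "coeff (psums lam) (m - a) \<noteq> 0"
    by (metis (no_types, lifting) mem_Collect_eq mult_eq_0_iff sum.neutral)
  then obtain i ks where "a = replicate_mset k i" "length ks = length lam" "m - a = monomial lam ks"
    using coeff_psum_nonzero Cons.IH by blast
  then have "length (i # ks) = length (k # lam) \<and> m = monomial (k # lam) (i # ks)"
    using a(1) by (simp add: monomial_def) (metis subset_mset.add_diff_inverse)
  then show ?case by blast
qed

text \<open>All coefficients are nonnegative, so nothing cancels and one positive summand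
  suffices.\<close>

lemma coeff_psums_pos:
  "length ks = length lam \<Longrightarrow> 0 < coeff (psums lam) (monomial lam ks)"
proof (induction ks lam rule: list_induct2)
  case Nil
  then show ?case by (simp add: psums_def one_ser.rep_eq series_one_def monomial_def)
next
  case (Cons i ks k lam)
  let ?m = "monomial (k # lam) (i # ks)"
  have m: "?m = replicate_mset k i + monomial lam ks" by (simp add: monomial_def)
  have "0 < coeff (psum k) (replicate_mset k i) * coeff (psums lam) (?m - replicate_mset k i)"
    using Cons.IH coeff_psum_pos by (simp add: m)
  also have "\<dots> \<le> (\<Sum>a\<in>{a. a \<subseteq># ?m}. coeff (psum k) a * coeff (psums lam) (?m - a))"
    by (rule member_le_sum)
      (simp_all add: finite_submultisets coeff_psum_nonneg coeff_psums_nonneg, simp add: m)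
  also have "\<dots> = coeff (psums (k # lam)) ?m"
    by (simp add: coeff_times psums_def)
  finally show ?case .
qed

lemma set_monomial:
  "length ks = length lam \<Longrightarrow> set_mset (monomial lam ks) \<subseteq> set ks \<and>
    (0 \<notin> set lam \<longrightarrow> set_mset (monomial lam ks) = set ks)"
  by (induction ks lam rule: list_induct2) (auto simp: monomial_def split: if_splits)

lemma mset_from_monomial:
  "length ks = length lam \<Longrightarrow> distinct ks \<Longrightarrow> mset lam = image_mset (count (monomial lam ks)) (mset ks)"
proof (induction ks lam rule: list_induct2)
  case (Cons i ks k lam)
  have m: "monomial (k # lam) (i # ks) = replicate_mset k i + monomial lam ks" by (simp add: monomial_def)
  have "i \<notin># monomial lam ks"
    using set_monomial[OF Cons.hyps] Cons.prems by auto
  then have "count (monomial (k # lam) (i # ks)) i = k"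
    by (simp add: m not_in_iff)
  moreover have "image_mset (count (monomial (k # lam) (i # ks))) (mset ks) =
      image_mset (count (monomial lam ks)) (mset ks)"
    using Cons.prems by (intro image_mset_cong) (auto simp: m)
  ultimately show ?case using Cons by simp
qed simp

lemma sorted_rev_mset_eq: "sorted (rev xs) \<Longrightarrow> sorted (rev ys) \<Longrightarrow> mset xs = mset ys \<Longrightarrow> xs = ys"
  for xs ys :: "'b :: linorder list"
  by (metis mset_rev properties_for_sort rev_rev_ident)

lemma length_le_sum_list: "0 \<notin> set (lam :: nat list) \<Longrightarrow> length lam \<le> sum_list lam"
  by (induction lam) auto

lemma finite_partitions: "finite (partitions n)"
proof (rule finite_subset)
  show "partitions n \<subseteq> {lam. set lam \<subseteq> {..n} \<and> length lam \<le> n}"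
  proof
    fix lam assume "lam \<in> partitions n"
    then have "0 \<notin> set lam" "sum_list lam = n" by (auto simp: partitions_def)
    then show "lam \<in> {lam. set lam \<subseteq> {..n} \<and> length lam \<le> n}"
      using length_le_sum_list[of lam] member_le_sum_list[of _ lam] by auto
  qed
qed (simp add: finite_lists_length_le)

text \<open>The monomial with exponents \<open>nu\<close> occurs in \<open>psums lam\<close> only if \<open>lam\<close> refines \<open>nu\<close>; so one takes a longest \<open>nu\<close>.\<close>

lemma psums_independent:
  assumes "(\<Sum>lam\<in>partitions n. d lam *\<^sub>s psums lam) = 0" "mu \<in> partitions n"
  shows "d mu = 0"
proof (rule ccontr)
  assume "d mu \<noteq> 0"
  let ?D = "{lam \<in> partitions n. d lam \<noteq> 0}"
  have "finite ?D" "?D \<noteq> {}"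
    using finite_partitions assms(2) \<open>d mu \<noteq> 0\<close> by auto
  then obtain nu where nu: "nu \<in> ?D" and max: "\<And>lam. lam \<in> ?D \<Longrightarrow> length lam \<le> length nu"
  proof -
    have "Max (length ` ?D) \<in> length ` ?D"
      using \<open>finite ?D\<close> \<open>?D \<noteq> {}\<close> by (intro Max_in) auto
    then obtain nu where nu: "nu \<in> ?D" "length nu = Max (length ` ?D)"
      by (metis (no_types, lifting) imageE)
    show thesis
    proof
      show "nu \<in> ?D" by (rule nu(1))
      fix lam assume "lam \<in> ?D"
      then show "length lam \<le> length nu"
        unfolding nu(2) using \<open>finite ?D\<close> by (intro Max_ge finite_imageI imageI)
    qed
  qed
  let ?m = "monomial nu [0..<length nu]"
  have z: "d lam * coeff (psums lam) ?m = 0" if lam: "lam \<in> partitions n" "lam \<noteq> nu" for lam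
  proof (rule ccontr)
    assume "d lam * coeff (psums lam) ?m \<noteq> 0"
    then have "length lam \<le> length nu" and nz: "coeff (psums lam) ?m \<noteq> 0"
      using max lam by auto
    from nz obtain ks where ks: "length ks = length lam" "?m = monomial lam ks"
      using coeff_psums_nonzero by blast
    have "{0..<length nu} = set_mset ?m"
      using set_monomial[of "[0..<length nu]" nu] nu by (auto simp: partitions_def)
    also have "\<dots> = set ks"
      using set_monomial[OF ks(1)] ks(2) lam(1) by (auto simp: partitions_def)
    finally have set: "set ks = {0..<length nu}" by simp
    \<comment> \<open>By the choice of \<open>nu\<close>, \<open>ks\<close> has at most
      \<open>length nu\<close> entries, yet it uses \<open>length nu\<close> variables. So none
      repeats, and the exponents of \<open>?m\<close> are precisely the parts of
      \<open>lam\<close>.\<close>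
    then have "card (set ks) = length ks"
      using card_length[of ks] \<open>length lam \<le> length nu\<close> ks(1) by simp
    then have dist: "distinct ks" by (rule card_distinct)
    then have "mset ks = mset [0..<length nu]"
      using set by (intro set_eq_iff_mset_eq_distinct[THEN iffD1]) auto
    then have "mset lam = mset nu"
      using mset_from_monomial[OF ks(1) dist] mset_from_monomial[of "[0..<length nu]" nu] ks(2) by simp
    then show False
      using sorted_rev_mset_eq lam nu by (auto simp: partitions_def)
  qed
  have "0 = (\<Sum>lam\<in>partitions n. d lam * coeff (psums lam) ?m)"
    using arg_cong[OF assms(1), of "\<lambda>f. coeff f ?m"] by (simp add: coeff_sum sscale.rep_eq zero_ser.rep_eq)
  also have "\<dots> = d nu * coeff (psums nu) ?m"
  proof -
    have "(\<Sum>lam\<in>partitions n - {nu}. d lam * coeff (psums lam) ?m) = 0"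
      by (rule sum.neutral) (use z in blast)
    then show ?thesis
      using nu by (subst sum.remove[OF finite_partitions, of nu]) auto
  qed
  finally show False
    using nu coeff_psums_pos[of "[0..<length nu]" nu] by auto
qed

section \<open>From power sums to star products\<close>

definition star_products :: "nat \<Rightarrow> ser set" where
  "star_products n = (\<lambda>lam. stars (mset lam)) ` partitions n"

definition desc :: "nat multiset \<Rightarrow> nat list" where
  "desc M = rev (sorted_list_of_multiset M)"

lemma mset_desc [simp]: "mset (desc M) = M"
  by (simp add: desc_def)

lemma desc_in_partitions: "0 \<notin># M \<Longrightarrow> desc M \<in> partitions (sum_mset M)"
  by (auto simp: partitions_def desc_def sum_mset_sum_list[symmetric] simp flip: set_mset_mset sum_list_rev)

lemma desc_mset: "lam \<in> partitions n \<Longrightarrow> desc (mset lam) = lam"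
  by (rule sorted_rev_mset_eq) (auto simp: partitions_def desc_def)

lemma stars_in_star_products: "0 \<notin># M \<Longrightarrow> sum_mset M = n \<Longrightarrow> stars M \<in> star_products n"
  unfolding star_products_def using desc_in_partitions[of M] by (intro image_eqI[of _ _ "desc M"]) auto

lemma star_products_times:
  assumes "f \<in> ser.span (star_products m)" "g \<in> ser.span (star_products n)"
  shows "f * g \<in> ser.span (star_products (m + n))"
proof -
  have base: "f * g \<in> ser.span (star_products (m + n))"
    if fg: "f \<in> star_products m" "g \<in> star_products n" for f g
  proof -
    obtain a b where "f = stars (mset a)" "g = stars (mset b)" "a \<in> partitions m" "b \<in> partitions n"
      using fg unfolding star_products_def by blast
    then show ?thesis
      by (auto simp: partitions_def sum_mset_sum_list simp flip: stars_add intro!: ser.span_base stars_in_star_products)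
  qed
  have left: "f * g \<in> ser.span (star_products (m + n))" if f: "f \<in> star_products m" for f
    using assms(2)
  proof (induction rule: ser.span_induct_alt)
    case (step c x y)
    have "f * (c *\<^sub>s x + y) = c *\<^sub>s (f * x) + f * y"
      by (simp add: distrib_left sscale_mult_right)
    then show ?case
      using step base[OF f] by (simp add: ser.span_add ser.span_scale)
  qed (simp add: ser.span_zero)
  show ?thesis
    using assms(1)
  proof (induction rule: ser.span_induct_alt)
    case (step c x y)
    have "(c *\<^sub>s x + y) * g = c *\<^sub>s (x * g) + y * g"
      by (simp add: distrib_right sscale_mult_left)
    then show ?case
      using step left by (simp add: ser.span_add ser.span_scale)
  qed (simp add: ser.span_zero)
qed

lemma block_parts_valid: "i < k \<Longrightarrow> 0 \<notin># block_parts k l i \<and> sum_mset (block_parts k l i) = k + l"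
  by (auto simp: block_parts_def)

text \<open>The block expansion with no leaves, in which all terms have degree
  \<open>k\<close>.\<close>

lemma psum_in_span: "k > 0 \<Longrightarrow> psum k \<in> ser.span (star_products k)"
  unfolding psum_def
proof (subst block_expansion)
  show "(\<Sum>i<card {0..<k}. of_int (block_coeff (card {0..<k}) i) *\<^sub>s
      stars (block_parts (card {0..<k}) (card ({} :: nat set)) i)) \<in> ser.span (star_products k)"
  proof (intro ser.span_sum ser.span_scale ser.span_base stars_in_star_products)
    fix i assume "i \<in> {..<card {0..<k}}"
    then show "0 \<notin># block_parts (card {0..<k}) (card ({} :: nat set)) i"
      "\<Sum>\<^sub># (block_parts (card {0..<k}) (card ({} :: nat set)) i) = k"
      using block_parts_valid[of i k 0] by simp_all
  qed
qed auto

lemma psums_in_span: "0 \<notin> set lam \<Longrightarrow> psums lam \<in> ser.span (star_products (sum_list lam))"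
proof (induction lam)
  case Nil
  have "stars {#} \<in> star_products 0" by (rule stars_in_star_products) auto
  then show ?case by (auto simp: psums_def stars_def intro: ser.span_base)
next
  case (Cons k lam)
  then have "psum k * psums lam \<in> ser.span (star_products (k + sum_list lam))"
    by (intro star_products_times psum_in_span) auto
  then show ?case by (simp add: psums_def)
qed

text \<open>The independent power sum products lie in the span of the equally many star products.\<close>

lemma stars_independent:
  assumes "(\<Sum>lam\<in>partitions n. d lam *\<^sub>s stars (mset lam)) = 0" "mu \<in> partitions n"
  shows "d mu = 0"
proof -
  let ?P = "partitions n" and ?f = "\<lambda>lam. stars (mset lam)"
  have inj: "inj_on psums ?P"
  proof (rule inj_onI, rule ccontr)
    fix a b assume ab: "a \<in> ?P" "b \<in> ?P" "psums a = psums b" "a \<noteq> b"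
    let ?d = "\<lambda>lam. if lam = a then 1 else if lam = b then - 1 else 0 :: rat"
    have "(\<Sum>lam\<in>?P. ?d lam *\<^sub>s psums lam) = (\<Sum>lam\<in>{a, b}. ?d lam *\<^sub>s psums lam)"
      using ab finite_partitions by (intro sum.mono_neutral_right) auto
    also have "\<dots> = 0" using ab by simp
    finally have "?d a = 0" using ab(1) by (rule psums_independent)
    then show False by simp
  qed
  have ind: "ser.independent (psums ` ?P)"
    unfolding ser.independent_explicit_finite_subsets
  proof (intro allI impI ballI)
    fix A u v
    assume A: "A \<subseteq> psums ` ?P" "finite A" "(\<Sum>v\<in>A. u v *\<^sub>s v) = 0" "v \<in> A"
    let ?d = "\<lambda>lam. if psums lam \<in> A then u (psums lam) else 0"
    have "(\<Sum>lam\<in>?P. ?d lam *\<^sub>s psums lam) = (\<Sum>v\<in>psums ` ?P. (if v \<in> A then u v else 0) *\<^sub>s v)"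
      by (simp add: sum.reindex[OF inj])
    also have "\<dots> = (\<Sum>v\<in>A. u v *\<^sub>s v)"
      using A finite_partitions by (intro sum.mono_neutral_cong_right) auto
    finally have "(\<Sum>lam\<in>?P. ?d lam *\<^sub>s psums lam) = 0" using A(3) by simp
    then have "?d lam = 0" if "lam \<in> ?P" for lam using that by (rule psums_independent)
    then show "u v = 0" using A by force
  qed
  \<comment> \<open>\<open>B\<close> spans all star products and thereby all power sum products, so
    it has at least as many elements as there are partitions.\<close>
  obtain B where B: "B \<subseteq> star_products n" "ser.independent B" "star_products n \<subseteq> ser.span B"
    using ser.maximal_independent_subset by blast
  have finB: "finite B"
    by (rule finite_subset[OF B(1)]) (simp add: star_products_def finite_partitions)
  have "psums ` ?P \<subseteq> ser.span B"
  proof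
    fix x assume "x \<in> psums ` ?P"
    then have "x \<in> ser.span (star_products n)"
      using psums_in_span by (auto simp: partitions_def)
    then show "x \<in> ser.span B" using B(3) ser.span_minimal[OF _ ser.subspace_span] by blast
  qed
  then have "card ?P \<le> card B"
    using ser.independent_span_bound[OF finB ind] card_image[OF inj] by simp
  moreover have "card B \<le> card (star_products n)"
    using B(1) finite_partitions by (intro card_mono) (auto simp: star_products_def)
  moreover have "card (star_products n) \<le> card ?P"
    unfolding star_products_def by (rule card_image_le[OF finite_partitions])
  \<comment> \<open>The chain of inequalities closes up: \<open>B\<close> consists of all star
    products, and different partitions have different star products.\<close>
  ultimately have "card B = card (star_products n)" "card (?f ` ?P) = card ?P"
    by (auto simp: star_products_def)
  then have "B = star_products n" and injf: "inj_on ?f ?P"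
    using card_subset_eq[OF _ B(1)] eq_card_imp_inj_on[OF finite_partitions, of ?f] finite_partitions
    by (simp_all add: star_products_def)
  then have indf: "ser.independent (?f ` ?P)" using B(2) by (simp add: star_products_def)
  let ?u = "\<lambda>v. d (the_inv_into ?P ?f v)"
  have "(\<Sum>v\<in>?f ` ?P. ?u v *\<^sub>s v) = 0"
  proof -
    have "(\<Sum>v\<in>?f ` ?P. ?u v *\<^sub>s v) = (\<Sum>lam\<in>?P. ?u (?f lam) *\<^sub>s ?f lam)"
      by (simp only: sum.reindex[OF injf] comp_def)
    also have "\<dots> = (\<Sum>lam\<in>?P. d lam *\<^sub>s ?f lam)"
      by (rule sum.cong) (simp_all add: the_inv_into_f_f[OF injf])
    finally show ?thesis using assms(1) by simp
  qed
  then have "?u (?f mu) = 0"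
    using assms(2) by (intro ser.independentD[OF indf _ subset_refl]) (auto simp: finite_partitions)
  then show ?thesis using the_inv_into_f_f[OF injf assms(2)] by simp
qed

lemma is_star_expansion_iff:
  "is_star_expansion G c \<longleftrightarrow> (\<forall>lam. lam \<notin> partitions (card (verts G)) \<longrightarrow> c lam = 0) \<and>
    Ser (chromatic_sf G) = (\<Sum>lam\<in>partitions (card (verts G)). c lam *\<^sub>s stars (mset lam))"
proof -
  have "(\<forall>m. chromatic_sf G m = (\<Sum>lam\<in>partitions (card (verts G)). c lam * star_sf lam m)) \<longleftrightarrow>
      coeff (Ser (chromatic_sf G)) = coeff (\<Sum>lam\<in>partitions (card (verts G)). c lam *\<^sub>s stars (mset lam))"
    by (simp add: fun_eq_iff Ser_inverse coeff_sum sscale.rep_eq coeff_stars)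
  then show ?thesis
    by (simp add: is_star_expansion_def coeff_inject)
qed

text \<open>Gives the definite description a value: two expansions differ by a linear relation
  between star products.\<close>

lemma star_coeff_eq:
  assumes "is_star_expansion G c"
  shows "star_coeff G = c"
  unfolding star_coeff_def
proof (rule the_equality, rule assms)
  fix c' assume c': "is_star_expansion G c'"
  let ?P = "partitions (card (verts G))"
  have "(\<Sum>lam\<in>?P. (c' lam - c lam) *\<^sub>s stars (mset lam)) = 0"
    using assms c' by (simp add: is_star_expansion_iff ser.scale_left_diff_distrib sum_subtractf)
  then have "c' lam - c lam = 0" if "lam \<in> ?P" for lam
    using that by (rule stars_independent)
  then show "c' = c"
    using assms c' by (auto simp: is_star_expansion_iff fun_eq_iff) (metis eq_iff_diff_eq_0)
qed

section \<open>The leading partition\<close>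

text \<open>On partitions, the lexicographic order agrees with the Dershowitz--Manna order of the multisets of parts.\<close>

lemma less_imp_mset_le:
  fixes xs ys :: "nat list"
  assumes "sorted (rev xs)" "xs < ys"
  shows "mset xs \<le> mset ys"
proof -
  from assms(2) consider a v where "ys = xs @ a # v"
    | u a b v w where "a < b" "xs = u @ a # v" "ys = u @ b # w"
    unfolding list_less_def lexord_def by blast
  then show ?thesis
  proof cases
    case 1
    then show ?thesis by (simp add: subset_eq_imp_le_multiset)
  next
    case 2
    have "x < b" if "x \<in> set (a # v)" for x
      using that 2 assms(1) by (auto simp: sorted_append)
    then have "mset (a # v) < mset (b # w)"
      by (intro ex_gt_imp_less_multiset) auto
    then have "mset (a # v) \<le> mset (b # w)" by simp
    then show ?thesis using add_left_mono[of "mset (a # v)" "mset (b # w)" "mset u"] 2 by simp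
  qed
qed

text \<open>Different \<open>j\<close> may share a multiset and cancel, hence the coefficients are
  collected over the fibres of \<open>N\<close>. A list below \<open>desc M\<close> has a multiset
  below \<open>M\<close>, where the collected coefficient is 0.\<close>

lemma mset_leading_partition:
  assumes "finite J" "Ser (chromatic_sf G) = (\<Sum>j\<in>J. of_int (w j) *\<^sub>s stars (N j))"
    and N: "\<And>j. j \<in> J \<Longrightarrow> 0 \<notin># N j \<and> sum_mset (N j) = card (verts G)"
    and nz: "(\<Sum>j\<in>{j \<in> J. N j = M}. w j) \<noteq> 0"
    and z: "\<And>M'. M' < M \<Longrightarrow> (\<Sum>j\<in>{j \<in> J. N j = M'}. w j) = 0"
  shows "mset (leading_partition G) = M"
proof -
  let ?P = "partitions (card (verts G))"
  define c where "c = (\<lambda>lam. if lam \<in> ?P then rat_of_int (\<Sum>j\<in>{j \<in> J. N j = mset lam}. w j) else 0)"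
  have eq: "{j \<in> J. desc (N j) = lam} = {j \<in> J. N j = mset lam}" if "lam \<in> ?P" for lam
    using desc_mset[OF that] by auto
  have "(\<Sum>j\<in>J. of_int (w j) *\<^sub>s stars (N j)) =
      (\<Sum>lam\<in>?P. \<Sum>j\<in>{j \<in> J. desc (N j) = lam}. of_int (w j) *\<^sub>s stars (N j))"
  proof (rule sum.group[symmetric])
    show "(\<lambda>j. desc (N j)) ` J \<subseteq> ?P" using N desc_in_partitions by fastforce
  qed (use assms(1) finite_partitions in auto)
  also have "\<dots> = (\<Sum>lam\<in>?P. c lam *\<^sub>s stars (mset lam))"
  proof (rule sum.cong[OF refl])
    fix lam assume lam: "lam \<in> ?P"
    then show "(\<Sum>j\<in>{j \<in> J. desc (N j) = lam}. of_int (w j) *\<^sub>s stars (N j)) = c lam *\<^sub>s stars (mset lam)"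
      by (simp add: eq c_def ser.scale_sum_left)
  qed
  finally have "is_star_expansion G c"
    using assms(2) by (simp add: is_star_expansion_iff c_def)
  then have sc: "star_coeff G = c" by (rule star_coeff_eq)
  have "{j \<in> J. N j = M} \<noteq> {}" using nz by (metis sum.empty)
  then have M: "0 \<notin># M" "sum_mset M = card (verts G)" using N by auto
  then have dM: "desc M \<in> ?P" using desc_in_partitions by metis
  have "leading_partition G = desc M"
    unfolding leading_partition_def sc
  proof (rule Min_eqI)
    show "finite {lam \<in> ?P. c lam \<noteq> 0}" using finite_partitions by simp
    show "desc M \<in> {lam \<in> ?P. c lam \<noteq> 0}" using dM nz by (simp add: c_def del: of_int_sum)
    fix lam assume lam: "lam \<in> {lam \<in> ?P. c lam \<noteq> 0}"
    show "desc M \<le> lam"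
    proof (rule ccontr)
      assume "\<not> desc M \<le> lam"
      then have less: "lam < desc M" by simp
      have "mset lam \<le> M"
        using less_imp_mset_le[OF _ less] lam by (simp add: partitions_def)
      moreover have "mset lam \<noteq> M" using less desc_mset lam by fastforce
      ultimately have "mset lam < M" by simp
      then have "(\<Sum>j\<in>{j \<in> J. N j = mset lam}. w j) = 0" by (rule z)
      then have "c lam = 0" unfolding c_def by (simp only: of_int_0 if_cancel)
      then show False using lam by simp
    qed
  qed
  then show ?thesis by simp
qed

section \<open>The two smallest partitions\<close>

definition sep :: "'a set set \<Rightarrow> 'a set \<Rightarrow> bool" where
  "sep S L \<longleftrightarrow> (\<forall>x\<in>L. \<forall>y\<in>L. (x, y) \<in> conn S \<longrightarrow> x = y)"

definition free_comps :: "'a set \<Rightarrow> 'a set set \<Rightarrow> 'a set \<Rightarrow> 'a set set" where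
  "free_comps V S L = {C \<in> comps V S. C \<inter> L = {}}"

text \<open>The number of edges in a spanning forest of the components that avoid \<open>L\<close>.
  It arises because the block coefficient for \<open>i = 1\<close> is \<open>-(k - 1)\<close>, which
  also explains the leading minus in \<open>coeff1\<close>.\<close>

definition free_rank :: "'a set \<Rightarrow> 'a set set \<Rightarrow> 'a set \<Rightarrow> int" where
  "free_rank V S L = (\<Sum>C\<in>free_comps V S L. int (card C) - 1)"

definition coeff0 :: "'a set set \<Rightarrow> 'a set \<Rightarrow> int" where
  "coeff0 E L = (\<Sum>S\<in>Pow E. if sep S L then (- 1) ^ card S else 0)"

definition coeff1 :: "'a set \<Rightarrow> 'a set set \<Rightarrow> 'a set \<Rightarrow> int" where
  "coeff1 V E L = - (\<Sum>S\<in>Pow E. if sep S L then (- 1) ^ card S * free_rank V S L else 0)"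

lemma image_mset_of_sum: "image_mset f (\<Sum>x\<in>A. F x) = (\<Sum>x\<in>A. image_mset f (F x))"
  by (induction A rule: infinite_finite_induct) simp_all

lemma sum_mset_of_sum: "\<Sum>\<^sub># (\<Sum>x\<in>A. F x) = (\<Sum>x\<in>A. \<Sum>\<^sub># (F x))"
  by (induction A rule: infinite_finite_induct) simp_all

definition base_parts :: "('a \<Rightarrow> nat) \<Rightarrow> 'a set \<Rightarrow> nat multiset" where
  "base_parts n C = image_mset (\<lambda>v. n v + 1) (mset_set C)"

lemma base_parts_one_positive:
  assumes "finite C" "x \<in> C" "\<And>v. v \<in> C \<Longrightarrow> v \<noteq> x \<Longrightarrow> n v = 0"
  shows "base_parts n C = {#n x + 1#} + replicate_mset (card C - 1) 1" "(\<Sum>v\<in>C. n v) = n x"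
proof -
  have "image_mset (\<lambda>v. n v + 1) (mset_set (C - {x})) = image_mset (\<lambda>_. 1) (mset_set (C - {x}))"
    using assms by (intro image_mset_cong) auto
  then show "base_parts n C = {#n x + 1#} + replicate_mset (card C - 1) 1"
    using assms(1,2) by (simp add: base_parts_def mset_set.remove image_mset_const_eq)
  show "(\<Sum>v\<in>C. n v) = n x"
    using assms by (subst sum.remove[of _ x]) (auto intro: sum.neutral)
qed

lemma block_parts_eq_base:
  assumes "finite C" "C \<noteq> {}" "\<And>x y. x \<in> C \<Longrightarrow> y \<in> C \<Longrightarrow> 0 < n x \<Longrightarrow> 0 < n y \<Longrightarrow> x = y"
  shows "block_parts (card C) (\<Sum>v\<in>C. n v) 0 = base_parts n C"
proof -
  obtain x where "x \<in> C" "\<And>v. v \<in> C \<Longrightarrow> v \<noteq> x \<Longrightarrow> n v = 0"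
    using assms(2,3) by (metis all_not_in_conv gr0I)
  from base_parts_one_positive[OF assms(1) this] show ?thesis
    by (simp add: block_parts_def)
qed

text \<open>All base parts are 1, and two of them are replaced by a 2. The equation adds on both
  sides because multiset subtraction truncates; the inequality serves to show that two such
  components are already too large.\<close>

lemma block_parts_one:
  assumes "finite C" "1 < card C" "\<And>x. x \<in> C \<Longrightarrow> n x = 0"
  shows "block_parts (card C) (\<Sum>v\<in>C. n v) 1 + {#1, 1#} = base_parts n C + {#2#}"
    and "base_parts n C + {#1, 1#} < block_parts (card C) (\<Sum>v\<in>C. n v) 1"
proof -
  have z: "(\<Sum>v\<in>C. n v) = 0" by (simp add: assms(3))
  define k where "k = card C - 2"
  have k: "card C = Suc (Suc k)"
    using assms(2) by (simp add: k_def)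
  have "base_parts n C = image_mset (\<lambda>_. 1) (mset_set C)"
    unfolding base_parts_def using assms by (intro image_mset_cong) auto
  then have b: "base_parts n C = replicate_mset (card C) 1"
    by (simp add: image_mset_const_eq)
  show "block_parts (card C) (\<Sum>v\<in>C. n v) 1 + {#1, 1#} = base_parts n C + {#2#}"
    unfolding b z k by (simp add: block_parts_def)
  show "base_parts n C + {#1, 1#} < block_parts (card C) (\<Sum>v\<in>C. n v) 1"
    unfolding b z k by (rule ex_gt_imp_less_multiset) (auto simp: block_parts_def intro!: bexI[of _ 2])
qed

text \<open>The star part is at least 3 and exceeds every \<open>n v + 1\<close>, which settles the
  multiset order regardless of the other parts. Adding the 2 gives one bound that lies above both of
  the two smallest candidates.\<close>

lemma block_parts_large:
  assumes "finite C" "C \<noteq> {}"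
    and "2 \<le> i \<or> i = 1 \<and> (\<exists>x\<in>C. 0 < n x) \<or> (\<exists>x\<in>C. \<exists>y\<in>C. 0 < n x \<and> 0 < n y \<and> x \<noteq> y)"
  shows "base_parts n C + {#2#} < block_parts (card C) (\<Sum>v\<in>C. n v) i"
proof (rule ex_gt_imp_less_multiset, intro exI conjI allI impI)
  let ?y = "(\<Sum>v\<in>C. n v) + i + 1"
  show "?y \<in># block_parts (card C) (\<Sum>v\<in>C. n v) i" by (simp add: block_parts_def)
  have le: "n v \<le> (\<Sum>v\<in>C. n v)" if "v \<in> C" for v
    using that assms(1) by (intro member_le_sum) auto
  have le2: "n v + n w \<le> (\<Sum>v\<in>C. n v)" if "v \<in> C" "w \<in> C" "v \<noteq> w" for v w
  proof -
    have "(\<Sum>v\<in>{v, w}. n v) \<le> (\<Sum>v\<in>C. n v)"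
      using that assms(1) by (intro sum_mono2) auto
    then show ?thesis using that by simp
  qed
  have "3 \<le> ?y \<and> (\<forall>v\<in>C. n v + 1 < ?y)"
    using assms(3)
  proof (elim disjE conjE bexE)
    assume "2 \<le> i"
    then show ?thesis using le by fastforce
  next
    fix x assume "i = 1" "x \<in> C" "0 < n x"
    then show ?thesis using le[of x] le by fastforce
  next
    fix x y assume xy: "x \<in> C" "y \<in> C" "0 < n x" "0 < n y" "x \<noteq> y"
    have "n v + 1 < ?y" if "v \<in> C" for v
      using le2[of v x] le2[of v y] xy that by (cases "v = x") auto
    then show ?thesis using le2[of x y] xy by auto
  qed
  then show "x < ?y" if "x \<in># base_parts n C + {#2#}" for x
    using that assms(1) by (auto simp: base_parts_def)
qed

context leafy_graph
begin

definition leafy :: "'a set" where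
  "leafy = {v \<in> V. 0 < nleaves v}"

abbreviation base0 :: "nat multiset" where
  "base0 \<equiv> base_parts nleaves V"

lemma card_comp_pos: "S \<subseteq> E \<Longrightarrow> C \<in> comps V S \<Longrightarrow> 0 < card C"
  using finite_comp[OF finV Union_edges] comps_nonempty by (metis card_gt_0_iff)

lemma sep_leafy_iff:
  assumes "S \<subseteq> E"
  shows "sep S leafy \<longleftrightarrow> (\<forall>C\<in>comps V S. \<forall>x\<in>C. \<forall>y\<in>C. 0 < nleaves x \<longrightarrow> 0 < nleaves y \<longrightarrow> x = y)"
proof
  assume sep: "sep S leafy"
  show "\<forall>C\<in>comps V S. \<forall>x\<in>C. \<forall>y\<in>C. 0 < nleaves x \<longrightarrow> 0 < nleaves y \<longrightarrow> x = y"
  proof (intro ballI impI)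
    fix C x y assume C: "C \<in> comps V S" "x \<in> C" "y \<in> C" "0 < nleaves x" "0 < nleaves y"
    then have "x \<in> leafy" "y \<in> leafy" "(x, y) \<in> conn S"
      using comps_subset[OF C(1) Union_edges[OF assms]] comps_conn[OF C(1,2)] by (auto simp: leafy_def)
    then show "x = y" using sep unfolding sep_def by blast
  qed
next
  assume *: "\<forall>C\<in>comps V S. \<forall>x\<in>C. \<forall>y\<in>C. 0 < nleaves x \<longrightarrow> 0 < nleaves y \<longrightarrow> x = y"
  show "sep S leafy"
    unfolding sep_def
  proof (intro ballI impI)
    fix x y assume xy: "x \<in> leafy" "y \<in> leafy" "(x, y) \<in> conn S"
    then have "conn S `` {x} \<in> comps V S" by (auto simp: comps_iff leafy_def)
    moreover have "x \<in> conn S `` {x}" "y \<in> conn S `` {x}" using xy by auto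
    ultimately show "x = y" using * xy unfolding leafy_def by blast
  qed
qed

lemma base_parts_comps: "S \<subseteq> E \<Longrightarrow> base0 = (\<Sum>C\<in>comps V S. base_parts nleaves C)"
proof -
  assume S: "S \<subseteq> E"
  note fin = finite_comps[OF finV, of S]
  have "mset_set (\<Union>(comps V S)) = (\<Sum>C\<in>comps V S. mset_set C)"
  proof -
    have "finite F \<Longrightarrow> F \<subseteq> comps V S \<Longrightarrow> mset_set (\<Union>F) = (\<Sum>C\<in>F. mset_set C)" for F
    proof (induction F rule: finite_induct)
      case (insert C F)
      have "C \<inter> \<Union>F = {}" using insert disjoint_comps[of C V S] by blast
      moreover have "finite C" "finite (\<Union>F)"
        using insert finite_comp[OF finV Union_edges[OF S]] by auto
      ultimately show ?case using insert by (simp add: mset_set_Union)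
    qed simp
    then show ?thesis using fin by blast
  qed
  moreover have "\<Union>(comps V S) = V" by (rule Union_comps[OF Union_edges[OF S]])
  ultimately have "mset_set V = (\<Sum>C\<in>comps V S. mset_set C)" by simp
  then show ?thesis
    by (simp add: base_parts_def image_mset_of_sum)
qed

text \<open>Each component reproduces its base parts, trades two parts 1 for a 2, or is large. The
  sum exceeds \<open>base0 + {#2#}\<close> as soon as one component is large or two of them make the
  trade. The negations in case \<open>large\<close> let \<open>sum_base\<close> and
  \<open>sum_one\<close> read the cases as equivalences.\<close>

lemma parts_cases:
  assumes "(S, g) \<in> indices"
  obtains (base) "sep S leafy" "\<forall>C\<in>comps V S. g C = 0" "parts (S, g) = base0"
    | (one) D where "sep S leafy" "D \<in> free_comps V S leafy" "g D = 1" "\<forall>C\<in>comps V S - {D}. g C = 0"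
      "parts (S, g) + {#1, 1#} = base0 + {#2#}"
    | (large) "\<not> (sep S leafy \<and> (\<forall>C\<in>comps V S. g C = 0))"
      "\<not> (sep S leafy \<and> (\<exists>D\<in>free_comps V S leafy. g D = 1 \<and> (\<forall>C\<in>comps V S - {D}. g C = 0)))"
      "base0 + {#2#} < parts (S, g)"
proof -
  let ?n = nleaves
  define P where "P C = block_parts (card C) (\<Sum>v\<in>C. ?n v) (g C)" for C
  define B where "B C = base_parts ?n C" for C
  have S: "S \<subseteq> E" and g: "\<And>C. C \<in> comps V S \<Longrightarrow> g C < card C"
    using assms by (auto simp: indices_def)
  note U = Union_edges[OF S] and fin = finite_comps[OF finV, of S]
  have C: "finite C" "C \<noteq> {}" "C \<subseteq> V" if "C \<in> comps V S" for C
    using that finite_comp[OF finV U] comps_nonempty comps_subset[OF _ U] by auto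
  have parts: "parts (S, g) = (\<Sum>C\<in>comps V S. P C)" by (simp add: parts_def P_def)
  have base: "base0 = (\<Sum>C\<in>comps V S. B C)" unfolding B_def by (rule base_parts_comps[OF S])
  let ?large = "\<lambda>C. 2 \<le> g C \<or> g C = 1 \<and> (\<exists>x\<in>C. 0 < ?n x) \<or> (\<exists>x\<in>C. \<exists>y\<in>C. 0 < ?n x \<and> 0 < ?n y \<and> x \<noteq> y)"
  let ?one = "\<lambda>C. g C = 1 \<and> (\<forall>x\<in>C. ?n x = 0)"
  have zero: "g C = 0 \<and> (\<forall>x\<in>C. \<forall>y\<in>C. 0 < ?n x \<longrightarrow> 0 < ?n y \<longrightarrow> x = y)" if "\<not> ?large C" "\<not> ?one C" for C
  proof -
    have "g C \<noteq> 1" using that by (metis gr0I)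
    moreover have "g C < 2" using that(1) by (meson not_le)
    ultimately have "g C = 0" by linarith
    then show ?thesis using that(1) by blast
  qed
  have PB: "P C = B C" if "C \<in> comps V S" "\<not> ?large C" "\<not> ?one C" for C
    using zero[OF that(2,3)] block_parts_eq_base[OF C(1,2)[OF that(1)], of ?n] by (simp add: P_def B_def)
  have P1: "P C + {#1, 1#} = B C + {#2#}" "B C + {#1, 1#} < P C" if "C \<in> comps V S" "?one C" for C
    using block_parts_one[OF C(1)[OF that(1)], of ?n] g[OF that(1)] that(2) by (simp_all add: P_def B_def)
  have PL: "B C + {#2#} < P C" if "C \<in> comps V S" "?large C" for C
    unfolding P_def B_def by (rule block_parts_large[OF C(1,2)[OF that(1)] that(2)])
  have le: "B C \<le> P C" if "C \<in> comps V S" for C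
  proof -
    have lt: "B C < B C + X" if "X \<noteq> {#}" for X using that by simp
    consider "?large C" | "?one C" | "\<not> ?large C \<and> \<not> ?one C" by blast
    then show ?thesis
    proof cases
      case 1
      then have "B C < P C" using PL[OF that] lt[of "{#2#}"] by (meson add_mset_not_empty order.strict_trans)
      then show ?thesis by simp
    next
      case 2
      then have "B C < P C" using P1(2)[OF that] lt[of "{#1, 1#}"] by (meson add_mset_not_empty order.strict_trans)
      then show ?thesis by simp
    next
      case 3
      then have "P C = B C" using PB[OF that] by blast
      then show ?thesis by simp
    qed
  qed
  have sepL: "sep S leafy \<longleftrightarrow> (\<forall>C\<in>comps V S. \<forall>x\<in>C. \<forall>y\<in>C. 0 < ?n x \<longrightarrow> 0 < ?n y \<longrightarrow> x = y)"
    by (rule sep_leafy_iff[OF S])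
  have free: "D \<in> free_comps V S leafy \<longleftrightarrow> D \<in> comps V S \<and> (\<forall>x\<in>D. ?n x = 0)" for D
  proof (cases "D \<in> comps V S")
    case True
    have "D \<subseteq> V" by (rule C(3)[OF True])
    then have "D \<inter> leafy = {} \<longleftrightarrow> (\<forall>x\<in>D. ?n x = 0)"
      unfolding leafy_def by fastforce
    then show ?thesis using True by (simp add: free_comps_def)
  qed (simp add: free_comps_def)
  show thesis
  proof (cases "\<exists>D\<in>comps V S. ?large D")
    case True
    then obtain D where D: "D \<in> comps V S" "?large D" by blast
    have "(\<Sum>C\<in>comps V S. B C) + {#2#} = B D + {#2#} + (\<Sum>C\<in>comps V S - {D}. B C)"
      by (simp add: sum.remove[OF fin D(1)])
    also have "\<dots> < P D + (\<Sum>C\<in>comps V S - {D}. P C)"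
      using PL[OF D] le by (intro add_less_le_mono sum_mono) auto
    also have "\<dots> = parts (S, g)" unfolding parts by (simp add: sum.remove[OF fin D(1)])
    finally have "base0 + {#2#} < parts (S, g)" unfolding base .
    moreover have "\<not> (sep S leafy \<and> (\<forall>C\<in>comps V S. g C = 0))"
      using D unfolding sepL by fastforce
    moreover have "\<not> (sep S leafy \<and> (\<exists>D\<in>free_comps V S leafy. g D = 1 \<and> (\<forall>C\<in>comps V S - {D}. g C = 0)))"
    proof (intro notI, elim conjE bexE)
      fix D' assume *: "sep S leafy" "D' \<in> free_comps V S leafy" "g D' = 1" "\<forall>C\<in>comps V S - {D'}. g C = 0"
      have "g D = 0 \<or> D = D'" using * D(1) by blast
      then show False using * D unfolding sepL free by fastforce
    qed
    ultimately show thesis using large by blast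
  next
    case nl: False
    then have sepS: "sep S leafy" unfolding sepL by blast
    show thesis
    proof (cases "\<exists>D\<in>comps V S. ?one D")
      case False
      have "g C = 0" if "C \<in> comps V S" for C
        by (rule conjunct1[OF zero]) (use nl False that in blast)+
      moreover have "parts (S, g) = base0"
        unfolding parts base using PB nl False by (intro sum.cong) auto
      ultimately show thesis using that(1) sepS by blast
    next
      case True
      then obtain D where D: "D \<in> comps V S" "?one D" by blast
      show thesis
      proof (cases "\<exists>D'\<in>comps V S - {D}. ?one D'")
        case False
        have "(\<Sum>C\<in>comps V S - {D}. P C) = (\<Sum>C\<in>comps V S - {D}. B C)"
          by (rule sum.cong[OF refl], rule PB) (use nl False in blast)+
        then have "parts (S, g) + {#1, 1#} = (P D + {#1, 1#}) + (\<Sum>C\<in>comps V S - {D}. B C)"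
          unfolding parts by (simp add: sum.remove[OF fin D(1)])
        also have "\<dots> = base0 + {#2#}"
          unfolding base P1(1)[OF D] by (simp add: sum.remove[OF fin D(1)])
        finally have "parts (S, g) + {#1, 1#} = base0 + {#2#}" .
        moreover have "g C = 0" if "C \<in> comps V S - {D}" for C
          by (rule conjunct1[OF zero]) (use nl False that in blast)+
        ultimately show thesis using that(2)[OF sepS, of D] D free by blast
      next
        case True
        then obtain D' where D': "D' \<in> comps V S" "D' \<noteq> D" "?one D'" by blast
        have D2: "D' \<in> comps V S - {D}" using D' by blast
        let ?R = "comps V S - {D} - {D'}"
        have split: "(\<Sum>C\<in>comps V S. F C) = F D + (F D' + (\<Sum>C\<in>?R. F C))" for F :: "_ \<Rightarrow> nat multiset"
          using fin by (simp add: sum.remove[OF fin D(1)] sum.remove[OF _ D2])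
        \<comment> \<open>The 2 is absorbed by the trade in \<open>D\<close>, which releases two
          parts 1; the trade in \<open>D'\<close> exceeds its base even with these added.\<close>
        have "(\<Sum>C\<in>comps V S. B C) + {#2#} = (B D + {#2#}) + (B D' + (\<Sum>C\<in>?R. B C))"
          unfolding split by (simp add: ac_simps)
        also have "\<dots> = P D + ((B D' + {#1, 1#}) + (\<Sum>C\<in>?R. B C))"
          unfolding P1(1)[OF D, symmetric] by (simp add: ac_simps)
        also have "\<dots> < P D + (P D' + (\<Sum>C\<in>?R. P C))"
          using P1(2)[OF D'(1,3)] le by (intro add_strict_left_mono add_less_le_mono sum_mono) auto
        also have "\<dots> = parts (S, g)" unfolding parts split ..
        finally have "base0 + {#2#} < parts (S, g)" unfolding base .
        moreover have "\<not> (\<forall>C\<in>comps V S. g C = 0)" using D by force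
        moreover have "\<not> (\<exists>D\<in>free_comps V S leafy. g D = 1 \<and> (\<forall>C\<in>comps V S - {D}. g C = 0))"
          using D D' by (metis DiffI One_nat_def empty_iff insert_iff zero_neq_one)
        ultimately show thesis using large by blast
      qed
    qed
  qed
qed

lemma card_full: "card (verts full) = card V + card U"
  using finV finU disj by (simp add: full_def card_Un_disjoint)

lemma parts_valid:
  assumes "j \<in> indices"
  shows "0 \<notin># parts j \<and> sum_mset (parts j) = card (verts full)"
proof -
  obtain S g where j: "j = (S, g)" "S \<subseteq> E" "\<And>C. C \<in> comps V S \<Longrightarrow> g C < card C"
    using assms by (auto simp: indices_def)
  note U = Union_edges[OF j(2)] and fin = finite_comps[OF finV, of S]
  have "0 \<notin># parts j"
    using j(3) block_parts_valid fin by (auto simp: j(1) parts_def set_mset_sum)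
  moreover have "sum_mset (parts j) = (\<Sum>C\<in>comps V S. card C + (\<Sum>v\<in>C. nleaves v))"
    using j(3) block_parts_valid by (simp add: j(1) parts_def sum_mset_of_sum)
  moreover have "\<dots> = (\<Sum>C\<in>comps V S. \<Sum>v\<in>C. 1 + nleaves v)"
    by (simp only: sum.distrib card_eq_sum)
  moreover have "\<dots> = (\<Sum>v\<in>\<Union>(comps V S). 1 + nleaves v)"
    using finite_comp[OF finV U] disjoint_comps[of _ V S]
    by (subst sum.Union_disjoint) auto
  moreover have "\<dots> = card V + card (leaves_at V)"
    unfolding Union_comps[OF U] by (simp only: sum.distrib card_eq_sum card_leaves_at[OF finV, unfolded card_eq_sum])
  moreover have "leaves_at V = U" using b by auto
  ultimately show ?thesis by (simp add: card_full)
qed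

lemma sum_indices:
  "(\<Sum>j\<in>{j \<in> indices. Q j}. weight j) =
    (\<Sum>S\<in>Pow E. \<Sum>g\<in>{g \<in> choices S. Q (S, g)}. weight (S, g))"
proof -
  have fin: "finite (choices S)" for S
    by (intro finite_PiE finite_comps finV) auto
  have "{j \<in> indices. Q j} = (SIGMA S:Pow E. {g \<in> choices S. Q (S, g)})"
    by (auto simp: indices_def)
  then show ?thesis
    using finE fin by (simp add: sum.Sigma)
qed

text \<open>For a separating \<open>S\<close> only the choice \<open>g = 0\<close> contributes, and
  there all block coefficients are 1.\<close>

lemma sum_base: "(\<Sum>j\<in>{j \<in> indices. parts j = base0}. weight j) = coeff0 E leafy"
  unfolding sum_indices coeff0_def
proof (rule sum.cong[OF refl])
  fix S assume S: "S \<in> Pow E"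
  let ?G = "choices S" and ?g = "\<lambda>C\<in>comps V S. 0 :: nat"
  have g0: "?g \<in> ?G"
    using card_comp_pos S by auto
  have "parts (S, g) = base0 \<longleftrightarrow> sep S leafy \<and> g = ?g" if g: "g \<in> ?G" for g
  proof -
    have "(S, g) \<in> indices" using S g by (auto simp: indices_def)
    then show ?thesis
    proof (cases rule: parts_cases)
      case base
      then have "g = ?g" using g by (auto simp: fun_eq_iff PiE_iff extensional_def)
      then show ?thesis using base by simp
    next
      case (one D)
      then have "D \<in> comps V S" by (simp add: free_comps_def)
      then have "g \<noteq> ?g" using one(3) by (auto dest: fun_cong[of _ _ D])
      moreover have "parts (S, g) \<noteq> base0"
        using one(5) by auto
      ultimately show ?thesis by simp
    next
      case large
      have "base0 < base0 + {#2#}" by simp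
      then have "parts (S, g) \<noteq> base0" using large(3) by auto
      moreover have "\<not> (sep S leafy \<and> g = ?g)" using large(1) by auto
      ultimately show ?thesis by simp
    qed
  qed
  then have "{g \<in> ?G. parts (S, g) = base0} = (if sep S leafy then {?g} else {})"
    using g0 by auto
  moreover have "weight (S, ?g) = (- 1) ^ card S"
    by (simp add: weight_def block_coeff_def)
  ultimately show "(\<Sum>g\<in>{g \<in> ?G. parts (S, g) = base0}. weight (S, g)) =
      (if sep S leafy then (- 1) ^ card S else 0)"
    by simp
qed

lemma size_base_parts: "size (base0) = card V"
  by (simp add: base_parts_def)

lemma leading_partition_coeff0:
  assumes "coeff0 E leafy \<noteq> 0"
  shows "length (leading_partition full) = card V"
    and "sum_list (leading_partition full) = card V + card U"
proof -
  have mset: "mset (leading_partition full) = base0"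
  proof (rule mset_leading_partition[OF finite_indices chromatic_stars parts_valid])
    show "(\<Sum>j\<in>{j \<in> indices. parts j = base0}. weight j) \<noteq> 0"
      using assms by (simp add: sum_base)
    fix M assume M: "M < base0"
    have "parts j \<noteq> M" if "j \<in> indices" for j
    proof -
      obtain S g where j: "j = (S, g)" by (cases j)
      have b: "base0 < base0 + {#2#}" by simp
      from that[unfolded j] show ?thesis
      proof (cases rule: parts_cases)
        case base
        then show ?thesis using M j by auto
      next
        case (one D)
        then have "M + {#1, 1#} < base0 + {#1, 1#}" using M by simp
        also have "\<dots> < base0 + {#2#}"
          by (intro add_strict_left_mono ex_gt_imp_less_multiset) auto
        finally show ?thesis using one(5) j by auto
      next
        case large
        then show ?thesis using M b j by (metis order.strict_trans less_irrefl)
      qed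
    qed
    then show "(\<Sum>j\<in>{j \<in> indices. parts j = M}. weight j) = 0"
      by (intro sum.neutral) auto
  qed auto
  then show "length (leading_partition full) = card V" by (metis size_base_parts size_mset)
  have "{j \<in> indices. parts j = base0} \<noteq> {}"
    using assms unfolding sum_base[symmetric] by (metis sum.empty)
  then obtain j where "j \<in> indices" "parts j = base0" by blast
  then have "\<Sum>\<^sub># (base0) = card V + card U"
    using parts_valid[of j] card_full by simp
  then show "sum_list (leading_partition full) = card V + card U"
    unfolding mset[symmetric] by (simp add: sum_mset_sum_list)
qed

text \<open>The terms correspond to a separating \<open>S\<close> and an unmarked component
  \<open>D\<close> with at least two vertices, of block coefficient \<open>-(card D - 1)\<close>.
  One-vertex components may be included since their contribution is 0.\<close>

lemma sum_one:
  assumes "M + {#1, 1#} = base0 + {#2#}"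
  shows "(\<Sum>j\<in>{j \<in> indices. parts j = M}. weight j) = coeff1 V E leafy"
  unfolding sum_indices coeff1_def sum_negf[symmetric]
proof (rule sum.cong[OF refl])
  fix S assume S: "S \<in> Pow E"
  let ?G = "choices S"
  let ?g = "\<lambda>D. \<lambda>C\<in>comps V S. if C = D then 1 else 0 :: nat"
  let ?F = "{D \<in> free_comps V S leafy. 1 < card D}"
  have pos: "0 < card C" if "C \<in> comps V S" for C
    using card_comp_pos S that by blast
  have fin: "finite (free_comps V S leafy)"
    using finite_comps[OF finV] by (simp add: free_comps_def)
  have M: "M \<noteq> base0" using assms by auto
  have "M < M + {#1, 1#}" by simp
  then have lt: "M < base0 + {#2#}" by (simp only: assms)
  have iff: "parts (S, g) = M \<longleftrightarrow> sep S leafy \<and> (\<exists>D\<in>free_comps V S leafy. g = ?g D)" if g: "g \<in> ?G" for g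
  proof -
    have "(S, g) \<in> indices" using S g by (auto simp: indices_def)
    then show ?thesis
    proof (cases rule: parts_cases)
      case base
      have "g \<noteq> ?g D" if "D \<in> free_comps V S leafy" for D
        using base(2) that by (auto simp: free_comps_def dest: fun_cong[of _ _ D])
      then show ?thesis using base M by auto
    next
      case (one D)
      have "g = ?g D"
      proof
        fix C show "g C = ?g D C"
          using one(2-4) g by (cases "C \<in> comps V S") (auto simp: PiE_iff extensional_def)
      qed
      moreover have "parts (S, g) = M" using one(5) assms by (metis add_right_cancel)
      ultimately show ?thesis using one by blast
    next
      case large
      have "\<not> (sep S leafy \<and> (\<exists>D\<in>free_comps V S leafy. g = ?g D))"
      proof (intro notI, elim conjE bexE)
        fix D assume D: "sep S leafy" "D \<in> free_comps V S leafy" "g = ?g D"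
        then have "g D = 1" "\<forall>C\<in>comps V S - {D}. g C = 0" by (auto simp: free_comps_def)
        then show False using large(2) D(1,2) by blast
      qed
      then show ?thesis using large(3) lt by auto
    qed
  qed
  have inG: "?g D \<in> ?G \<longleftrightarrow> 1 < card D" if "D \<in> free_comps V S leafy" for D
    using that pos by (auto simp: free_comps_def PiE_iff split: if_splits)
  show "(\<Sum>g\<in>{g \<in> ?G. parts (S, g) = M}. weight (S, g)) =
      - (if sep S leafy then (- 1) ^ card S * free_rank V S leafy else 0)"
  proof (cases "sep S leafy")
    case False
    then have e: "{g \<in> ?G. parts (S, g) = M} = {}" using iff by blast
    show ?thesis unfolding e using False by simp
  next
    case True
    have eq: "{g \<in> ?G. parts (S, g) = M} = ?g ` ?F"
      using iff True inG by blast
    have inj: "inj_on ?g ?F"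
    proof (rule inj_onI)
      fix D D' assume D: "D \<in> ?F" "D' \<in> ?F" "?g D = ?g D'"
      have "?g D D = ?g D' D" by (rule fun_cong[OF D(3)])
      moreover have "D \<in> comps V S" using D(1) by (simp add: free_comps_def)
      ultimately show "D = D'" by (simp split: if_splits)
    qed
    have w: "weight (S, ?g D) = - ((- 1) ^ card S * (int (card D) - 1))" if D: "D \<in> ?F" for D
    proof -
      have D': "D \<in> comps V S" using D by (simp add: free_comps_def)
      have "(\<Prod>C\<in>comps V S. block_coeff (card C) (?g D C)) =
          block_coeff (card D) (?g D D) * (\<Prod>C\<in>comps V S - {D}. block_coeff (card C) (?g D C))"
        by (rule prod.remove[OF finite_comps[OF finV] D'])
      also have "(\<Prod>C\<in>comps V S - {D}. block_coeff (card C) (?g D C)) = 1"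
        by (rule prod.neutral) (auto simp: block_coeff_def)
      also have "block_coeff (card D) (?g D D) = - (int (card D) - 1)"
        using D D' by (simp add: block_coeff_def of_nat_diff)
      finally show ?thesis by (simp add: weight_def right_diff_distrib)
    qed
    have "(\<Sum>g\<in>{g \<in> ?G. parts (S, g) = M}. weight (S, g)) = (\<Sum>D\<in>?F. weight (S, ?g D))"
      unfolding eq by (simp only: sum.reindex[OF inj] comp_def)
    also have "\<dots> = (\<Sum>D\<in>?F. - ((- 1) ^ card S * (int (card D) - 1)))"
      by (rule sum.cong[OF refl w])
    also have "\<dots> = (\<Sum>D\<in>free_comps V S leafy. - ((- 1) ^ card S * (int (card D) - 1)))"
    proof (rule sum.mono_neutral_left[OF fin])
      show "\<forall>D\<in>free_comps V S leafy - ?F. - ((- 1) ^ card S * (int (card D) - 1)) = 0"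
      proof
        fix D assume "D \<in> free_comps V S leafy - ?F"
        then have "card D = 1" using pos[of D] by (auto simp: free_comps_def)
        then show "- ((- 1) ^ card S * (int (card D) - 1)) = 0" by simp
      qed
    qed auto
    finally show ?thesis
      using True by (simp add: free_rank_def sum_distrib_left sum_negf)
  qed
qed

lemma leading_partition_coeff1:
  assumes "coeff0 E leafy = 0" "coeff1 V E leafy \<noteq> 0"
  shows "Suc (length (leading_partition full)) = card V"
    and "sum_list (leading_partition full) = card V + card U"
proof -
  \<comment> \<open>A nonzero summand of \<open>coeff1\<close> supplies an actual term, and with it
    a multiset \<open>M\<close> such that \<open>M + {#1, 1#} = base0 + {#2#}\<close>; a priori
    \<open>base0\<close> need not contain two parts 1.\<close>
  have "\<exists>S\<in>Pow E. sep S leafy \<and> free_rank V S leafy \<noteq> 0"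
  proof (rule ccontr)
    assume "\<not> ?thesis"
    then have "coeff1 V E leafy = 0" unfolding coeff1_def by (auto intro: sum.neutral)
    then show False using assms(2) by simp
  qed
  then obtain S where S: "S \<subseteq> E" "sep S leafy" "free_rank V S leafy \<noteq> 0" by blast
  then obtain D where D: "D \<in> free_comps V S leafy" "int (card D) - 1 \<noteq> 0"
    unfolding free_rank_def by (meson sum.neutral)
  let ?g = "\<lambda>C\<in>comps V S. if C = D then 1 else 0 :: nat"
  have pos: "0 < card C" if "C \<in> comps V S" for C
    by (rule card_comp_pos[OF S(1) that])
  have D': "D \<in> comps V S" "1 < card D" using D pos[of D] by (auto simp: free_comps_def)
  then have ind: "(S, ?g) \<in> indices"
    using S(1) pos by (auto simp: indices_def PiE_iff)
  define M where "M = parts (S, ?g)"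
  have M: "M + {#1, 1#} = base0 + {#2#}"
    using ind
  proof (cases rule: parts_cases)
    case base
    then show ?thesis using D' by force
  next
    case (one D)
    then show ?thesis by (simp add: M_def)
  next
    case large
    have "?g D = 1" "\<forall>C\<in>comps V S - {D}. ?g C = 0" using D'(1) by auto
    then show ?thesis using large(2) S(2) D(1) by blast
  qed
  have mset: "mset (leading_partition full) = M"
  proof (rule mset_leading_partition[OF finite_indices chromatic_stars parts_valid])
    show "(\<Sum>j\<in>{j \<in> indices. parts j = M}. weight j) \<noteq> 0"
      using assms(2) sum_one[OF M] by simp
    fix M' assume M': "M' < M"
    show "(\<Sum>j\<in>{j \<in> indices. parts j = M'}. weight j) = 0"
    proof (cases "M' = base0")
      case True
      then show ?thesis using assms(1) by (simp add: sum_base)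
    next
      case False
      have "M < M + {#1, 1#}" by simp
      then have lt: "M' < base0 + {#2#}" using M M' by (metis order.strict_trans)
      have "parts j \<noteq> M'" if "j \<in> indices" for j
      proof -
        obtain S g where j: "j = (S, g)" by (cases j)
        from that[unfolded j] show ?thesis
        proof (cases rule: parts_cases)
          case base
          then show ?thesis using False j by simp
        next
          case (one D)
          then have "parts (S, g) = M" using M by (metis add_right_cancel)
          then show ?thesis using M' j by auto
        next
          case large
          then show ?thesis using lt j by auto
        qed
      qed
      then show ?thesis by (intro sum.neutral) auto
    qed
  qed auto
  have "size (M + {#1, 1#}) = size (base0 + {#2#})" using M by simp
  then show "Suc (length (leading_partition full)) = card V"
    using mset by (simp add: size_base_parts flip: size_mset)
  have "\<Sum>\<^sub># M = card V + card U"
    using parts_valid[OF ind] card_full by (simp add: M_def)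
  then show "sum_list (leading_partition full) = card V + card U"
    unfolding mset[symmetric] by (simp add: sum_mset_sum_list)
qed

end

section \<open>Attaching a pendant vertex\<close>

lemma conn_isolated:
  assumes "v \<notin> \<Union>S"
  shows "(v, x) \<in> conn S \<longleftrightarrow> x = v" "(x, v) \<in> conn S \<longleftrightarrow> x = v"
proof -
  have "(y = v) = (z = v)" if "(y, z) \<in> conn S" for y z
    using that by (rule conn_invariant) (use assms in auto)
  then show "(v, x) \<in> conn S \<longleftrightarrow> x = v" "(x, v) \<in> conn S \<longleftrightarrow> x = v"
    by auto
qed

text \<open>Contracting the pendant edge identifies \<open>v\<close> with \<open>u\<close>; the
  conditionals perform this substitution.\<close>

lemma conn_pendant:
  assumes "v \<notin> \<Union>S"
  shows "(a, b) \<in> conn (insert {u, v} S) \<longleftrightarrow>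
    (if a = v then u else a, if b = v then u else b) \<in> conn S"
proof -
  define \<phi> where "\<phi> x = (if x = v then u else x)" for x
  have "(a, b) \<in> conn (insert {u, v} S) \<longleftrightarrow> (\<phi> a, \<phi> b) \<in> conn S"
  proof
    assume "(a, b) \<in> conn (insert {u, v} S)"
    then have "conn S `` {\<phi> a} = conn S `` {\<phi> b}"
    proof (rule conn_invariant)
      fix p q assume pq: "{p, q} \<in> insert {u, v} S"
      show "conn S `` {\<phi> p} = conn S `` {\<phi> q}"
      proof (cases "{p, q} \<in> S")
        case True
        then have "p \<noteq> v" "q \<noteq> v" using assms by auto
        then show ?thesis
          using equiv_class_eq[OF equiv_conn conn_edge[OF True]] by (simp add: \<phi>_def)
      next
        case False
        then have "{p, q} = {u, v}" using pq by blast
        then have "\<phi> p = \<phi> q" by (auto simp: \<phi>_def doubleton_eq_iff)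
        then show ?thesis by simp
      qed
    qed
    moreover have "\<phi> b \<in> conn S `` {\<phi> b}" by simp
    ultimately show "(\<phi> a, \<phi> b) \<in> conn S" by blast
  next
    assume "(\<phi> a, \<phi> b) \<in> conn S"
    then have *: "(\<phi> a, \<phi> b) \<in> conn (insert {u, v} S)"
      using conn_mono[of S "insert {u, v} S"] by blast
    have "(x, \<phi> x) \<in> conn (insert {u, v} S)" for x
      by (auto simp: \<phi>_def insert_commute intro!: conn_edge)
    then show "(a, b) \<in> conn (insert {u, v} S)"
      using * conn_trans conn_sym by metis
  qed
  then show ?thesis by (simp add: \<phi>_def)
qed

lemma sep_isolated: "v \<notin> \<Union>S \<Longrightarrow> sep S L \<longleftrightarrow> sep S (L - {v})"
  unfolding sep_def by (metis DiffE DiffI conn_isolated empty_iff insert_iff)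

lemma sep_pendant_out:
  assumes "v \<notin> \<Union>S" "v \<notin> L"
  shows "sep (insert {u, v} S) L \<longleftrightarrow> sep S L"
proof -
  have "(x, y) \<in> conn (insert {u, v} S) \<longleftrightarrow> (x, y) \<in> conn S" if "x \<in> L" "y \<in> L" for x y
    using that assms(2) unfolding conn_pendant[OF assms(1)] by auto
  then show ?thesis by (simp add: sep_def)
qed

text \<open>The edge lets \<open>v\<close> hand its mark to \<open>u\<close>. If \<open>u\<close> is
  marked already, two marked vertices are joined.\<close>

lemma sep_pendant_in:
  assumes "v \<notin> \<Union>S" "u \<noteq> v" "v \<in> L"
  shows "sep (insert {u, v} S) L \<longleftrightarrow> u \<notin> L \<and> sep S (insert u (L - {v}))"
proof -
  let ?S = "insert {u, v} S"
  have uv: "(v, u) \<in> conn ?S" by (rule conn_sym) (simp add: conn_edge)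
  have eq: "(x, y) \<in> conn ?S \<longleftrightarrow> (x, y) \<in> conn S" if "x \<noteq> v" "y \<noteq> v" for x y
    using that unfolding conn_pendant[OF assms(1)] by simp
  have v: "(v, y) \<in> conn ?S \<longleftrightarrow> (u, y) \<in> conn S" if "y \<noteq> v" for y
    using that unfolding conn_pendant[OF assms(1)] by simp
  show ?thesis
  proof
    assume sep: "sep ?S L"
    have u: "u \<notin> L" using sep uv assms(2,3) unfolding sep_def by blast
    moreover have "sep S (insert u (L - {v}))"
      unfolding sep_def
    proof (intro ballI impI)
      fix x y assume xy: "x \<in> insert u (L - {v})" "y \<in> insert u (L - {v})" "(x, y) \<in> conn S"
      have nv: "x \<noteq> v" "y \<noteq> v" using xy assms(2) by auto
      have uL: "z = v" if "z \<in> L - {v}" "(u, z) \<in> conn S" for z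
        using sep that v[of z] assms(3) unfolding sep_def by blast
      consider "x \<in> L" "y \<in> L" | "x = u" "y = u" | "x = u" "y \<in> L - {v}" | "x \<in> L - {v}" "y = u"
        using xy by blast
      then show "x = y"
      proof cases
        case 1
        then show ?thesis using sep xy(3) eq nv unfolding sep_def by blast
      next
        case 3
        then show ?thesis using uL xy(3) nv by blast
      next
        case 4
        then show ?thesis using uL xy(3) nv conn_sym by metis
      qed simp
    qed
    ultimately show "u \<notin> L \<and> sep S (insert u (L - {v}))" by blast
  next
    assume R: "u \<notin> L \<and> sep S (insert u (L - {v}))"
    show "sep ?S L"
      unfolding sep_def
    proof (intro ballI impI)
      fix x y assume xy: "x \<in> L" "y \<in> L" "(x, y) \<in> conn ?S"
      let ?x = "if x = v then u else x" and ?y = "if y = v then u else y"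
      have "(?x, ?y) \<in> conn S" using xy(3) unfolding conn_pendant[OF assms(1)] .
      moreover have "?x \<in> insert u (L - {v})" "?y \<in> insert u (L - {v})" using xy by auto
      ultimately have "?x = ?y" using R unfolding sep_def by blast
      then show "x = y" using xy R by (auto split: if_splits)
    qed
  qed
qed

lemma comps_isolated:
  assumes "v \<notin> \<Union>S"
  shows "comps (insert v V) S = insert {v} (comps V S)"
proof -
  have "conn S `` {v} = {v}" using conn_isolated[OF assms] by auto
  moreover have "comps (insert v V) S = insert (conn S `` {v}) (comps V S)"
    by (simp add: comps_def quotient_def)
  ultimately show ?thesis by simp
qed

lemma comps_pendant:
  assumes "v \<notin> \<Union>S" "v \<notin> V" "u \<in> V"
  shows "comps (insert v V) (insert {u, v} S) = (\<lambda>C. if u \<in> C then insert v C else C) ` comps V S"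
proof -
  let ?S = "insert {u, v} S"
  have cls: "conn ?S `` {w} = (if u \<in> conn S `` {w} then insert v (conn S `` {w}) else conn S `` {w})"
    if "w \<in> V" for w
  proof -
    have "w \<noteq> v" using that assms(2) by blast
    then have x: "x \<in> conn ?S `` {w} \<longleftrightarrow> (w, if x = v then u else x) \<in> conn S" for x
      by (simp add: conn_pendant[OF assms(1)])
    have "(w, v) \<notin> conn S" using conn_isolated(2)[OF assms(1), of w] \<open>w \<noteq> v\<close> by simp
    then show ?thesis unfolding set_eq_iff x by simp
  qed
  have "(u, v) \<in> conn ?S" by (simp add: conn_edge)
  then have "conn ?S `` {v} = conn ?S `` {u}"
    using equiv_class_eq[OF equiv_conn] by metis
  then have "comps (insert v V) ?S = (\<lambda>w. conn ?S `` {w}) ` V"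
    using assms(3) unfolding comps_def quotient_def by blast
  also have "\<dots> = (\<lambda>w. if u \<in> conn S `` {w} then insert v (conn S `` {w}) else conn S `` {w}) ` V"
    by (rule image_cong[OF refl cls])
  also have "\<dots> = (\<lambda>C. if u \<in> C then insert v C else C) ` comps V S"
    unfolding comps_def quotient_def by auto
  finally show ?thesis .
qed

lemma comps_notin: "\<Union>S \<subseteq> V \<Longrightarrow> v \<notin> V \<Longrightarrow> C \<in> comps V S \<Longrightarrow> v \<notin> C"
  using comps_subset by blast

text \<open>The component \<open>{v}\<close> contributes \<open>1 - 1 = 0\<close> even when it is
  free.\<close>

lemma free_rank_isolated:
  assumes "\<Union>S \<subseteq> V" "v \<notin> V" "finite V"
  shows "free_rank (insert v V) S L = free_rank V S (L - {v})"
proof -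
  have v: "v \<notin> \<Union>S" using assms by blast
  have "C \<inter> L = {} \<longleftrightarrow> C \<inter> (L - {v}) = {}" if "C \<in> comps V S" for C
    using comps_notin[OF assms(1,2) that] by blast
  moreover define F where "F = free_comps V S (L - {v})"
  ultimately have eq: "free_comps (insert v V) S L = (if v \<in> L then F else insert {v} F)"
    unfolding F_def free_comps_def comps_isolated[OF v] by auto
  have "{v} \<notin> F"
    using comps_notin[OF assms(1,2)] unfolding F_def free_comps_def by blast
  moreover have "finite F"
    using finite_comps[OF assms(3)] by (simp add: F_def free_comps_def)
  ultimately show ?thesis unfolding free_rank_def eq F_def[symmetric] by simp
qed

lemma free_rank_pendant_in:
  assumes "\<Union>S \<subseteq> V" "v \<notin> V" "u \<in> V" "v \<in> L"
  shows "free_rank (insert v V) (insert {u, v} S) L = free_rank V S (insert u (L - {v}))"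
proof -
  have v: "v \<notin> \<Union>S" using assms by blast
  have "free_comps (insert v V) (insert {u, v} S) L = free_comps V S (insert u (L - {v}))"
  proof (intro set_eqI iffI)
    fix C assume "C \<in> free_comps (insert v V) (insert {u, v} S) L"
    then obtain D where D: "D \<in> comps V S" "C = (if u \<in> D then insert v D else D)" "C \<inter> L = {}"
      unfolding free_comps_def comps_pendant[OF v assms(2,3)] by blast
    then have "u \<notin> D" using assms(4) by auto
    then show "C \<in> free_comps V S (insert u (L - {v}))"
      using D by (auto simp: free_comps_def)
  next
    fix C assume C: "C \<in> free_comps V S (insert u (L - {v}))"
    then have "C \<in> comps V S" "u \<notin> C" by (auto simp: free_comps_def)
    moreover from this have "v \<notin> C" using comps_notin[OF assms(1,2)] by blast
    ultimately show "C \<in> free_comps (insert v V) (insert {u, v} S) L"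
      using C unfolding free_comps_def comps_pendant[OF v assms(2,3)] by auto
  qed
  then show ?thesis by (simp add: free_rank_def)
qed

text \<open>The unmarked \<open>v\<close> enlarges the component of \<open>u\<close> by one vertex,
  which is noticed only if that component is free.\<close>

lemma free_rank_pendant_out:
  assumes "\<Union>S \<subseteq> V" "v \<notin> V" "u \<in> V" "v \<notin> L" "finite V"
  shows "free_rank (insert v V) (insert {u, v} S) L =
    free_rank V S L + (if conn S `` {u} \<inter> L = {} then 1 else 0)"
proof -
  have v: "v \<notin> \<Union>S" using assms by blast
  let ?h = "\<lambda>C. if u \<in> C then insert v C else C"
  have nv: "v \<notin> C" if "C \<in> free_comps V S L" for C
    using that comps_notin[OF assms(1,2)] by (auto simp: free_comps_def)
  have fin: "finite (free_comps V S L)"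
    using finite_comps[OF assms(5)] by (simp add: free_comps_def)
  have eq: "free_comps (insert v V) (insert {u, v} S) L = ?h ` free_comps V S L"
  proof -
    have "?h C \<inter> L = C \<inter> L" for C using assms(4) by auto
    then show ?thesis
      unfolding free_comps_def comps_pendant[OF v assms(2,3)] by (auto simp del: if_image_distrib)
  qed
  have inj: "inj_on ?h (free_comps V S L)"
  proof (rule inj_onI)
    fix C D assume "C \<in> free_comps V S L" "D \<in> free_comps V S L" "?h C = ?h D"
    then show "C = D" using nv[of C] nv[of D] by (auto split: if_splits)
  qed
  have card: "int (card (?h C)) - 1 = (int (card C) - 1) + (if u \<in> C then 1 else 0)"
    if "C \<in> free_comps V S L" for C
  proof -
    have "finite C" using that finite_comp[OF assms(5,1)] by (simp add: free_comps_def)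
    then show ?thesis using nv[OF that] by simp
  qed
  have "free_rank (insert v V) (insert {u, v} S) L = (\<Sum>C\<in>free_comps V S L. int (card (?h C)) - 1)"
    unfolding free_rank_def eq by (simp only: sum.reindex[OF inj] comp_def)
  also have "\<dots> = free_rank V S L + (\<Sum>C\<in>free_comps V S L. if u \<in> C then 1 else 0)"
    unfolding free_rank_def sum.distrib[symmetric] by (rule sum.cong[OF refl card])
  also have "(\<Sum>C\<in>free_comps V S L. if u \<in> C then 1 else 0) =
      (\<Sum>C\<in>free_comps V S L. if C = conn S `` {u} then 1 else (0 :: int))"
  proof (rule sum.cong[OF refl])
    fix C assume "C \<in> free_comps V S L"
    then have C: "C \<in> comps V S" by (simp add: free_comps_def)
    have "u \<in> C \<longleftrightarrow> C = conn S `` {u}"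
    proof
      assume "u \<in> C"
      then show "C = conn S `` {u}" using comps_conn[OF C \<open>u \<in> C\<close>] by (simp add: set_eq_iff)
    next
      assume "C = conn S `` {u}"
      then show "u \<in> C" by simp
    qed
    then show "(if u \<in> C then 1 else 0) = (if C = conn S `` {u} then 1 else (0 :: int))" by simp
  qed
  also have "\<dots> = (if conn S `` {u} \<inter> L = {} then 1 else 0)"
  proof -
    have "conn S `` {u} \<in> comps V S" using assms(3) by (auto simp: comps_iff)
    then show ?thesis using fin by (simp add: free_comps_def)
  qed
  finally show ?thesis .
qed

section \<open>Sign-normalized coefficients and their recursion at a pendant vertex\<close>

definition signed0 :: "'a set \<Rightarrow> 'a set set \<Rightarrow> 'a set \<Rightarrow> int" where
  "signed0 V E L = (- 1) ^ card (V - L) * coeff0 E L"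

definition signed1 :: "'a set \<Rightarrow> 'a set set \<Rightarrow> 'a set \<Rightarrow> int" where
  "signed1 V E L = (- 1) ^ card (V - L) * coeff1 V E L"

lemma sum_Pow_insert_sign:
  assumes "finite E" "e \<notin> E"
  shows "(\<Sum>S\<in>Pow (insert e E). if P S then (- 1) ^ card S * F S else 0) =
    (\<Sum>S\<in>Pow E. if P S then (- 1) ^ card S * F S else 0) -
    (\<Sum>S\<in>Pow E. if P (insert e S) then (- 1) ^ card S * F (insert e S) else (0 :: int))"
proof -
  have "(if P (insert e S) then (- 1) ^ card (insert e S) * F (insert e S) else 0) =
      - (if P (insert e S) then (- 1) ^ card S * F (insert e S) else 0)" if "S \<in> Pow E" for S
    using that assms finite_subset[of S E] by (subst card_insert_disjoint) auto
  then show ?thesis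
    unfolding sum_Pow_insert[OF assms] by (simp add: sum_negf)
qed

lemma sum_Pow_insert_sign0:
  assumes "finite E" "e \<notin> E"
  shows "coeff0 (insert e E) L = coeff0 E L - (\<Sum>S\<in>Pow E. if sep (insert e S) L then (- 1) ^ card S else 0)"
  using sum_Pow_insert_sign[OF assms, of "\<lambda>S. sep S L" "\<lambda>_. 1"] by (simp add: coeff0_def cong: if_cong)

locale pendant =
  fixes V :: "'a set" and E :: "'a set set" and u v :: 'a
  assumes fin: "finite V" and E: "\<Union>E \<subseteq> V" and u: "u \<in> V" and v: "v \<notin> V"
begin

lemma finE: "finite E"
  using finite_subset[of E "Pow V"] fin E by blast

lemma new: "{u, v} \<notin> E"
  using E v by blast

lemma vS: "S \<in> Pow E \<Longrightarrow> v \<notin> \<Union>S"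
  using E v by blast

lemma SV: "S \<in> Pow E \<Longrightarrow> \<Union>S \<subseteq> V"
  using E by blast

lemma uv: "u \<noteq> v"
  using u v by blast

text \<open>An unmarked end does not influence \<open>sep\<close>, so toggling the edge
  \<open>{u, v}\<close> is a sign-reversing involution.\<close>

lemma coeff0_out: "v \<notin> L \<Longrightarrow> coeff0 (insert {u, v} E) L = 0"
proof -
  assume L: "v \<notin> L"
  have "(\<Sum>S\<in>Pow E. if sep (insert {u, v} S) L then (- 1) ^ card S else 0) = coeff0 E L"
    unfolding coeff0_def by (intro sum.cong refl) (simp only: sep_pendant_out[OF vS L])
  then show ?thesis by (simp add: sum_Pow_insert_sign0[OF finE new])
qed

text \<open>Split by whether \<open>S\<close> contains \<open>{u, v}\<close>. Without it
  \<open>v\<close> is isolated and its mark is void; with it the mark passes to \<open>u\<close> and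
  the extra edge costs a sign.\<close>

lemma coeff0_in:
  assumes "v \<in> L"
  shows "coeff0 (insert {u, v} E) L =
    coeff0 E (L - {v}) - (if u \<in> L then 0 else coeff0 E (insert u (L - {v})))"
proof -
  have "coeff0 E L = coeff0 E (L - {v})"
    unfolding coeff0_def by (rule sum.cong[OF refl]) (simp only: sep_isolated[OF vS, of _ L])
  moreover have "(\<Sum>S\<in>Pow E. if sep (insert {u, v} S) L then (- 1) ^ card S else 0) =
      (if u \<in> L then 0 else coeff0 E (insert u (L - {v})))"
  proof (cases "u \<in> L")
    case True
    have "(\<Sum>S\<in>Pow E. if sep (insert {u, v} S) L then (- 1) ^ card S else 0) = (\<Sum>S\<in>Pow E. 0 :: int)"
      by (rule sum.cong[OF refl]) (simp only: sep_pendant_in[OF vS uv assms] True simp_thms if_False)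
    then show ?thesis using True by simp
  next
    case False
    have "(\<Sum>S\<in>Pow E. if sep (insert {u, v} S) L then (- 1) ^ card S else 0) = coeff0 E (insert u (L - {v}))"
      unfolding coeff0_def by (rule sum.cong[OF refl]) (simp only: sep_pendant_in[OF vS uv assms] False simp_thms)
    then show ?thesis using False by simp
  qed
  ultimately show ?thesis by (simp add: sum_Pow_insert_sign0[OF finE new])
qed

lemma coeff1_split:
  "coeff1 (insert v V) (insert {u, v} E) L =
    - (\<Sum>S\<in>Pow E. if sep S L then (- 1) ^ card S * free_rank (insert v V) S L else 0) +
    (\<Sum>S\<in>Pow E. if sep (insert {u, v} S) L
      then (- 1) ^ card S * free_rank (insert v V) (insert {u, v} S) L else 0)"
  unfolding coeff1_def sum_Pow_insert_sign[OF finE new] by simp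

lemma coeff1_in:
  assumes "v \<in> L"
  shows "coeff1 (insert v V) (insert {u, v} E) L =
    coeff1 V E (L - {v}) - (if u \<in> L then 0 else coeff1 V E (insert u (L - {v})))"
proof -
  have "- (\<Sum>S\<in>Pow E. if sep S L then (- 1) ^ card S * free_rank (insert v V) S L else 0) =
      coeff1 V E (L - {v})"
    unfolding coeff1_def
  proof (intro arg_cong[of _ _ uminus] sum.cong refl)
    fix S assume S: "S \<in> Pow E"
    show "(if sep S L then (- 1) ^ card S * free_rank (insert v V) S L else 0) =
        (if sep S (L - {v}) then (- 1) ^ card S * free_rank V S (L - {v}) else 0)"
      unfolding free_rank_isolated[OF SV[OF S] v fin] sep_isolated[OF vS[OF S], of L] ..
  qed
  moreover have "(\<Sum>S\<in>Pow E. if sep (insert {u, v} S) L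
      then (- 1) ^ card S * free_rank (insert v V) (insert {u, v} S) L else 0) =
      - (if u \<in> L then 0 else coeff1 V E (insert u (L - {v})))"
  proof (cases "u \<in> L")
    case True
    have "(\<Sum>S\<in>Pow E. if sep (insert {u, v} S) L
        then (- 1) ^ card S * free_rank (insert v V) (insert {u, v} S) L else 0) = (\<Sum>S\<in>Pow E. 0 :: int)"
      by (rule sum.cong[OF refl]) (simp only: sep_pendant_in[OF vS uv assms] True simp_thms if_False)
    then show ?thesis using True by simp
  next
    case False
    have "(\<Sum>S\<in>Pow E. if sep (insert {u, v} S) L
        then (- 1) ^ card S * free_rank (insert v V) (insert {u, v} S) L else 0) =
        - coeff1 V E (insert u (L - {v}))"
      unfolding coeff1_def minus_minus
      by (rule sum.cong[OF refl])
        (simp only: sep_pendant_in[OF vS uv assms] False simp_thms free_rank_pendant_in[OF SV v u assms])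
    then show ?thesis using False by simp
  qed
  ultimately show ?thesis unfolding coeff1_split by simp
qed

text \<open>Toggling the edge cancels everything but the change of \<open>free_rank\<close>, which
  is 1 if the component of \<open>u\<close> is unmarked. When \<open>u\<close> is unmarked, that
  condition together with \<open>sep S L\<close> says that \<open>S\<close> still separates after
  marking \<open>u\<close>: here the second coefficient falls back on the first.\<close>

lemma coeff1_out:
  assumes "v \<notin> L"
  shows "coeff1 (insert v V) (insert {u, v} E) L = (if u \<in> L then 0 else coeff0 E (insert u L))"
proof -
  have L: "L - {v} = L" using assms by blast
  have "coeff1 (insert v V) (insert {u, v} E) L =
      (\<Sum>S\<in>Pow E. (if sep (insert {u, v} S) L
        then (- 1) ^ card S * free_rank (insert v V) (insert {u, v} S) L else 0) -
        (if sep S L then (- 1) ^ card S * free_rank (insert v V) S L else 0))"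
    unfolding coeff1_split sum_subtractf by simp
  also have "\<dots> = (\<Sum>S\<in>Pow E. if sep S L \<and> conn S `` {u} \<inter> L = {} then (- 1) ^ card S else 0)"
  proof (rule sum.cong[OF refl])
    fix S assume S: "S \<in> Pow E"
    show "(if sep (insert {u, v} S) L
        then (- 1) ^ card S * free_rank (insert v V) (insert {u, v} S) L else 0) -
        (if sep S L then (- 1) ^ card S * free_rank (insert v V) S L else 0) =
        (if sep S L \<and> conn S `` {u} \<inter> L = {} then (- 1) ^ card S else 0)"
      unfolding sep_pendant_out[OF vS[OF S] assms] free_rank_isolated[OF SV[OF S] v fin] L
        free_rank_pendant_out[OF SV[OF S] v u assms fin]
      by (simp add: distrib_left)
  qed
  also have "\<dots> = (if u \<in> L then 0 else coeff0 E (insert u L))"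
  proof (cases "u \<in> L")
    case True
    then have "conn S `` {u} \<inter> L \<noteq> {}" for S using conn_refl[of u S] by blast
    then show ?thesis using True by simp
  next
    case False
    have "sep S L \<and> conn S `` {u} \<inter> L = {} \<longleftrightarrow> sep S (insert u L)" for S
    proof
      assume *: "sep S L \<and> conn S `` {u} \<inter> L = {}"
      then have n: "(u, y) \<notin> conn S" "(y, u) \<notin> conn S" if "y \<in> L" for y
        using that conn_sym[of y u S] by blast+
      show "sep S (insert u L)"
        unfolding sep_def
      proof (intro ballI impI)
        fix x y assume "x \<in> insert u L" "y \<in> insert u L" "(x, y) \<in> conn S"
        then show "x = y" using n * unfolding sep_def by (metis insertE)
      qed
    next
      assume "sep S (insert u L)"
      then show "sep S L \<and> conn S `` {u} \<inter> L = {}" using False unfolding sep_def by blast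
    qed
    then show ?thesis using False by (simp add: coeff0_def)
  qed
  finally show ?thesis .
qed

lemma card_diff:
  "v \<in> L \<Longrightarrow> card (insert v V - L) = card (V - (L - {v}))"
  "v \<in> L \<Longrightarrow> u \<notin> L \<Longrightarrow> card (insert v V - L) = Suc (card (V - insert u (L - {v})))"
  "v \<notin> L \<Longrightarrow> u \<notin> L \<Longrightarrow> card (insert v V - L) = Suc (Suc (card (V - insert u L)))"
proof -
  have rem: "card (V - M) = Suc (card (V - insert u M))" if "u \<notin> M" for M
  proof -
    have "card (V - M) = card (insert u (V - insert u M))"
      by (rule arg_cong[of _ _ card]) (use u that in blast)
    also have "\<dots> = Suc (card (V - insert u M))" using fin by simp
    finally show ?thesis .
  qed
  have eq: "V - (L - {v}) = V - L" using v by blast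
  then have "insert v V - L = V - (L - {v})" if "v \<in> L" using that by blast
  then show 1: "v \<in> L \<Longrightarrow> card (insert v V - L) = card (V - (L - {v}))" by simp
  show "v \<in> L \<Longrightarrow> u \<notin> L \<Longrightarrow> card (insert v V - L) = Suc (card (V - insert u (L - {v})))"
    using 1 rem[of "L - {v}"] by simp
  assume "v \<notin> L" "u \<notin> L"
  moreover from this have "insert v V - L = insert v (V - L)" by blast
  ultimately show "card (insert v V - L) = Suc (Suc (card (V - insert u L)))"
    using rem[of L] v fin by simp
qed

text \<open>Moving the mark to an unmarked \<open>u\<close> leaves one unmarked vertex fewer than
  dropping it, so the normalization turns the minus of \<open>coeff0_in\<close> into a plus and
  terms cannot cancel.\<close>

lemma signed0_eq:
  "signed0 (insert v V) (insert {u, v} E) L = (if v \<notin> L then 0 else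
    signed0 V E (L - {v}) + (if u \<in> L then 0 else signed0 V E (insert u (L - {v}))))"
proof (cases "v \<in> L")
  case False
  then show ?thesis by (simp add: signed0_def coeff0_out)
next
  case v: True
  show ?thesis
  proof (cases "u \<in> L")
    case True
    then show ?thesis 
      unfolding signed0_def coeff0_in[OF v] card_diff(1)[OF v] using v by simp
  next
    case False
    have "card (V - (L - {v})) = Suc (card (V - insert u (L - {v})))"
      using v False card_diff(1,2) by metis
    then show ?thesis
      unfolding signed0_def coeff0_in[OF v] card_diff(2)[OF v False]
      using v False by (simp add: algebra_simps)
  qed
qed

text \<open>In the additional case \<open>v \<notin> L\<close> the numbers of unmarked vertices
  differ by two, so that term keeps its sign.\<close>

lemma signed1_eq:
  "signed1 (insert v V) (insert {u, v} E) L =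
    (if v \<notin> L then if u \<in> L then 0 else signed0 V E (insert u L)
     else signed1 V E (L - {v}) + (if u \<in> L then 0 else signed1 V E (insert u (L - {v}))))"
proof (cases "v \<in> L")
  case False
  then show ?thesis by (simp add: signed0_def signed1_def coeff1_out card_diff(3))
next
  case v: True
  show ?thesis
  proof (cases "u \<in> L")
    case True
    then show ?thesis 
      unfolding signed1_def coeff1_in[OF v] card_diff(1)[OF v] using v by simp
  next
    case False
    have "card (V - (L - {v})) = Suc (card (V - insert u (L - {v})))"
      using v False card_diff(1,2) by metis
    then show ?thesis
      unfolding signed1_def coeff1_in[OF v] card_diff(2)[OF v False]
      using v False by (simp add: algebra_simps)
  qed
qed

end

section \<open>Graphs grown by pendant vertices\<close>

text \<open>Every connected unicyclic graph arises in this way from its cycle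
  (\<open>unicyclic_grown\<close>), which turns the pendant recursion into an induction.\<close>

inductive grown :: "'a set \<Rightarrow> 'a set set \<Rightarrow> 'a set \<Rightarrow> 'a set set \<Rightarrow> bool" for V0 E0 where
  base: "grown V0 E0 V0 E0"
| step: "grown V0 E0 V E \<Longrightarrow> u \<in> V \<Longrightarrow> v \<notin> V \<Longrightarrow> grown V0 E0 (insert v V) (insert {u, v} E)"

lemma grown_basic:
  assumes "grown V0 E0 V E" "finite V0" "\<Union>E0 \<subseteq> V0"
  shows "finite V" "\<Union>E \<subseteq> V" "V0 \<subseteq> V" "E0 \<subseteq> E"
  using assms by (induction rule: grown.induct) auto

text \<open>In the application \<open>(V0, E0)\<close> is the cycle, \<open>E\<close> the edges between non-leaves and \<open>L\<close> the vertices carrying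
  leaves; the touched vertices are then the roots of the non-trivial trees.\<close>

definition touched :: "'a set \<Rightarrow> 'a set set \<Rightarrow> 'a set set \<Rightarrow> 'a set \<Rightarrow> 'a set" where
  "touched V0 E0 E L = {x \<in> V0. x \<in> L \<or> (\<exists>e\<in>E - E0. x \<in> e)}"

abbreviation edeg :: "'a set set \<Rightarrow> 'a \<Rightarrow> nat" where
  "edeg E x \<equiv> card {e \<in> E. x \<in> e}"

text \<open>Holds once the leaves are cut off: a vertex off the cycle that is left with degree one
  was no leaf before, so it carries a leaf. It keeps the recursion away from the case of an unmarked
  pendant vertex.\<close>

definition covers_ends :: "'a set \<Rightarrow> 'a set \<Rightarrow> 'a set set \<Rightarrow> 'a set \<Rightarrow> bool" where
  "covers_ends V0 V E L \<longleftrightarrow> (\<forall>x\<in>V - V0. edeg E x = 1 \<longrightarrow> x \<in> L)"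

text \<open>The mark moved to \<open>u\<close> makes up for the deleted edge at
  \<open>u\<close>.\<close>

lemma touched_pendant:
  assumes "V0 \<subseteq> V" "\<Union>E \<subseteq> V" "E0 \<subseteq> E" "v \<notin> V"
  shows "touched V0 E0 (insert {u, v} E) L = touched V0 E0 E (insert u (L - {v}))"
proof -
  have "{u, v} \<notin> E0" using assms by blast
  then have "insert {u, v} E - E0 = insert {u, v} (E - E0)" by blast
  then show ?thesis using assms unfolding touched_def by auto
qed

lemma covers_ends_pendant:
  assumes "V0 \<subseteq> V" "\<Union>E \<subseteq> V" "v \<notin> V" "covers_ends V0 (insert v V) (insert {u, v} E) L"
  shows "v \<in> L" "covers_ends V0 V E (insert u (L - {v}))"
proof -
  have "{e \<in> insert {u, v} E. v \<in> e} = {{u, v}}" using assms(2,3) by auto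
  then have "edeg (insert {u, v} E) v = 1" by simp
  then show "v \<in> L" using assms unfolding covers_ends_def by blast
  show "covers_ends V0 V E (insert u (L - {v}))"
    unfolding covers_ends_def
  proof (intro ballI impI)
    fix x assume x: "x \<in> V - V0" "edeg E x = 1"
    show "x \<in> insert u (L - {v})"
    proof (cases "x = u")
      case False
      have "x \<noteq> v" using x assms(3) by blast
      then have "{e \<in> insert {u, v} E. x \<in> e} = {e \<in> E. x \<in> e}" using False by auto
      then have "x \<in> L" using x assms(4) unfolding covers_ends_def by auto
      then show ?thesis using \<open>x \<noteq> v\<close> by simp
    qed simp
  qed
qed

lemma grown_signed0_nonneg:
  assumes "grown V0 E0 V E" "finite V0" "\<Union>E0 \<subseteq> V0"
    and base: "\<And>L. L \<subseteq> V0 \<Longrightarrow> 0 \<le> signed0 V0 E0 L"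
    and "L \<subseteq> V"
  shows "0 \<le> signed0 V E L"
  using assms(1,5)
proof (induction arbitrary: L rule: grown.induct)
  case (step V E u v)
  note b = grown_basic[OF step.hyps(1) assms(2,3)]
  interpret pendant V E u v using b step.hyps by unfold_locales auto
  have "L - {v} \<subseteq> V" "insert u (L - {v}) \<subseteq> V" using step by auto
  then have "0 \<le> signed0 V E (L - {v})" "0 \<le> signed0 V E (insert u (L - {v}))"
    using step.IH by blast+
  then show ?case unfolding signed0_eq by simp
qed (rule base)

text \<open>The term that moves the mark inherits all hypotheses and stays positive down to the
  base. The term that drops the mark may violate them but is nonnegative. If \<open>u\<close> is
  marked, the two marked sets coincide and the only term is the positive one.\<close>

lemma grown_signed0_pos:
  assumes "grown V0 E0 V E" "finite V0" "\<Union>E0 \<subseteq> V0"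
    and base: "\<And>L. L \<subseteq> V0 \<Longrightarrow> 0 \<le> signed0 V0 E0 L"
    and base_pos: "\<And>L. L \<subseteq> V0 \<Longrightarrow> 2 \<le> card L \<Longrightarrow> 0 < signed0 V0 E0 L"
    and "L \<subseteq> V" "covers_ends V0 V E L" "2 \<le> card (touched V0 E0 E L)"
  shows "0 < signed0 V E L"
  using assms(1,6-8)
proof (induction arbitrary: L rule: grown.induct)
  case base
  have "touched V0 E0 E0 L = L" using base by (auto simp: touched_def)
  then show ?case using base base_pos by simp
next
  case (step V E u v)
  note b = grown_basic[OF step.hyps(1) assms(2,3)]
  interpret pendant V E u v using b step.hyps by unfold_locales auto
  note ce = covers_ends_pendant[OF b(3,2) step.hyps(3) step.prems(2)]
  have sub: "L - {v} \<subseteq> V" "insert u (L - {v}) \<subseteq> V" using step by auto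
  have "2 \<le> card (touched V0 E0 E (insert u (L - {v})))"
    using step.prems(3) touched_pendant[OF b(3,2,4) step.hyps(3)] by metis
  then have "0 < signed0 V E (insert u (L - {v}))"
    using step.IH sub(2) ce(2) by blast
  moreover have "0 \<le> signed0 V E (L - {v})"
    by (rule grown_signed0_nonneg[OF step.hyps(1) assms(2,3) assms(4) sub(1)])
  moreover have "insert u (L - {v}) = L - {v}" if "u \<in> L" using that uv by blast
  ultimately show ?case
    unfolding signed0_eq using ce(1) by (cases "u \<in> L") auto
qed

text \<open>The claims have to be proved together. An unmarked pendant vertex reduces
  \<open>signed1\<close> to a first coefficient of the smaller graph, which must be 0; and dropping
  a mark may uncover an end, so that term is only known to be nonnegative.\<close>

lemma grown_coeffs_one_touched:
  assumes "grown V0 E0 V E" "finite V0" "\<Union>E0 \<subseteq> V0"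
    and base0: "\<And>L. L \<subseteq> {r} \<Longrightarrow> coeff0 E0 L = 0"
    and base1: "\<And>L. L \<subseteq> {r} \<Longrightarrow> 0 < signed1 V0 E0 L"
    and "L \<subseteq> V" "touched V0 E0 E L \<subseteq> {r}"
  shows "coeff0 E L = 0 \<and> 0 \<le> signed1 V E L \<and> (covers_ends V0 V E L \<longrightarrow> 0 < signed1 V E L)"
  using assms(1,6,7)
proof (induction arbitrary: L rule: grown.induct)
  case base
  then have "L \<subseteq> {r}" by (auto simp: touched_def)
  then show ?case using base0 base1 by (simp add: less_imp_le)
next
  case (step V E u v)
  note b = grown_basic[OF step.hyps(1) assms(2,3)]
  interpret pendant V E u v using b step.hyps by unfold_locales auto
  have t: "touched V0 E0 E (insert u (L - {v})) \<subseteq> {r}"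
    using step.prems(2) touched_pendant[OF b(3,2,4) step.hyps(3)] by metis
  then have t': "touched V0 E0 E (L - {v}) \<subseteq> {r}" by (auto simp: touched_def)
  have sub: "L - {v} \<subseteq> V" "insert u (L - {v}) \<subseteq> V" using step by auto
  note IH1 = step.IH[OF sub(1) t'] and IH2 = step.IH[OF sub(2) t]
  show ?case
  proof (cases "v \<in> L")
    case False
    then have "L - {v} = L" by blast
    then have "signed1 (insert v V) (insert {u, v} E) L = 0"
      unfolding signed1_eq using IH2 False by (simp add: signed0_def)
    moreover have "\<not> covers_ends V0 (insert v V) (insert {u, v} E) L"
      using covers_ends_pendant(1)[OF b(3,2) step.hyps(3)] False by blast
    ultimately show ?thesis using False by (simp add: coeff0_out)
  next
    case True
    have "0 < signed1 V E (insert u (L - {v}))" if "covers_ends V0 (insert v V) (insert {u, v} E) L"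
      using IH2 covers_ends_pendant(2)[OF b(3,2) step.hyps(3) that] by blast
    moreover have "insert u (L - {v}) = L - {v}" if "u \<in> L" using that uv by blast
    ultimately show ?thesis
      using True IH1 IH2 by (cases "u \<in> L") (auto simp: coeff0_in signed1_eq)
  qed
qed

section \<open>Paths and cycles\<close>

text \<open>The order \<open>{y, x}\<close> matches \<open>{u, v}\<close> in the locale
  \<open>pendant\<close>, with the head \<open>x\<close> as the pendant vertex attached to
  \<open>y\<close>.\<close>

fun path_edges :: "'a list \<Rightarrow> 'a set set" where
  "path_edges (x # y # zs) = insert {y, x} (path_edges (y # zs))"
| "path_edges _ = {}"

definition cycle_edges :: "'a list \<Rightarrow> 'a set set" where
  "cycle_edges vs = insert {last vs, hd vs} (path_edges vs)"

lemma Union_path_edges: "\<Union>(path_edges xs) \<subseteq> set xs"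
  by (induction xs rule: path_edges.induct) auto

lemma Union_cycle_edges: "vs \<noteq> [] \<Longrightarrow> \<Union>(cycle_edges vs) \<subseteq> set vs"
  using Union_path_edges[of vs] by (simp add: cycle_edges_def)

lemma finite_path_edges [simp]: "finite (path_edges xs)"
  by (induction xs rule: path_edges.induct) auto

lemma path_edges_append:
  "as \<noteq> [] \<Longrightarrow> bs \<noteq> [] \<Longrightarrow>
    path_edges (as @ bs) = insert {hd bs, last as} (path_edges as \<union> path_edges bs)"
proof (induction as rule: path_edges.induct)
  case (1 x y zs)
  then show ?case by auto
next
  case ("2_2" x)
  then show ?case by (cases bs) auto
qed simp

lemma cycle_edges_rotate: "cycle_edges (as @ bs) = cycle_edges (bs @ as)"
proof (cases "as = [] \<or> bs = []")
  case False
  then show ?thesis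
    by (auto simp: cycle_edges_def path_edges_append)
qed auto

lemma path_edge_split:
  "e \<in> path_edges vs \<Longrightarrow> \<exists>as p q bs. vs = as @ p # q # bs \<and> e = {q, p}"
proof (induction vs rule: path_edges.induct)
  case (1 x y zs)
  show ?case
  proof (cases "e = {y, x}")
    case True
    then show ?thesis by (intro exI[of _ "[]"]) auto
  next
    case False
    then have "e \<in> path_edges (y # zs)" using 1(2) by simp
    from 1(1)[OF this] obtain as p q bs where "y # zs = as @ p # q # bs" "e = {q, p}" by blast
    then have "x # y # zs = (x # as) @ p # q # bs \<and> e = {q, p}" by simp
    then show ?thesis by blast
  qed
qed auto

lemma closing_edge_notin:
  assumes "distinct vs" "3 \<le> length vs"
  shows "{last vs, hd vs} \<notin> path_edges vs"
proof
  assume e: "{last vs, hd vs} \<in> path_edges vs"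
  obtain x y z zs where vs: "vs = x # y # z # zs"
    using assms(2) by (auto simp: numeral_3_eq_3 Suc_le_length_iff)
  have l: "last vs \<in> set (z # zs)" unfolding vs by simp
  have "{last vs, x} \<noteq> {y, x}"
    using l assms(1) unfolding vs by (auto simp: doubleton_eq_iff)
  then have "{last vs, x} \<in> path_edges (y # z # zs)" using e by (simp add: vs)
  then have "x \<in> set (y # z # zs)" using Union_path_edges[of "y # z # zs"] by blast
  then show False using assms(1) vs by auto
qed

lemma card_path_edges: "distinct xs \<Longrightarrow> card (path_edges xs) = length xs - 1"
proof (induction xs rule: path_edges.induct)
  case (1 x y zs)
  have "{y, x} \<notin> path_edges (y # zs)"
    using 1(2) Union_path_edges[of "y # zs"] by auto
  then show ?case using 1 by simp
qed auto

lemma card_cycle_edges: "distinct vs \<Longrightarrow> 3 \<le> length vs \<Longrightarrow> card (cycle_edges vs) = length vs"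
  by (simp add: cycle_edges_def closing_edge_notin card_path_edges)

lemma rotate_last:
  assumes "distinct vs" "x \<in> set vs"
  obtains ws where "distinct ws" "set ws = set vs" "length ws = length vs"
    "cycle_edges ws = cycle_edges vs" "last ws = x"
proof -
  obtain as bs where vs: "vs = as @ x # bs" using assms(2) by (meson split_list)
  have "cycle_edges (bs @ (as @ [x])) = cycle_edges ((as @ [x]) @ bs)" by (rule cycle_edges_rotate)
  then show thesis
    using assms(1) that[of "bs @ as @ [x]"] by (auto simp: vs)
qed

lemma rotate_edge:
  assumes "distinct vs" "3 \<le> length vs" "e \<in> cycle_edges vs"
  obtains ws where "distinct ws" "set ws = set vs" "length ws = length vs"
    "cycle_edges ws = cycle_edges vs" "path_edges ws = cycle_edges vs - {e}"
proof -
  obtain ws where ws: "distinct ws" "set ws = set vs" "length ws = length vs"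
    "cycle_edges ws = cycle_edges vs" "e = {last ws, hd ws}"
  proof (cases "e = {last vs, hd vs}")
    case True
    then show thesis using that[of vs] assms by simp
  next
    case False
    then have "e \<in> path_edges vs" using assms(3) by (simp add: cycle_edges_def)
    then obtain as p q bs where vs: "vs = as @ p # q # bs" "e = {q, p}" using path_edge_split by blast
    have "cycle_edges ((q # bs) @ (as @ [p])) = cycle_edges ((as @ [p]) @ (q # bs))" by (rule cycle_edges_rotate)
    then show thesis
      using assms(1) that[of "(q # bs) @ as @ [p]"] by (auto simp: vs insert_commute)
  qed
  have "e \<notin> path_edges ws"
    unfolding ws(5) by (rule closing_edge_notin) (use ws(1,3) assms(2) in simp_all)
  moreover have "cycle_edges vs = insert e (path_edges ws)"
    unfolding ws(4)[symmetric] ws(5) by (rule cycle_edges_def)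
  ultimately have "path_edges ws = cycle_edges vs - {e}" by simp
  then show thesis using that[OF ws(1-4)] by blast
qed

lemma path_pendant:
  assumes "distinct (x # y # zs)"
  shows "pendant (set (y # zs)) (path_edges (y # zs)) y x"
  using assms Union_path_edges[of "y # zs"] by unfold_locales auto

lemma conn_path: "xs \<noteq> [] \<Longrightarrow> x \<in> set xs \<Longrightarrow> (x, last xs) \<in> conn (path_edges xs)"
proof (induction xs arbitrary: x rule: path_edges.induct)
  case (1 a b zs)
  let ?P = "path_edges (a # b # zs)"
  have sub: "conn (path_edges (b # zs)) \<subseteq> conn ?P" by (rule conn_mono) auto
  have IH: "(z, last (b # zs)) \<in> conn ?P" if "z \<in> set (b # zs)" for z
    using 1(1)[of z] that sub by blast
  have "(a, b) \<in> conn ?P" by (rule conn_sym, rule conn_edge) simp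
  then have "(a, last (b # zs)) \<in> conn ?P" using conn_trans IH[of b] by fastforce
  then show ?case using IH 1(3) by auto
qed auto

lemma conn_path_all: "x \<in> set xs \<Longrightarrow> y \<in> set xs \<Longrightarrow> (x, y) \<in> conn (path_edges xs)"
  using conn_path[of xs x] conn_path[of xs y] conn_sym conn_trans by (metis empty_iff list.set(1))

lemma path_connecting_subset:
  "distinct xs \<Longrightarrow> xs \<noteq> [] \<Longrightarrow> S \<subseteq> path_edges xs \<Longrightarrow> (hd xs, last xs) \<in> conn S \<Longrightarrow> S = path_edges xs"
proof (induction xs arbitrary: S rule: path_edges.induct)
  case (1 x y zs)
  let ?P = "path_edges (y # zs)"
  interpret pendant "set (y # zs)" ?P y x using 1(2) by (rule path_pendant)
  define S' where "S' = S \<inter> ?P"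
  have S': "S' \<in> Pow ?P" by (simp add: S'_def)
  have lx: "last (y # zs) \<noteq> x" using 1(2) last_in_set[of "y # zs"] by auto
  show ?case
  proof (cases "{y, x} \<in> S")
    case False
    then have "S = S'" using 1(4) by (auto simp: S'_def)
    then have "x \<notin> \<Union>S" using vS[OF S'] by simp
    then have "last (x # y # zs) = x" using 1(5) conn_isolated(1)[of x S] by simp
    then show ?thesis using lx by simp
  next
    case True
    then have S: "S = insert {y, x} S'" using 1(4) by (auto simp: S'_def)
    have "(x, last (y # zs)) \<in> conn (insert {y, x} S')" using 1(5) S by simp
    then have "(y, last (y # zs)) \<in> conn S'"
      using conn_pendant[OF vS[OF S'], of x "last (y # zs)" y] lx by simp
    then have "S' = ?P" using 1(1)[of S'] 1(2) S' by simp
    then show ?thesis using S by simp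
  qed
qed auto

text \<open>Peel off the head. An unmarked head gives 0; a marked head passes its mark to the next
  vertex, so strict positivity comes from the final one-vertex path.\<close>

lemma path_signed0:
  "distinct xs \<Longrightarrow> xs \<noteq> [] \<Longrightarrow> L \<subseteq> set xs \<Longrightarrow> last xs \<in> L \<Longrightarrow>
    0 \<le> signed0 (set xs) (path_edges xs) L \<and> (hd xs \<in> L \<longrightarrow> 0 < signed0 (set xs) (path_edges xs) L)"
proof (induction xs arbitrary: L rule: path_edges.induct)
  case (1 x y zs)
  let ?P = "path_edges (y # zs)" and ?V = "set (y # zs)"
  interpret pendant ?V ?P y x using 1(2) by (rule path_pendant)
  have lx: "last (y # zs) \<noteq> x" using 1(2) last_in_set[of "y # zs"] by auto
  have sub: "L - {x} \<subseteq> ?V" "insert y (L - {x}) \<subseteq> ?V" using 1(4) by auto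
  have l: "last (y # zs) \<in> L - {x}" "last (y # zs) \<in> insert y (L - {x})" using 1(5) lx by auto
  have a: "0 \<le> signed0 ?V ?P (L - {x})" using 1(1)[OF _ _ sub(1) l(1)] 1(2) by simp
  have b: "0 < signed0 ?V ?P (insert y (L - {x}))" using 1(1)[OF _ _ sub(2) l(2)] 1(2) by simp
  have c: "insert y (L - {x}) = L - {x}" if "y \<in> L" using that uv by blast
  have "signed0 (set (x # y # zs)) (path_edges (x # y # zs)) L = (if x \<notin> L then 0 else
      signed0 ?V ?P (L - {x}) + (if y \<in> L then 0 else signed0 ?V ?P (insert y (L - {x}))))"
    using signed0_eq[of L] by simp
  then show ?case using a b c by (cases "y \<in> L") auto
next
  case ("2_2" x)
  then have "L = {x}" by auto
  then show ?case by (simp add: signed0_def coeff0_def sep_def)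
qed simp

lemma conn_cong: "(z, w) \<in> conn S \<Longrightarrow> (z, x) \<in> conn S \<longleftrightarrow> (w, x) \<in> conn S"
  using conn_trans conn_sym by metis

lemma conn_insert_cases:
  assumes "(x, y) \<in> conn (insert {p, q} S)"
  shows "(x, y) \<in> conn S \<or>
    ((x, p) \<in> conn S \<or> (x, q) \<in> conn S) \<and> ((y, p) \<in> conn S \<or> (y, q) \<in> conn S)"
proof -
  define D where "D = {z. (z, p) \<in> conn S \<or> (z, q) \<in> conn S}"
  \<comment> \<open>The class of \<open>z\<close> after the classes of \<open>p\<close> and
    \<open>q\<close> have been merged into \<open>D\<close>.\<close>
  define f where "f z = (if z \<in> D then D else conn S `` {z})" for z
  have D: "z \<in> D \<longleftrightarrow> w \<in> D" if "(z, w) \<in> conn S" for z w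
    unfolding D_def mem_Collect_eq conn_cong[OF that] ..
  have "f x = f y"
    using assms
  proof (rule conn_invariant)
    fix u v assume uv: "{u, v} \<in> insert {p, q} S"
    show "f u = f v"
    proof (cases "{u, v} \<in> S")
      case True
      then have c: "(u, v) \<in> conn S" by (rule conn_edge)
      then show ?thesis using D[OF c] equiv_class_eq[OF equiv_conn c] by (simp add: f_def)
    next
      case False
      then have "{u, v} = {p, q}" using uv by blast
      then have "u \<in> D" "v \<in> D" by (auto simp: D_def doubleton_eq_iff)
      then show ?thesis by (simp add: f_def)
    qed
  qed
  show ?thesis
  proof (cases "x \<in> D")
    case True
    have "y \<in> D"
    proof (rule ccontr)
      assume "y \<notin> D"
      then have "conn S `` {y} = D" using \<open>f x = f y\<close> True by (simp add: f_def)
      then have "y \<in> D" using conn_refl[of y S] by blast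
      then show False using \<open>y \<notin> D\<close> by blast
    qed
    then show ?thesis using True by (simp add: D_def)
  next
    case False
    show ?thesis
    proof (cases "y \<in> D")
      case True
      then have "conn S `` {x} = D" using \<open>f x = f y\<close> False by (simp add: f_def)
      then have "x \<in> D" using conn_refl[of x S] by blast
      then show ?thesis using False by blast
    next
      case False
      then have "conn S `` {x} = conn S `` {y}" using \<open>f x = f y\<close> \<open>x \<notin> D\<close> by (simp add: f_def)
      then have "(x, y) \<in> conn S" using conn_refl[of y S] by blast
      then show ?thesis by blast
    qed
  qed
qed

text \<open>Like a pendant edge, the closing edge passes the mark of \<open>last vs\<close> on to
  \<open>hd vs\<close>. The difference is that \<open>S\<close> may already join its two ends; then
  \<open>S\<close> is the whole path, and since there is a second marked vertex, both sides are
  false.\<close>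

lemma sep_closing_edge:
  assumes vs: "distinct vs" "vs \<noteq> []" and L: "L \<subseteq> set vs" "last vs \<in> L" "hd vs \<notin> L" "2 \<le> card L"
    and S: "S \<subseteq> path_edges vs"
  shows "sep (insert {last vs, hd vs} S) L \<longleftrightarrow> sep S (insert (hd vs) L)"
proof
  let ?S = "insert {last vs, hd vs} S"
  have SS: "conn S \<subseteq> conn ?S" by (rule conn_mono) auto
  assume sep: "sep ?S L"
  have "(hd vs, y) \<notin> conn S" if "y \<in> L" for y
  proof
    assume hy: "(hd vs, y) \<in> conn S"
    have "(last vs, hd vs) \<in> conn ?S" by (rule conn_edge) simp
    moreover have "(hd vs, y) \<in> conn ?S" using hy SS by blast
    ultimately have "(last vs, y) \<in> conn ?S" by (rule conn_trans)
    then have "y = last vs" using sep L(2) that unfolding sep_def by blast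
    then have P: "S = path_edges vs" using path_connecting_subset[OF vs S] hy by blast
    obtain z where z: "z \<in> L" "z \<noteq> last vs"
    proof -
      have "\<not> L \<subseteq> {last vs}" using L(4) card_mono[of "{last vs}" L] by auto
      then show thesis using that by blast
    qed
    then have "(z, last vs) \<in> conn S" using conn_path[OF vs(2), of z] L(1) P by blast
    then have "(z, last vs) \<in> conn ?S" using SS by blast
    then show False using sep z L(2) unfolding sep_def by blast
  qed
  then have n: "(hd vs, y) \<notin> conn S" "(y, hd vs) \<notin> conn S" if "y \<in> L" for y
    using that conn_sym[of y "hd vs" S] by blast+
  show "sep S (insert (hd vs) L)"
    unfolding sep_def
  proof (intro ballI impI)
    fix x y assume "x \<in> insert (hd vs) L" "y \<in> insert (hd vs) L" and xy: "(x, y) \<in> conn S"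
    moreover have "(x, y) \<in> conn ?S" using xy SS by blast
    ultimately show "x = y" using n sep unfolding sep_def by (metis insertE)
  qed
next
  assume sep: "sep S (insert (hd vs) L)"
  show "sep (insert {last vs, hd vs} S) L"
    unfolding sep_def
  proof (intro ballI impI)
    fix x y assume xy: "x \<in> L" "y \<in> L" "(x, y) \<in> conn (insert {last vs, hd vs} S)"
    have "z = last vs" if "z \<in> L" "(z, last vs) \<in> conn S \<or> (z, hd vs) \<in> conn S" for z
      using that sep L(2,3) unfolding sep_def by blast
    moreover have "x = y" if "(x, y) \<in> conn S" using that sep xy unfolding sep_def by blast
    ultimately show "x = y" using conn_insert_cases[OF xy(3)] xy(1,2) by metis
  qed
qed

text \<open>Rotate so that the last vertex is marked and split by the closing edge. If the first
  vertex is marked too, that edge is forbidden and the path remains; otherwise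
  \<open>sep_closing_edge\<close> yields a recursion of the pendant type.\<close>

lemma cycle_signed0_pos:
  assumes "distinct vs" "3 \<le> length vs" "L \<subseteq> set vs" "2 \<le> card L"
  shows "0 < signed0 (set vs) (cycle_edges vs) L"
proof -
  obtain x where "x \<in> L" using assms(4) by fastforce
  then obtain ws where ws: "distinct ws" "set ws = set vs" "length ws = length vs"
    "cycle_edges ws = cycle_edges vs" "last ws = x"
    using rotate_last[OF assms(1), of x] assms(3) by blast
  let ?P = "path_edges ws" and ?e = "{last ws, hd ws}" and ?V = "set ws"
  have ne: "ws \<noteq> []" using ws(3) assms(2) by auto
  have L: "L \<subseteq> ?V" "last ws \<in> L" using assms(3) ws(2,5) \<open>x \<in> L\<close> by auto
  have new: "?e \<notin> ?P" using closing_edge_notin ws(1,3) assms(2) by metis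
  have c: "coeff0 (cycle_edges ws) L = coeff0 ?P L -
      (\<Sum>S\<in>Pow ?P. if sep (insert ?e S) L then (- 1) ^ card S else 0)"
    unfolding cycle_edges_def by (rule sum_Pow_insert_sign0[OF finite_path_edges new])
  have "0 < signed0 ?V (cycle_edges ws) L"
  proof (cases "hd ws \<in> L")
    case True
    have "3 \<le> length ws" using ws(3) assms(2) by simp
    then obtain a b cs where "ws = a # b # cs"
      by (auto simp: numeral_3_eq_3 Suc_le_length_iff)
    then have "hd ws \<noteq> last ws"
      using ws(1) last_in_set[of "b # cs"] by auto
    moreover have "(last ws, hd ws) \<in> conn (insert ?e S)" for S by (rule conn_edge) simp
    ultimately have "\<not> sep (insert ?e S) L" for S
      using True L(2) unfolding sep_def by metis
    then have "coeff0 (cycle_edges ws) L = coeff0 ?P L" unfolding c by simp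
    then show ?thesis
      using path_signed0[OF ws(1) ne L] True by (simp add: signed0_def)
  next
    case False
    have "(\<Sum>S\<in>Pow ?P. if sep (insert ?e S) L then (- 1) ^ card S else 0) = coeff0 ?P (insert (hd ws) L)"
      unfolding coeff0_def
    proof (rule sum.cong[OF refl])
      fix S assume "S \<in> Pow ?P"
      then have "sep (insert ?e S) L \<longleftrightarrow> sep S (insert (hd ws) L)"
        using sep_closing_edge[OF ws(1) ne L False assms(4)] by blast
      then show "(if sep (insert ?e S) L then (- 1) ^ card S else 0) =
          (if sep S (insert (hd ws) L) then (- 1) ^ card S else (0 :: int))" by simp
    qed
    then have c': "coeff0 (cycle_edges ws) L = coeff0 ?P L - coeff0 ?P (insert (hd ws) L)"
      unfolding c by simp
    have "card (?V - L) = Suc (card (?V - insert (hd ws) L))"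
    proof -
      have "card (?V - L) = card (insert (hd ws) (?V - insert (hd ws) L))"
        by (rule arg_cong[of _ _ card]) (use False ne in auto)
      also have "\<dots> = Suc (card (?V - insert (hd ws) L))" by simp
      finally show ?thesis .
    qed
    then have "signed0 ?V (cycle_edges ws) L = signed0 ?V ?P L + signed0 ?V ?P (insert (hd ws) L)"
      unfolding signed0_def c' by (simp add: algebra_simps)
    moreover have "0 < signed0 ?V ?P (insert (hd ws) L)"
      using path_signed0[OF ws(1) ne, of "insert (hd ws) L"] L ne by simp
    ultimately show ?thesis using path_signed0[OF ws(1) ne L] by simp
  qed
  then show ?thesis using ws by simp
qed

section \<open>The cycle with at most one marked vertex\<close>

lemma sep_card_le_1: "card L \<le> 1 \<Longrightarrow> finite L \<Longrightarrow> sep S L"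
  using card_le_Suc0_iff_eq[of L] unfolding sep_def by auto

lemma finite_cycle_edges: "finite (cycle_edges vs)"
  by (simp add: cycle_edges_def)

lemma cycle_coeff0_zero:
  assumes "card L \<le> 1" "finite L"
  shows "coeff0 (cycle_edges vs) L = 0"
proof -
  have "cycle_edges vs \<noteq> {}" by (simp add: cycle_edges_def)
  then show ?thesis
    using sum_Pow_sign[OF finite_cycle_edges, of vs] by (simp add: coeff0_def sep_card_le_1[OF assms])
qed

text \<open>Subsets of a path are forests, and without marks every component counts.\<close>

lemma free_rank_path: "distinct xs \<Longrightarrow> S \<subseteq> path_edges xs \<Longrightarrow> free_rank (set xs) S {} = int (card S)"
proof (induction xs arbitrary: S rule: path_edges.induct)
  case (1 x y zs)
  let ?P = "path_edges (y # zs)" and ?V = "set (y # zs)"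
  interpret pendant ?V ?P y x using 1(2) by (rule path_pendant)
  define S' where "S' = S \<inter> ?P"
  have S': "S' \<in> Pow ?P" by (simp add: S'_def)
  have IH: "free_rank ?V S' {} = int (card S')" using 1(1)[of S'] 1(2) S' by simp
  have fS: "finite S'" using S' finite_subset[of S' ?P] by simp
  have V: "set (x # y # zs) = insert x ?V" by simp
  show ?case
  proof (cases "{y, x} \<in> S")
    case False
    then have S: "S = S'" using 1(3) by (auto simp: S'_def)
    show ?thesis
      unfolding V S using free_rank_isolated[OF SV[OF S'] v fin, of "{}"] IH by simp
  next
    case True
    then have S: "S = insert {y, x} S'" using 1(3) by (auto simp: S'_def)
    have "{y, x} \<notin> S'" using new S' by blast
    then show ?thesis
      unfolding V S using free_rank_pendant_out[OF SV[OF S'] v u _ fin, of "{}"] IH fS by simp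
  qed
next
  case ("2_2" x)
  then have "S = {}" by simp
  moreover have "comps {x} {} = {{x}}"
    by (auto simp: comps_def quotient_def conn_def)
  ultimately show ?case by (simp add: free_rank_def free_comps_def)
qed (simp add: free_rank_def free_comps_def comps_def quotient_def)

lemma sum_Pow_sign_card:
  assumes "finite E" "2 \<le> card E"
  shows "(\<Sum>S\<in>Pow E. (- 1) ^ card S * int (card S)) = 0"
proof -
  obtain e F where E: "E = insert e F" "e \<notin> F" and "1 \<le> card F"
    using assms(2) by (metis One_nat_def card_le_Suc_iff Suc_1)
  then have F: "finite F" "F \<noteq> {}" using assms(1) by auto
  have "(\<Sum>S\<in>Pow F. (- 1) ^ card (insert e S) * int (card (insert e S))) =
      (\<Sum>S\<in>Pow F. - ((- 1) ^ card S * int (card S)) - (- 1) ^ card S)"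
  proof (rule sum.cong[OF refl])
    fix S assume "S \<in> Pow F"
    then have "finite S" "e \<notin> S" using F(1) E(2) finite_subset by blast+
    then show "(- 1) ^ card (insert e S) * int (card (insert e S)) =
        - ((- 1) ^ card S * int (card S)) - (- 1) ^ card S"
      by (simp add: algebra_simps)
  qed
  then show ?thesis
    unfolding E(1) sum_Pow_insert[OF F(1) E(2)]
    using sum_Pow_sign[OF F(1), where 'b = int] F(2) by (simp add: sum_subtractf sum_negf)
qed

text \<open>A proper subset of the cycle lies on a path, so its rank is its number of edges; the
  full cycle falls short by one. The alternating sum of the cardinalities vanishes, so only this
  deficit survives.\<close>

lemma cycle_coeff1_empty:
  assumes "distinct vs" "3 \<le> length vs"
  shows "coeff1 (set vs) (cycle_edges vs) {} = (- 1) ^ length vs"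
proof -
  let ?E = "cycle_edges vs" and ?V = "set vs"
  have fin: "finite ?E" by (rule finite_cycle_edges)
  have rank: "free_rank ?V S {} = int (card S)" if S: "S \<in> Pow ?E" "S \<noteq> ?E" for S
  proof -
    obtain e where e: "e \<in> ?E" "e \<notin> S" using S by blast
    obtain ws where ws: "distinct ws" "set ws = set vs" "path_edges ws = cycle_edges vs - {e}"
      by (rule rotate_edge[OF assms e(1)])
    have "S \<subseteq> path_edges ws" unfolding ws(3) using S(1) e(2) by blast
    from free_rank_path[OF ws(1) this] show ?thesis unfolding ws(2) .
  qed
  have "comps ?V ?E = {?V}"
  proof -
    have "(x, y) \<in> conn ?E" if "x \<in> ?V" "y \<in> ?V" for x y
      using conn_path_all[OF that] conn_mono[of "path_edges vs" ?E] by (auto simp: cycle_edges_def)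
    moreover have "\<Union>?E \<subseteq> ?V"
      by (rule Union_cycle_edges) (use assms(2) in auto)
    ultimately have *: "conn ?E `` {x} = ?V" if "x \<in> ?V" for x
      using that conn_in[of x _ ?E ?V] by blast
    have "comps ?V ?E = (\<lambda>x. conn ?E `` {x}) ` ?V"
      unfolding comps_def quotient_def by blast
    also have "\<dots> = (\<lambda>x. ?V) ` ?V"
      by (rule image_cong[OF refl *])
    also have "\<dots> = {?V}"
      by (rule image_constant_conv[THEN trans]) (use assms(2) in auto)
    finally show ?thesis .
  qed
  then have rankE: "free_rank ?V ?E {} = int (card ?E) - 1"
    by (simp add: free_rank_def free_comps_def distinct_card assms card_cycle_edges)
  have "(\<Sum>S\<in>Pow ?E. (- 1) ^ card S * free_rank ?V S {}) =
      (\<Sum>S\<in>Pow ?E. (- 1) ^ card S * int (card S) - (if S = ?E then (- 1) ^ card ?E else 0))"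
  proof (rule sum.cong[OF refl])
    fix S assume "S \<in> Pow ?E"
    then show "(- 1) ^ card S * free_rank ?V S {} =
        (- 1) ^ card S * int (card S) - (if S = ?E then (- 1) ^ card ?E else 0)"
      using rank[of S] rankE by (cases "S = ?E") (simp_all add: right_diff_distrib)
  qed
  also have "\<dots> = 0 - (- 1) ^ card ?E"
  proof -
    have "2 \<le> card ?E" using card_cycle_edges[OF assms] assms(2) by simp
    then have "(\<Sum>S\<in>Pow ?E. (- 1) ^ card S * int (card S)) = 0" by (rule sum_Pow_sign_card[OF fin])
    moreover have "(\<Sum>S\<in>Pow ?E. if S = ?E then (- 1) ^ card ?E else 0) = (- 1 :: int) ^ card ?E"
      using sum.delta[of "Pow ?E" ?E "\<lambda>_. (- 1 :: int) ^ card ?E"] fin by simp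
    ultimately show ?thesis by (simp only: sum_subtractf)
  qed
  finally show ?thesis
    unfolding coeff1_def using card_cycle_edges[OF assms] by (simp add: sep_def)
qed

text \<open>Marking \<open>r\<close> takes its component out of \<open>free_rank\<close>, a loss of
  1 for each \<open>w \<noteq> r\<close> joined to \<open>r\<close>. The signed number of sets
  joining \<open>r\<close> and \<open>w\<close> is minus that of the sets separating them, because
  all signs sum to 0.\<close>

lemma coeff1_singleton:
  assumes "finite V" "\<Union>E \<subseteq> V" "r \<in> V" "E \<noteq> {}"
  shows "coeff1 V E {r} = coeff1 V E {} - (\<Sum>w\<in>V - {r}. coeff0 E {r, w})"
proof -
  have finE: "finite E" using finite_subset[of E "Pow V"] assms(1,2) by blast
  have rank: "free_rank V S {} = free_rank V S {r} + (\<Sum>w\<in>V - {r}. if (r, w) \<in> conn S then 1 else 0)"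
    if S: "S \<in> Pow E" for S
  proof -
    let ?C = "conn S `` {r}"
    have U: "\<Union>S \<subseteq> V" using S assms(2) by blast
    have C: "?C \<in> comps V S" using assms(3) by (auto simp: comps_iff)
    have "free_comps V S {r} = comps V S - {?C}"
    proof (intro set_eqI)
      fix D
      have "r \<in> D \<longleftrightarrow> D = ?C" if D: "D \<in> comps V S"
      proof
        assume r: "r \<in> D"
        then show "D = ?C" using comps_conn[OF D r] by (simp add: set_eq_iff)
      qed simp
      then show "D \<in> free_comps V S {r} \<longleftrightarrow> D \<in> comps V S - {?C}"
        by (auto simp: free_comps_def)
    qed
    moreover have "free_comps V S {} = comps V S" by (simp add: free_comps_def)
    ultimately have "free_rank V S {} = (int (card ?C) - 1) + free_rank V S {r}"
      unfolding free_rank_def by (simp add: sum.remove[OF finite_comps[OF assms(1)] C])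
    moreover have "(\<Sum>w\<in>V - {r}. if (r, w) \<in> conn S then 1 else 0) = int (card ?C) - 1"
    proof -
      have "{w \<in> V - {r}. (r, w) \<in> conn S} = ?C - {r}"
        using comps_subset[OF C U] by blast
      moreover have "card (?C - {r}) = card ?C - 1" by (simp add: card_Diff_singleton)
      moreover have "0 < card ?C"
        using finite_comp[OF assms(1) U C] by (auto simp: card_gt_0_iff intro: conn_refl)
      ultimately show ?thesis
        using assms(1) by (simp add: sum.inter_filter[symmetric] of_nat_diff)
    qed
    ultimately show ?thesis by simp
  qed
  have pair: "(\<Sum>S\<in>Pow E. if (r, w) \<in> conn S then (- 1) ^ card S else 0) = - coeff0 E {r, w}"
    if w: "w \<in> V - {r}" for w
  proof -
    have "sep S {r, w} \<longleftrightarrow> (r, w) \<notin> conn S" for S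
      using w conn_sym[of w r S] unfolding sep_def by auto
    then have "coeff0 E {r, w} + (\<Sum>S\<in>Pow E. if (r, w) \<in> conn S then (- 1) ^ card S else 0) =
        (\<Sum>S\<in>Pow E. (- 1) ^ card S)"
      unfolding coeff0_def sum.distrib[symmetric] by (intro sum.cong) auto
    then show ?thesis using sum_Pow_sign[OF finE, where 'b = int] assms(4) by simp
  qed
  have "(\<Sum>S\<in>Pow E. (- 1) ^ card S * free_rank V S {}) =
      (\<Sum>S\<in>Pow E. (- 1) ^ card S * free_rank V S {r}) +
      (\<Sum>S\<in>Pow E. \<Sum>w\<in>V - {r}. if (r, w) \<in> conn S then (- 1) ^ card S else 0)"
    unfolding sum.distrib[symmetric]
    by (intro sum.cong refl) (simp add: rank distrib_left sum_distrib_left if_distrib cong: if_cong)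
  also have "(\<Sum>S\<in>Pow E. \<Sum>w\<in>V - {r}. if (r, w) \<in> conn S then (- 1) ^ card S else 0) =
      (\<Sum>w\<in>V - {r}. - coeff0 E {r, w})"
    by (subst sum.swap) (rule sum.cong[OF refl pair])
  finally show ?thesis
    by (simp add: coeff1_def sep_def sum_negf)
qed

lemma cycle_signed1_pos:
  assumes "distinct vs" "3 \<le> length vs" "r \<in> set vs" "L \<subseteq> {r}"
  shows "0 < signed1 (set vs) (cycle_edges vs) L"
proof -
  let ?E = "cycle_edges vs" and ?V = "set vs"
  have n: "card ?V = length vs" by (rule distinct_card[OF assms(1)])
  consider "L = {}" | "L = {r}" using assms(4) by blast
  then show ?thesis
  proof cases
    case 1
    then show ?thesis by (simp add: signed1_def cycle_coeff1_empty assms n flip: power_add)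
  next
    case 2
    \<comment> \<open>There will be \<open>k + 1\<close> terms, one for each
      \<open>w \<noteq> r\<close>; each is a positive integer, so together they outweigh the single
      -1 coming from the empty marking.\<close>
    obtain k where k: "length vs = Suc (Suc k)" "1 \<le> k"
      using assms(2) that by (metis Suc_le_D Suc_le_mono numeral_3_eq_3 One_nat_def)
    have E: "\<Union>?E \<subseteq> ?V" "?E \<noteq> {}"
      by (rule Union_cycle_edges) (use assms(2) in \<open>auto simp: cycle_edges_def\<close>)
    have "card (?V - {r}) = Suc k" using n k assms(3) by simp
    have pos: "1 \<le> (- 1) ^ k * coeff0 ?E {r, w}" if w: "w \<in> ?V - {r}" for w
    proof -
      have "card {r, w} = 2" using w by auto
      then have "card (?V - {r, w}) = k"
        using w assms(3) n k by (simp add: card_Diff_subset)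
      moreover have "0 < signed0 ?V ?E {r, w}"
        using w assms by (intro cycle_signed0_pos) auto
      ultimately show ?thesis by (simp add: signed0_def)
    qed
    have "signed1 ?V ?E L = (- 1) ^ Suc k * ((- 1) ^ Suc (Suc k) - (\<Sum>w\<in>?V - {r}. coeff0 ?E {r, w}))"
      using coeff1_singleton[OF _ E(1) assms(3) E(2)] cycle_coeff1_empty[OF assms(1,2)]
        \<open>card (?V - {r}) = Suc k\<close> k 2 by (simp add: signed1_def)
    also have "\<dots> = (\<Sum>w\<in>?V - {r}. (- 1) ^ k * coeff0 ?E {r, w}) - 1"
      by (simp add: algebra_simps sum_distrib_left sum_negf flip: power_add)
    finally have "signed1 ?V ?E L = (\<Sum>w\<in>?V - {r}. (- 1) ^ k * coeff0 ?E {r, w}) - 1" .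
    moreover have "(\<Sum>w\<in>?V - {r}. 1) \<le> (\<Sum>w\<in>?V - {r}. (- 1) ^ k * coeff0 ?E {r, w})"
      by (rule sum_mono[OF pos])
    moreover have "(\<Sum>w\<in>?V - {r}. 1 :: int) = int (Suc k)"
      using \<open>card (?V - {r}) = Suc k\<close> by simp
    ultimately show ?thesis using k(2) by linarith
  qed
qed

section \<open>Structure of connected unicyclic graphs\<close>

lemma path_edges_nth: "path_edges xs = {{xs ! i, xs ! Suc i} | i. Suc i < length xs}"
proof (induction xs rule: path_edges.induct)
  case (1 x y zs)
  have "{{(x # y # zs) ! i, (x # y # zs) ! Suc i} | i. Suc i < length (x # y # zs)} =
      insert {x, y} {{(y # zs) ! i, (y # zs) ! Suc i} | i. Suc i < length (y # zs)}" (is "?A = insert _ ?B")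
  proof (intro set_eqI iffI)
    fix e assume "e \<in> ?A"
    then obtain i where i: "e = {(x # y # zs) ! i, (x # y # zs) ! Suc i}" "Suc i < length (x # y # zs)" by blast
    then show "e \<in> insert {x, y} ?B" by (cases i) auto
  next
    fix e assume "e \<in> insert {x, y} ?B"
    then consider "e = {x, y}" | i where "e = {(y # zs) ! i, (y # zs) ! Suc i}" "Suc i < length (y # zs)" by blast
    then show "e \<in> ?A"
    proof cases
      case 1
      then show ?thesis by (intro CollectI exI[of _ 0]) simp
    next
      case 2
      then show ?thesis by (intro CollectI exI[of _ "Suc i"]) simp
    qed
  qed
  then show ?case using 1 by (simp add: insert_commute)
qed auto

lemma cycle_graph_eq: "vs \<noteq> [] \<Longrightarrow> cycle_graph vs = (set vs, cycle_edges vs)"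
proof -
  assume ne: "vs \<noteq> []"
  have "{{vs ! i, vs ! (Suc i mod length vs)} | i. i < length vs} =
      insert {last vs, hd vs} {{vs ! i, vs ! Suc i} | i. Suc i < length vs}" (is "?A = insert ?e ?B")
  proof (intro set_eqI iffI)
    fix e assume "e \<in> ?A"
    then obtain i where i: "e = {vs ! i, vs ! (Suc i mod length vs)}" "i < length vs" by blast
    show "e \<in> insert ?e ?B"
    proof (cases "Suc i < length vs")
      case True
      then show ?thesis using i by auto
    next
      case False
      then have "i = length vs - 1" using i(2) by simp
      then have "e = ?e" using i(1) ne by (simp add: last_conv_nth hd_conv_nth)
      then show ?thesis by simp
    qed
  next
    fix e assume "e \<in> insert ?e ?B"
    then consider "e = ?e" | i where "e = {vs ! i, vs ! Suc i}" "Suc i < length vs" by blast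
    then show "e \<in> ?A"
    proof cases
      case 1
      then show ?thesis
        using ne by (intro CollectI exI[of _ "length vs - 1"]) (simp add: last_conv_nth hd_conv_nth)
    next
      case 2
      then show ?thesis by (intro CollectI exI[of _ i]) simp
    qed
  qed
  then show ?thesis
    by (simp add: cycle_graph_def cycle_edges_def path_edges_nth)
qed

lemma path_edges_suffix: "path_edges (a # q) \<subseteq> path_edges (p @ a # q)"
  by (cases "p = []") (auto simp: path_edges_append)

lemma conn_imp_path:
  assumes "(a, b) \<in> conn F" "\<Union>F \<subseteq> V" "b \<in> V"
  shows "\<exists>xs. xs \<noteq> [] \<and> distinct xs \<and> hd xs = a \<and> last xs = b \<and> path_edges xs \<subseteq> F \<and> set xs \<subseteq> V"
  using assms(1) unfolding conn_def
proof (induction rule: converse_rtrancl_induct)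
  case base
  show ?case using assms(3) by (intro exI[of _ "[b]"]) simp
next
  case (step a c)
  then obtain xs where xs: "xs \<noteq> []" "distinct xs" "hd xs = c" "last xs = b" "path_edges xs \<subseteq> F" "set xs \<subseteq> V"
    by blast
  have ac: "{a, c} \<in> F" using step(1) by simp
  show ?case
  proof (cases "a \<in> set xs")
    case False
    obtain ys where ys: "xs = c # ys" using xs(1,3) by (cases xs) auto
    have "path_edges (a # xs) \<subseteq> F" using xs(5) ac unfolding ys by (simp add: insert_commute)
    moreover have "a \<in> V" using ac assms(2) by blast
    ultimately show ?thesis
      using xs False by (intro exI[of _ "a # xs"]) simp
  next
    case True
    \<comment> \<open>The path already passes through \<open>a\<close>, so it is cut off there to
      stay distinct.\<close>
    then obtain p q where pq: "xs = p @ a # q" by (meson split_list)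
    have "path_edges (a # q) \<subseteq> F" using path_edges_suffix[of a q p] xs(5) pq by blast
    then show ?thesis
      using xs pq by (intro exI[of _ "a # q"]) auto
  qed
qed

lemma grown_conn:
  assumes "grown V0 E0 V E" "\<And>x y. x \<in> V0 \<Longrightarrow> y \<in> V0 \<Longrightarrow> (x, y) \<in> conn E0" "r \<in> V0" "x \<in> V"
  shows "(x, r) \<in> conn E"
  using assms(1,4)
proof (induction arbitrary: x rule: grown.induct)
  case base
  then show ?case using assms(2,3) by blast
next
  case (step V E u v)
  have sub: "conn E \<subseteq> conn (insert {u, v} E)" by (rule conn_mono) auto
  show ?case
  proof (cases "x = v")
    case True
    have "(v, u) \<in> conn (insert {u, v} E)" by (rule conn_sym, rule conn_edge) simp
    moreover have "(u, r) \<in> conn (insert {u, v} E)" using step.IH[OF step.hyps(2)] sub by blast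
    ultimately show ?thesis unfolding True by (rule conn_trans)
  next
    case False
    then show ?thesis using step sub by blast
  qed
qed

text \<open>Greedy growth: if no edge left \<open>W\<close>, membership in \<open>W\<close> would be
  constant along edges, although every vertex is connected to \<open>r \<in> W\<close>.\<close>

lemma grown_extend:
  assumes "finite V" "\<Union>E \<subseteq> V" "\<And>x. x \<in> V \<Longrightarrow> (x, r) \<in> conn E" "r \<in> W"
    and "grown V0 E0 W F" "F \<subseteq> E" "W \<subseteq> V"
  shows "\<exists>F'. grown V0 E0 V F' \<and> F' \<subseteq> E"
  using assms(4-7)
proof (induction "card (V - W)" arbitrary: W F rule: less_induct)
  case less
  show ?case
  proof (cases "W = V")
    case True
    then show ?thesis using less.prems by blast
  next
    case False
    then obtain x where x: "x \<in> V" "x \<notin> W" using less.prems by blast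
    have "\<exists>p q. {p, q} \<in> E \<and> p \<in> W \<and> q \<notin> W"
    proof (rule ccontr)
      assume no: "\<not> ?thesis"
      have "(x \<in> W) = (r \<in> W)"
        using assms(3)[OF x(1)]
      proof (rule conn_invariant)
        fix p q assume "{p, q} \<in> E"
        moreover from this have "{q, p} \<in> E" by (simp add: insert_commute)
        ultimately show "(p \<in> W) = (q \<in> W)" using no by blast
      qed
      then show False using x less.prems(1) by blast
    qed
    then obtain p q where pq: "{p, q} \<in> E" "p \<in> W" "q \<notin> W" by blast
    have q: "q \<in> V" using pq(1) assms(2) by blast
    have "card (V - insert q W) < card (V - W)"
      using assms(1) q pq(3) by (intro psubset_card_mono) auto
    moreover have "grown V0 E0 (insert q W) (insert {p, q} F)"
      by (rule grown.step[OF less.prems(2) pq(2,3)])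
    ultimately show ?thesis
      using less.hyps[of "insert q W" "insert {p, q} F"] less.prems pq(1) q by blast
  qed
qed

text \<open>Grow a spanning subgraph \<open>F\<close> of \<open>G\<close> from the cycle. An edge
  outside \<open>F\<close> would close a path of \<open>F\<close> to a cycle through that edge,
  which differs from \<open>C\<close> because \<open>F\<close> contains all edges of
  \<open>C\<close>.\<close>

lemma unicyclic_grown:
  assumes G: "simple_graph G" "connected_graph G" "unicyclic G" and C: "is_cycle_in C G"
    and vs: "distinct vs" "3 \<le> length vs" "C = cycle_graph vs"
  shows "grown (set vs) (cycle_edges vs) (verts G) (edges G)"
proof -
  let ?V = "verts G" and ?E = "edges G" and ?W = "set vs" and ?D = "cycle_edges vs"
  have ne: "vs \<noteq> []" using vs(2) by auto
  have CG: "C = (?W, ?D)" using vs(3) cycle_graph_eq[OF ne] by simp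
  have sub: "?W \<subseteq> ?V" "?D \<subseteq> ?E" using C CG by (auto simp: is_cycle_in_def)
  have fin: "finite ?V" and U: "\<Union>?E \<subseteq> ?V" and card2: "\<And>e. e \<in> ?E \<Longrightarrow> card e = 2"
    using G(1) by (auto simp: simple_graph_def)
  have adj: "(adj_rel G)\<^sup>* = conn ?E" by (simp add: adj_rel_def conn_def)
  have r: "last vs \<in> ?W" using ne by simp
  have conn: "(x, last vs) \<in> conn ?E" if "x \<in> ?V" for x
    using G(2) that r sub(1) unfolding connected_graph_def adj by blast
  obtain F where F: "grown ?W ?D ?V F" "F \<subseteq> ?E"
    using grown_extend[OF fin U conn r grown.base sub(2,1)] by blast
  have UE0: "\<Union>?D \<subseteq> ?W" by (rule Union_cycle_edges[OF ne])
  note b = grown_basic[OF F(1) _ UE0]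
  have c0: "(x, y) \<in> conn ?D" if "x \<in> ?W" "y \<in> ?W" for x y
    using conn_path_all[OF that] conn_mono[of "path_edges vs" ?D] by (auto simp: cycle_edges_def)
  have "?E \<subseteq> F"
  proof (rule ccontr)
    assume "\<not> ?E \<subseteq> F"
    then obtain e where e: "e \<in> ?E" "e \<notin> F" by blast
    then obtain a c where ac: "e = {a, c}" "a \<noteq> c" using card2[OF e(1)] by (auto simp: card_2_iff)
    have V: "a \<in> ?V" "c \<in> ?V" using e(1) U ac by auto
    have "(a, c) \<in> conn F"
      using grown_conn[OF F(1) c0 r V(1)] grown_conn[OF F(1) c0 r V(2)] conn_sym conn_trans by metis
    then obtain xs where xs: "xs \<noteq> []" "distinct xs" "hd xs = a" "last xs = c" "path_edges xs \<subseteq> F" "set xs \<subseteq> ?V"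
      using conn_imp_path[of a c F ?V] b(2) V by auto
    have len: "3 \<le> length xs"
    proof (rule ccontr)
      assume "\<not> 3 \<le> length xs"
      then consider x where "xs = [x]" | x y where "xs = [x, y]"
        using xs(1) by (cases xs; cases "tl xs"; cases "tl (tl xs)") auto
      then show False
      proof cases
        case 1
        then show ?thesis using xs ac by simp
      next
        case 2
        then show ?thesis using xs ac e(2) by (simp add: insert_commute)
      qed
    qed
    have "cycle_graph xs = (set xs, cycle_edges xs)" by (rule cycle_graph_eq[OF xs(1)])
    moreover have "cycle_edges xs \<subseteq> ?E"
      using xs(3-5) F(2) e(1) ac by (auto simp: cycle_edges_def insert_commute)
    ultimately have "is_cycle_in (cycle_graph xs) G"
      unfolding is_cycle_in_def using xs(2,6) len by auto
    then have "cycle_graph xs = C" using G(3) C unfolding unicyclic_def by blast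
    then have "cycle_edges xs = ?D" using CG cycle_graph_eq[OF xs(1)] by simp
    moreover have "e \<in> cycle_edges xs" using xs(3,4) ac by (auto simp: cycle_edges_def)
    ultimately show False using e(2) b(4) by auto
  qed
  then show ?thesis using F by (simp add: subset_antisym)
qed

section \<open>Degrees and removal of the leaves\<close>

lemma degree_pendant:
  assumes "pendant V E u v"
  shows "edeg (insert {u, v} E) v = 1"
    and "edeg (insert {u, v} E) u = Suc (edeg E u)"
    and "x \<noteq> u \<Longrightarrow> x \<noteq> v \<Longrightarrow> {e \<in> insert {u, v} E. x \<in> e} = {e \<in> E. x \<in> e}"
proof -
  interpret pendant V E u v by (rule assms)
  have "{e \<in> insert {u, v} E. v \<in> e} = {{u, v}}" using E v by blast
  then show "edeg (insert {u, v} E) v = 1" by simp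
  have "{e \<in> insert {u, v} E. u \<in> e} = insert {u, v} {e \<in> E. u \<in> e}" by blast
  then show "edeg (insert {u, v} E) u = Suc (edeg E u)"
    using finE new by simp
  show "x \<noteq> u \<Longrightarrow> x \<noteq> v \<Longrightarrow> {e \<in> insert {u, v} E. x \<in> e} = {e \<in> E. x \<in> e}" by blast
qed

lemma grown_degree_pos:
  assumes "grown V0 E0 V E" "finite V0" "\<Union>E0 \<subseteq> V0"
    and "\<And>x. x \<in> V0 \<Longrightarrow> 2 \<le> edeg E0 x" "x \<in> V"
  shows "1 \<le> edeg E x"
  using assms(1,5)
proof (induction arbitrary: x rule: grown.induct)
  case base
  then show ?case using assms(4)[of x] by simp
next
  case (step V E u v)
  note b = grown_basic[OF step.hyps(1) assms(2,3)]
  have p: "pendant V E u v" using b step.hyps by unfold_locales auto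
  consider "x = v" | "x = u" | "x \<noteq> u" "x \<noteq> v" by blast
  then show ?case
  proof cases
    case 3
    then show ?thesis using step.IH[of x] step.prems degree_pendant(3)[OF p 3] by simp
  qed (use degree_pendant[OF p] in simp_all)
qed

text \<open>\<open>U\<close> is a mere subset of the degree-one vertices because in the induction,
  removing \<open>v\<close> may turn \<open>u\<close> into a new leaf that has to stay;
  \<open>u \<notin> U\<close> since its degree was at least 2. The second claim excludes an edge
  between two leaves, so each leaf hangs on a non-leaf.\<close>

lemma grown_remove_leaves:
  assumes "grown V0 E0 V E" "finite V0" "\<Union>E0 \<subseteq> V0"
    and deg: "\<And>x. x \<in> V0 \<Longrightarrow> 2 \<le> edeg E0 x"
    and "{} \<notin> E0" "U \<subseteq> {x \<in> V. edeg E x = 1}"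
  shows "grown V0 E0 (V - U) {e \<in> E. e \<inter> U = {}} \<and> (\<forall>e\<in>E. \<not> e \<subseteq> U)"
  using assms(1,6)
proof (induction arbitrary: U rule: grown.induct)
  case base
  have "U = {}" using base deg by fastforce
  then show ?case using assms(5) grown.base[of V0 E0] by auto
next
  case (step V E u v)
  note b = grown_basic[OF step.hyps(1) assms(2,3)]
  have p: "pendant V E u v" using b step.hyps by unfold_locales auto
  have uU: "u \<notin> U"
  proof
    assume "u \<in> U"
    then have "edeg (insert {u, v} E) u = 1" using step.prems by blast
    then show False
      using degree_pendant(2)[OF p] grown_degree_pos[OF step.hyps(1) assms(2,3) deg step.hyps(2)] by simp
  qed
  have "U - {v} \<subseteq> {x \<in> V. edeg E x = 1}"
  proof
    fix x assume x: "x \<in> U - {v}"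
    then have n: "x \<noteq> u" "x \<noteq> v" using uU by blast+
    have "x \<in> insert v V" "edeg (insert {u, v} E) x = 1"
      using x step.prems by blast+
    then show "x \<in> {x \<in> V. edeg E x = 1}"
      unfolding degree_pendant(3)[OF p n] using n(2) by blast
  qed
  note IH = step.IH[OF this]
  have vE: "v \<notin> e" if "e \<in> E" for e using that b(2) step.hyps(3) by blast
  have eq: "{e \<in> E. e \<inter> (U - {v}) = {}} = {e \<in> E. e \<inter> U = {}}" using vE by blast
  have "\<forall>e\<in>insert {u, v} E. \<not> e \<subseteq> U" using IH uU vE by blast
  moreover have "grown V0 E0 (insert v V - U) {e \<in> insert {u, v} E. e \<inter> U = {}}"
  proof (cases "v \<in> U")
    case True
    then have "insert v V - U = V - (U - {v})" "{e \<in> insert {u, v} E. e \<inter> U = {}} = {e \<in> E. e \<inter> U = {}}"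
      using step.hyps(3) by auto
    then show ?thesis using IH eq by simp
  next
    case False
    then have "insert v V - U = insert v (V - (U - {v}))"
      "{e \<in> insert {u, v} E. e \<inter> U = {}} = insert {u, v} {e \<in> E. e \<inter> U = {}}"
      using uU by auto
    moreover have "grown V0 E0 (insert v (V - (U - {v}))) (insert {u, v} {e \<in> E. e \<inter> (U - {v}) = {}})"
      by (rule grown.step) (use IH uU step.hyps in auto)
    ultimately show ?thesis using eq by simp
  qed
  ultimately show ?case by blast
qed

lemma cycle_degree:
  assumes "distinct vs" "3 \<le> length vs" "x \<in> set vs"
  shows "2 \<le> edeg (cycle_edges vs) x"
proof -
  obtain ws where ws: "distinct ws" "set ws = set vs" "length ws = length vs"
    "cycle_edges ws = cycle_edges vs" "last ws = x"
    by (rule rotate_last[OF assms(1,3)])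
  define ys where "ys = butlast ws"
  have "ws \<noteq> []" using ws(3) assms(2) by auto
  then have ys: "ws = ys @ [x]" using ws(5) unfolding ys_def by (metis append_butlast_last_id)
  have "ys \<noteq> []" using ys ws(3) assms(2) by auto
  then have e: "{x, last ys} \<in> path_edges ws" using path_edges_append[of ys "[x]"] ys by simp
  moreover have c: "{last ws, hd ws} \<notin> path_edges ws"
    by (rule closing_edge_notin) (use ws assms(2) in auto)
  ultimately have ne: "{x, last ys} \<noteq> {x, hd ws}" using ws(5) by auto
  have "{x, last ys} \<in> cycle_edges ws" "{x, hd ws} \<in> cycle_edges ws"
    using e ws(5) by (simp_all add: cycle_edges_def)
  then have "{{x, last ys}, {x, hd ws}} \<subseteq> {e \<in> cycle_edges vs. x \<in> e}"
    unfolding ws(4) by simp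
  then have "card {{x, last ys}, {x, hd ws}} \<le> edeg (cycle_edges vs) x"
    by (rule card_mono[rotated]) (simp add: finite_cycle_edges)
  then show ?thesis using ne by simp
qed

text \<open>Brings the roots into the shape of \<open>touched\<close>: a component has a second
  vertex precisely when some edge meets the root.\<close>

lemma nontrivial_roots_eq:
  assumes "simple_graph G" "verts C \<subseteq> verts G"
  shows "nontrivial_roots G C = {v \<in> verts C. \<exists>e\<in>edges G - edges C. v \<in> e}"
proof -
  let ?D = "edges G - edges C"
  have "1 < card (verts (rooted_tree G C v)) \<longleftrightarrow> (\<exists>e\<in>?D. v \<in> e)" if v: "v \<in> verts C" for v
  proof -
    have eq: "verts (rooted_tree G C v) = {u \<in> verts G. (v, u) \<in> conn ?D}"
      by (simp add: rooted_tree_def component_of_def Let_def adj_rel_def conn_def)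
    have vG: "v \<in> verts G" using v assms(2) by blast
    show ?thesis
    proof
      assume gt: "1 < card (verts (rooted_tree G C v))"
      show "\<exists>e\<in>?D. v \<in> e"
      proof (rule ccontr)
        assume "\<not> ?thesis"
        then have "v \<notin> \<Union>?D" by blast
        then have "{u \<in> verts G. (v, u) \<in> conn ?D} = {v}"
          using conn_isolated(1)[of v ?D] vG by auto
        then show False using gt eq by simp
      qed
    next
      assume "\<exists>e\<in>?D. v \<in> e"
      then obtain e where e: "e \<in> ?D" "v \<in> e" by blast
      then have e2: "card e = 2" "e \<subseteq> verts G" using assms(1) by (auto simp: simple_graph_def)
      then obtain w where w: "e = {v, w}" "w \<noteq> v"
        using e(2) by (auto simp: card_2_iff insert_commute)
      have "(v, w) \<in> conn ?D" using e(1) w by (intro conn_edge) simp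
      then have "{v, w} \<subseteq> verts (rooted_tree G C v)" using eq e2(2) w by auto
      moreover have "finite (verts (rooted_tree G C v))"
        using assms(1) eq by (simp add: simple_graph_def)
      ultimately have "card {v, w} \<le> card (verts (rooted_tree G C v))" by (rule card_mono[rotated])
      then show "1 < card (verts (rooted_tree G C v))" using w(2) by auto
    qed
  qed
  then show ?thesis by (auto simp: nontrivial_roots_def)
qed

theorem corollary5p17:
  fixes G C :: "'a graph" and c :: nat
  assumes "simple_graph G" and "connected_graph G" and "unicyclic G"
    and "is_cycle_in C G" and "card (verts C) = c"
  shows "(card (nontrivial_roots G C) = 1 \<longrightarrow>
            int (card (leaves G)) =
              int (sum_list (leading_partition G)) - int (length (leading_partition G)) - 1) \<and>
         (card (nontrivial_roots G C) \<ge> 2 \<longrightarrow>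
            int (card (leaves G)) =
              int (sum_list (leading_partition G)) - int (length (leading_partition G)))"
proof -
  obtain vs where vs: "distinct vs" "3 \<le> length vs" "C = cycle_graph vs"
    using assms(4) by (auto simp: is_cycle_in_def)
  have ne: "vs \<noteq> []" using vs(2) by auto
  define V E V0 E0 U where "V = verts G" and "E = edges G" and "V0 = set vs" and "E0 = cycle_edges vs"
    and "U = leaves G"
  have C: "verts C = V0" "edges C = E0"
    using vs(3) cycle_graph_eq[OF ne] by (simp_all add: V0_def E0_def)
  have grown: "grown V0 E0 V E"
    unfolding V_def E_def V0_def E0_def by (rule unicyclic_grown[OF assms(1-4) vs])
  have fin0: "finite V0" and UE0: "\<Union>E0 \<subseteq> V0"
    by (simp_all add: V0_def E0_def Union_cycle_edges[OF ne])
  have deg: "2 \<le> edeg E0 x" if "x \<in> V0" for x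
    using cycle_degree[OF vs(1,2)] that by (simp add: V0_def E0_def)
  have simple: "finite V" "\<And>e. e \<in> E \<Longrightarrow> e \<subseteq> V \<and> card e = 2"
    using assms(1) by (auto simp: simple_graph_def V_def E_def)
  have U: "U = {x \<in> V. edeg E x = 1}"
    by (simp add: U_def leaves_def degree_def V_def E_def)
  define V' E' where "V' = V - U" and "E' = {e \<in> E. e \<inter> U = {}}"
  have grown': "grown V0 E0 V' E'" and nU: "\<And>e. e \<in> E \<Longrightarrow> \<not> e \<subseteq> U"
  proof -
    have "{} \<notin> E0" using grown_basic(4)[OF grown fin0 UE0] simple(2)[of "{}"] by auto
    then show "grown V0 E0 V' E'" "\<And>e. e \<in> E \<Longrightarrow> \<not> e \<subseteq> U"
      using grown_remove_leaves[OF grown fin0 UE0 deg, of U] U by (auto simp: V'_def E'_def)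
  qed
  note basic' = grown_basic[OF grown' fin0 UE0]
  have "\<exists>w. {w, u} \<in> E \<and> w \<in> V' \<and> {e \<in> E. u \<in> e} = {{w, u}}" if u: "u \<in> U" for u
  proof -
    obtain e where e: "{e \<in> E. u \<in> e} = {e}" using u U by (auto simp: card_1_singleton_iff)
    then have eE: "e \<in> E" "u \<in> e" by auto
    then obtain w where w: "e = {w, u}"
      using simple(2)[of e] by (auto simp: card_2_iff insert_commute)
    then have "w \<notin> U" using nU[OF eE(1)] u by blast
    then show ?thesis using e eE w simple(2)[OF eE(1)] by (auto simp: V'_def)
  qed
  then obtain b where bU: "\<And>u. u \<in> U \<Longrightarrow> {b u, u} \<in> E \<and> b u \<in> V' \<and> {e \<in> E. u \<in> e} = {{b u, u}}"
    by metis
  interpret leafy_graph V' U E' b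
  proof
    show "finite V'" "finite U" "V' \<inter> U = {}" using simple(1) U by (auto simp: V'_def)
    show "b u \<in> V'" if "u \<in> U" for u using bU[OF that] by blast
    show "e \<subseteq> V' \<and> card e = 2" if "e \<in> E'" for e
      using that simple(2)[of e] by (auto simp: E'_def V'_def)
  qed
  have leafE: "\<exists>u\<in>U. e = {b u, u}" if e: "e \<in> E" "e \<notin> E'" for e
  proof -
    obtain u where u: "u \<in> U" "u \<in> e" using e unfolding E'_def by blast
    then have "e \<in> {{b u, u}}" using bU[OF u(1)] e(1) by blast
    then show ?thesis using u(1) by blast
  qed
  have full: "full = G"
  proof -
    have "V' \<union> U = V" using U by (auto simp: V'_def)
    moreover have "E' \<union> (\<lambda>u. {b u, u}) ` U = E"
      using leafE bU by (auto simp: E'_def)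
    ultimately show ?thesis by (simp add: full_def V_def E_def)
  qed
  have leafy: "x \<in> leafy \<longleftrightarrow> (\<exists>u\<in>U. b u = x)" for x
  proof -
    have "0 < card {u \<in> U. b u = x} \<longleftrightarrow> (\<exists>u\<in>U. b u = x)"
      using finU by (auto simp: card_gt_0_iff)
    then show ?thesis using bU by (auto simp: leafy_def nleaves_def)
  qed
  \<comment> \<open>An edge at a cycle vertex that is not a cycle edge leads either to a non-leaf,
    so it survives in \<open>E'\<close>, or to a leaf, and then the vertex belongs to
    \<open>leafy\<close>.\<close>
  have touched: "touched V0 E0 E' leafy = nontrivial_roots G C"
  proof -
    have "(x \<in> leafy \<or> (\<exists>e\<in>E' - E0. x \<in> e)) \<longleftrightarrow> (\<exists>e\<in>E - E0. x \<in> e)" if x: "x \<in> V0" for x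
    proof
      assume "x \<in> leafy \<or> (\<exists>e\<in>E' - E0. x \<in> e)"
      then show "\<exists>e\<in>E - E0. x \<in> e"
      proof
        assume "x \<in> leafy"
        then obtain u where u: "u \<in> U" "b u = x" using leafy by blast
        have "u \<notin> V0" using u(1) basic'(3) by (auto simp: V'_def)
        then have "{b u, u} \<notin> E0" using UE0 by blast
        then show ?thesis using bU[OF u(1)] u(2) by blast
      next
        assume "\<exists>e\<in>E' - E0. x \<in> e"
        then show ?thesis by (auto simp: E'_def)
      qed
    next
      assume "\<exists>e\<in>E - E0. x \<in> e"
      then obtain e where e: "e \<in> E" "e \<notin> E0" "x \<in> e" by blast
      show "x \<in> leafy \<or> (\<exists>e\<in>E' - E0. x \<in> e)"
      proof (cases "e \<in> E'")
        case True
        then show ?thesis using e by blast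
      next
        case False
        then obtain u where u: "u \<in> U" "e = {b u, u}" using leafE e(1) by blast
        have "x \<noteq> u" using x u(1) basic'(3) by (auto simp: V'_def)
        then show ?thesis using u e(3) leafy by auto
      qed
    qed
    moreover have "verts C \<subseteq> verts G" using assms(4) by (simp add: is_cycle_in_def)
    ultimately show ?thesis
      unfolding nontrivial_roots_eq[OF assms(1) \<open>verts C \<subseteq> verts G\<close>] C touched_def E_def[symmetric] by blast
  qed
  \<comment> \<open>A vertex of \<open>V'\<close> carrying no leaf keeps all its edges, so degree
    one in \<open>E'\<close> would make it a leaf of \<open>G\<close>, and those were
    removed.\<close>
  have ends: "covers_ends V0 V' E' leafy"
    unfolding covers_ends_def
  proof (intro ballI impI, rule ccontr)
    fix x assume x: "x \<in> V' - V0" "edeg E' x = 1" "x \<notin> leafy"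
    have "e \<in> E'" if e: "e \<in> E" "x \<in> e" for e
    proof (rule ccontr)
      assume "e \<notin> E'"
      then obtain u where "u \<in> U" "e = {b u, u}" using leafE e(1) by blast
      then show False using e(2) x(1,3) leafy by (auto simp: V'_def)
    qed
    then have "{e \<in> E'. x \<in> e} = {e \<in> E. x \<in> e}" by (auto simp: E'_def)
    then have "x \<in> U" using x U by (auto simp: V'_def)
    then show False using x(1) by (simp add: V'_def)
  qed
  have sub: "leafy \<subseteq> V'" by (auto simp: leafy_def)
  have pos: "0 < signed0 V0 E0 L" if "L \<subseteq> V0" "2 \<le> card L" for L
    unfolding V0_def E0_def using cycle_signed0_pos[OF vs(1,2)] that by (simp add: V0_def)
  have nonneg: "0 \<le> signed0 V0 E0 L" if L: "L \<subseteq> V0" for L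
  proof (cases "2 \<le> card L")
    case True
    then show ?thesis using pos[OF L] by simp
  next
    case False
    then have "coeff0 E0 L = 0"
      unfolding E0_def using finite_subset[OF L fin0] by (intro cycle_coeff0_zero) auto
    then show ?thesis by (simp add: signed0_def)
  qed
  show ?thesis
  proof (intro conjI impI)
    assume "card (nontrivial_roots G C) = 1"
    then obtain r where r: "touched V0 E0 E' leafy = {r}"
      unfolding touched by (auto simp: card_1_singleton_iff)
    then have "r \<in> set vs" by (auto simp: touched_def V0_def)
    have "coeff0 E' leafy = 0 \<and> 0 \<le> signed1 V' E' leafy \<and> (covers_ends V0 V' E' leafy \<longrightarrow> 0 < signed1 V' E' leafy)"
    proof (rule grown_coeffs_one_touched[OF grown' fin0 UE0 _ _ sub])
      fix L assume L: "L \<subseteq> {r}"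
      have "finite L" "card L \<le> 1"
        using finite_subset[OF L] card_mono[OF _ L] by auto
      then show "coeff0 E0 L = 0" unfolding E0_def by (intro cycle_coeff0_zero)
      show "0 < signed1 V0 E0 L"
        unfolding V0_def E0_def by (rule cycle_signed1_pos[OF vs(1,2) \<open>r \<in> set vs\<close> L])
    qed (use r in simp)
    then have "coeff0 E' leafy = 0" "coeff1 V' E' leafy \<noteq> 0"
      using ends by (auto simp: signed1_def)
    from leading_partition_coeff1[OF this]
    show "int (card (leaves G)) =
        int (sum_list (leading_partition G)) - int (length (leading_partition G)) - 1"
      unfolding full U_def[symmetric] by linarith
  next
    assume "2 \<le> card (nontrivial_roots G C)"
    then have "0 < signed0 V' E' leafy"
      unfolding touched[symmetric]
      by (intro grown_signed0_pos[OF grown' fin0 UE0 nonneg pos sub ends])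
    then have "coeff0 E' leafy \<noteq> 0" by (auto simp: signed0_def)
    from leading_partition_coeff0[OF this]
    show "int (card (leaves G)) =
        int (sum_list (leading_partition G)) - int (length (leading_partition G))"
      unfolding full U_def[symmetric] by linarith
  qed
qed

end
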